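(* Suppose that $\mathbb F=(\mathcal F_t)_{t\ge0}$ is a filtration that satisfies the usual conditions. Let $(M_t)_{t\ge 0}$ be a convex and integrably bounded set-valued $\mathbb F$-submartingale such that $t\mapsto s(x^*,\mathbb E[M_t])$ is right-continuous for every $x^*\in\mathscr W$. Then it has a Hausdorff càdlàg modification $(\tilde M_t)_{t\ge 0}$, i.e., there is a convex and integrably bounded set-valued $\mathbb F$-submartingale $(\tilde M_t)_{t\ge 0}$ with $\mathbb P\{M_t=\tilde M_t\}=1$ for every $t\ge 0$ such that the following properties hold with probability one: (a) $\tilde M_{t-}$ exists for every $t>0$; (b) $\tilde M_{t+}$ exists and $\tilde M_t=\tilde M_{t+}$ for every $t\ge 0$. If, in addition, $(M_t)_{t\ge 0}$ is a set-valued $\mathbb F$-martingale, then so is $(\tilde M_t)_{t\ge 0}$.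
   Context: Sets. $\mathbb R^d$ carries the Euclidean inner product $\langle\cdot,\cdot\rangle$ and norm $|\cdot|$; $\mathbb B=\{x\in\mathbb R^d: |x|\le 1\}$. For nonempty closed $C,D\subseteq\mathbb R^d$: $d(x,C)=\inf_{y\in C}|x-y|$; the Hausdorff distance is $h(C,D)=\max\{\sup_{x\in C}d(x,D),\sup_{y\in D}d(y,C)\}$; $\|C\|=\sup_{x\in C}|x|$; the support function is $s(x^*,C)=\sup_{x\in C}\langle x^*,x\rangle$. "Hausdorff" limits and continuity are with respect to $h$. $\mathscr W$ is a fixed countable dense subset of $\mathbb B$ with $0\notin\mathscr W$. Set-valued random variables. $(\Omega,\mathcal F,\mathbb P)$ is a probability space, $\mathcal G\subseteq\mathcal F$ a sub-$\sigma$-algebra. A map $\Xi$ from $\Omega$ to the nonempty closed subsets of $\mathbb R^d$ is $\mathcal G$-measurable if $\{\omega:\Xi(\omega)\cap C\ne\emptyset\}\in\mathcal G$ for all closed $C$; such maps are identified up to a.s. equality. $S^1_{\mathcal G}(\Xi)$ is the set of $\mathcal G$-measurable integrable random vectors $\xi$ with $\xi\in\Xi$ a.s. $\Xi$ is integrable if $S^1_{\mathcal F}(\Xi)\neq\emptyset$ and integrably bounded if $\mathbb E[\|\Xi\|]<\infty$. $\mathbb E[\Xi]$ is the closure in $\mathbb R^d$ of $\{\mathbb E[\xi]:\xi\in S^1_{\mathcal F}(\Xi)\}$. $\mathbb E[\Xi|\mathcal G]$ is the a.s. unique $\mathcal G$-measurable integrable set-valued random variable such that $S^1_{\mathcal G}(\mathbb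 E[\Xi|\mathcal G])$ is the $L^1$-closure of $\{\mathbb E[\xi|\mathcal G]:\xi\in S^1_{\mathcal F}(\Xi)\}$. Processes. A set-valued process $(M_t)_{t\ge0}$ is a family of $\mathcal F$-measurable (closed nonempty valued) set-valued random variables; it is $\mathbb F$-adapted if each $M_t$ is $\mathcal F_t$-measurable, convex if each $M_t$ has convex values, integrable (integrably bounded) if each $M_t$ is. An $\mathbb F$-adapted integrable set-valued process is a set-valued $\mathbb F$-submartingale if $\mathbb E[M_t|\mathcal F_s]\supseteq M_s$ a.s. for all $s\le t$, and a set-valued $\mathbb F$-martingale if equality holds a.s. for all $s\le t$. The usual conditions: $\mathbb F$ is right-continuous and augmented (complete, with all $\mathbb P$-null sets in $\mathcal F_0$). One-sided limits. For a set-valued process $(N_t)_{t\ge0}$, $N_{t-}=\lim_{r\in\mathbb Q,\,r\uparrow t}N_r$ ($t>0$) and $N_{t+}=\lim_{r\in\mathbb Q,\,r\downarrow t}N_r$ ($t\ge0$), in the Hausdorff sense. *)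

theory Defs
  imports "HOL-Probability.Probability"
begin

section \<open>Closed sets\<close>

text \<open>
  The values are extended, since the sets need not be bounded. The definitions are only used
  for nonempty sets.
\<close>

definition hausdorff_distance :: "'b::metric_space set \<Rightarrow> 'b set \<Rightarrow> ennreal" where
  "hausdorff_distance C D =
     max (SUP x\<in>C. ennreal (infdist x D)) (SUP y\<in>D. ennreal (infdist y C))"

definition norm_of_set :: "'b::real_normed_vector set \<Rightarrow> ennreal" where
  "norm_of_set C = (SUP x\<in>C. ennreal (norm x))"

definition support_function :: "'b::real_inner \<Rightarrow> 'b set \<Rightarrow> ereal" where
  "support_function u C = (SUP x\<in>C. ereal (u \<bullet> x))"

definition hausdorff_limit :: "('i \<Rightarrow> 'b::metric_space set) \<Rightarrow> 'b set \<Rightarrow> 'i filter \<Rightarrow> bool" where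
  "hausdorff_limit N L A \<longleftrightarrow>
     closed L \<and> L \<noteq> {} \<and> ((\<lambda>r. hausdorff_distance (N r) L) \<longlongrightarrow> 0) A"


section \<open>Set-valued random variables\<close>

definition set_valued_rv :: "'a measure \<Rightarrow> ('a \<Rightarrow> 'b::topological_space set) \<Rightarrow> bool" where
  "set_valued_rv G X \<longleftrightarrow>
     (\<forall>\<omega>\<in>space G. closed (X \<omega>) \<and> X \<omega> \<noteq> {}) \<and>
     (\<forall>C. closed C \<longrightarrow> {\<omega> \<in> space G. X \<omega> \<inter> C \<noteq> {}} \<in> sets G)"

text \<open>
  Below, \<open>P\<close> is the probability measure and \<open>G\<close> a sub-\<open>\<sigma>\<close>-algebra, represented by a measure
  of which only the measurable sets matter; \<open>G = P\<close> gives the full \<open>\<sigma>\<close>-algebra.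
\<close>

definition integrable_selections ::
    "'a measure \<Rightarrow> 'a measure \<Rightarrow> ('a \<Rightarrow> 'b::euclidean_space set) \<Rightarrow> ('a \<Rightarrow> 'b) set" where
  "integrable_selections P G X =
     {\<xi>. \<xi> \<in> borel_measurable G \<and> integrable P \<xi> \<and> (AE \<omega> in P. \<xi> \<omega> \<in> X \<omega>)}"

definition set_rv_integrable :: "'a measure \<Rightarrow> ('a \<Rightarrow> 'b::euclidean_space set) \<Rightarrow> bool" where
  "set_rv_integrable P X \<longleftrightarrow> integrable_selections P P X \<noteq> {}"

definition set_rv_integrably_bounded :: "'a measure \<Rightarrow> ('a \<Rightarrow> 'b::euclidean_space set) \<Rightarrow> bool" where
  "set_rv_integrably_bounded P X \<longleftrightarrow> (\<integral>\<^sup>+ \<omega>. norm_of_set (X \<omega>) \<partial>P) < \<infinity>"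

definition set_expectation :: "'a measure \<Rightarrow> ('a \<Rightarrow> 'b::euclidean_space set) \<Rightarrow> 'b set" where
  "set_expectation P X = closure ((\<lambda>\<xi>. integral\<^sup>L P \<xi>) ` integrable_selections P P X)"

definition vector_cond_exp ::
    "'a measure \<Rightarrow> 'a measure \<Rightarrow> ('a \<Rightarrow> 'b::euclidean_space) \<Rightarrow> 'a \<Rightarrow> 'b" where
  "vector_cond_exp P G \<xi> = (\<lambda>\<omega>. \<Sum>b\<in>Basis. real_cond_exp P G (\<lambda>\<omega>'. \<xi> \<omega>' \<bullet> b) \<omega> *\<^sub>R b)"

text \<open>
  The closure is taken in the space of \<open>G\<close>-measurable integrable functions. Since these are
  functions rather than equivalence classes, it contains every \<open>G\<close>-measurable function that is
  almost surely equal to one of its members.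
\<close>

definition L1_closure ::
    "'a measure \<Rightarrow> 'a measure \<Rightarrow> ('a \<Rightarrow> 'b::euclidean_space) set \<Rightarrow> ('a \<Rightarrow> 'b) set" where
  "L1_closure P G A =
     {\<eta>. \<eta> \<in> borel_measurable G \<and> integrable P \<eta> \<and>
         (\<forall>\<epsilon>>0. \<exists>\<zeta>\<in>A. (\<integral>\<omega>. norm (\<eta> \<omega> - \<zeta> \<omega>) \<partial>P) < \<epsilon>)}"

text \<open>
  \<open>Y\<close> is a version of the conditional expectation of \<open>X\<close> given \<open>G\<close>. As it is determined only up
  to almost sure equality, it is rendered as a relation.
\<close>

definition has_set_cond_exp ::
    "'a measure \<Rightarrow> 'a measure \<Rightarrow> ('a \<Rightarrow> 'b::euclidean_space set) \<Rightarrow> ('a \<Rightarrow> 'b set) \<Rightarrow> bool" where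
  "has_set_cond_exp P G X Y \<longleftrightarrow>
     set_valued_rv G Y \<and> set_rv_integrable P Y \<and>
     integrable_selections P G Y =
       L1_closure P G (vector_cond_exp P G ` integrable_selections P P X)"


section \<open>Filtrations and set-valued processes\<close>

text \<open>Time is the half-line of nonnegative reals; values at negative times are irrelevant.\<close>

definition is_filtration :: "'a measure \<Rightarrow> (real \<Rightarrow> 'a measure) \<Rightarrow> bool" where
  "is_filtration P F \<longleftrightarrow>
     (\<forall>t\<ge>0. subalgebra P (F t)) \<and> (\<forall>s\<ge>0. \<forall>t\<ge>s. sets (F s) \<subseteq> sets (F t))"

definition usual_conditions :: "'a measure \<Rightarrow> (real \<Rightarrow> 'a measure) \<Rightarrow> bool" where
  "usual_conditions P F \<longleftrightarrow>
     (\<forall>t\<ge>0. sets (F t) = (\<Inter>u\<in>{t<..}. sets (F u))) \<and>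
     complete_measure P \<and> null_sets P \<subseteq> sets (F 0)"

definition set_adapted :: "(real \<Rightarrow> 'a measure) \<Rightarrow> (real \<Rightarrow> 'a \<Rightarrow> 'b::euclidean_space set) \<Rightarrow> bool" where
  "set_adapted F M \<longleftrightarrow> (\<forall>t\<ge>0. set_valued_rv (F t) (M t))"

definition convex_process :: "'a measure \<Rightarrow> (real \<Rightarrow> 'a \<Rightarrow> 'b::euclidean_space set) \<Rightarrow> bool" where
  "convex_process P M \<longleftrightarrow> (\<forall>t\<ge>0. \<forall>\<omega>\<in>space P. convex (M t \<omega>))"

definition integrable_process :: "'a measure \<Rightarrow> (real \<Rightarrow> 'a \<Rightarrow> 'b::euclidean_space set) \<Rightarrow> bool" where
  "integrable_process P M \<longleftrightarrow> (\<forall>t\<ge>0. set_rv_integrable P (M t))"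

definition integrably_bounded_process ::
    "'a measure \<Rightarrow> (real \<Rightarrow> 'a \<Rightarrow> 'b::euclidean_space set) \<Rightarrow> bool" where
  "integrably_bounded_process P M \<longleftrightarrow> (\<forall>t\<ge>0. set_rv_integrably_bounded P (M t))"

definition set_submartingale ::
    "'a measure \<Rightarrow> (real \<Rightarrow> 'a measure) \<Rightarrow> (real \<Rightarrow> 'a \<Rightarrow> 'b::euclidean_space set) \<Rightarrow> bool" where
  "set_submartingale P F M \<longleftrightarrow>
     set_adapted F M \<and> integrable_process P M \<and>
     (\<forall>s\<ge>0. \<forall>t\<ge>s. \<exists>Y. has_set_cond_exp P (F s) (M t) Y \<and> (AE \<omega> in P. M s \<omega> \<subseteq> Y \<omega>))"

definition set_martingale ::
    "'a measure \<Rightarrow> (real \<Rightarrow> 'a measure) \<Rightarrow> (real \<Rightarrow> 'a \<Rightarrow> 'b::euclidean_space set) \<Rightarrow> bool" where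
  "set_martingale P F M \<longleftrightarrow>
     set_adapted F M \<and> integrable_process P M \<and>
     (\<forall>s\<ge>0. \<forall>t\<ge>s. \<exists>Y. has_set_cond_exp P (F s) (M t) Y \<and> (AE \<omega> in P. Y \<omega> = M s \<omega>))"

text \<open>One-sided limits, along rational times, of a path \<open>N\<close>.\<close>

definition has_left_limit :: "(real \<Rightarrow> 'b::metric_space set) \<Rightarrow> real \<Rightarrow> 'b set \<Rightarrow> bool" where
  "has_left_limit N t L \<longleftrightarrow> hausdorff_limit N L (at t within (\<rat> \<inter> {0..<t}))"

definition has_right_limit :: "(real \<Rightarrow> 'b::metric_space set) \<Rightarrow> real \<Rightarrow> 'b set \<Rightarrow> bool" where
  "has_right_limit N t L \<longleftrightarrow> hausdorff_limit N L (at t within (\<rat> \<inter> {t<..}))"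

definition hausdorff_cadlag :: "(real \<Rightarrow> 'b::metric_space set) \<Rightarrow> bool" where
  "hausdorff_cadlag N \<longleftrightarrow>
     (\<forall>t>0. \<exists>L. has_left_limit N t L) \<and>
     (\<forall>t\<ge>0. \<exists>L. has_right_limit N t L \<and> N t = L)"

end

theory Submission
  imports Defs
begin

text \<open>
  For every direction \<open>u\<close> the support values \<open>s(u, M\<^sub>t)\<close> form a real submartingale: the nearest
  point of \<open>M\<^sub>s\<close> to \<open>k u\<close> is a measurable selection which nearly maximizes \<open>u \<bullet> x\<close>, it is also a
  selection of the conditional expectation of \<open>M\<^sub>t\<close>, and so its inner product with \<open>u\<close> is at
  most the conditional expectation of \<open>s(u, M\<^sub>t)\<close>. All submartingale inequalities are used in
  integrated form, over events of the past. Doob's maximal and upcrossing inequalities give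
  one-sided limits of the support values along the rationals, simultaneously for a countable dense
  set of directions, and local boundedness of the sets. Since support functions of bounded sets
  are equi-Lipschitz, this yields one-sided Hausdorff limits. Right continuity of the means
  together with uniform integrability identifies the right limit of \<open>s(u, M\<^sub>r)\<close> at \<open>t\<close> with
  \<open>s(u, M\<^sub>t)\<close>, so the process of right limits is a modification; all other properties are
  invariant under almost sure equality because the filtration contains the null sets.
\<close>

section \<open>Support values and Hausdorff limits\<close>

text \<open>Passing to a later time bounds a real submartingale from above only, but local
  boundedness and uniform integrability to the right of \<open>t\<close> need two-sided control.
  Sets supply it: -s(u, C) <= s(-u, C), and s(-u, M_t) is a submartingale as well. So upper bounds
  in the finitely many directions +b and -b confine the whole set, and on an event of the past the
  integral of |s(u, M_r)| is at most that of |s(u, M_T)| + |s(-u, M_T)| for one later time T. The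
  limits must exist at uncountably many times off a single null set. Chance therefore enters only
  through countably many events, indexed by horizons, directions, rational times and rational
  levels; off these, existence of the limits is a deterministic argument. By contrast, the right
  limit is identified with M_t for one \<open>t\<close> at a time, with a null set depending on
  \<open>t\<close>, which is all that a modification asks. The right limit is chosen path by path
  without regard to measurability, which is recovered from the almost sure equality with
  M_t.\<close>

definition support_value :: "'b::real_inner \<Rightarrow> 'b set \<Rightarrow> real" where
  "support_value u C = real_of_ereal (support_function u C)"

text \<open>\<open>support_value\<close> returns 0 where the supremum is infinite, which can happen
  for unbounded sets and does for the empty one. Boundedness and nonemptiness make it faithful, and
  the later lemmas carry them for this reason.\<close>

lemma support_function_bounded:
  assumes "bounded C" "C \<noteq> {}"
  shows "support_function u C = ereal (support_value u C)"
proof -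
  obtain K where K: "\<And>x. x \<in> C \<Longrightarrow> norm x \<le> K"
    using assms(1) by (auto simp: bounded_iff)
  have b: "\<bar>u \<bullet> x\<bar> \<le> norm u * K" if "x \<in> C" for x
    using K[OF that] Cauchy_Schwarz_ineq2[of u x] mult_left_mono[of "norm x" K "norm u"] by simp
  have "support_function u C \<le> ereal (norm u * K)"
    unfolding support_function_def using b by (intro SUP_least) (auto simp: abs_le_iff)
  moreover obtain x where "x \<in> C" using assms(2) by auto
  then have "ereal (u \<bullet> x) \<le> support_function u C"
    unfolding support_function_def by (intro SUP_upper)
  ultimately have "\<bar>support_function u C\<bar> \<noteq> \<infinity>" by auto
  then show ?thesis unfolding support_value_def by (simp add: ereal_real)
qed

lemma support_value_upper:
  assumes "bounded C" "x \<in> C"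
  shows "u \<bullet> x \<le> support_value u C"
proof -
  have "ereal (u \<bullet> x) \<le> support_function u C"
    unfolding support_function_def using assms by (intro SUP_upper)
  moreover have "support_function u C = ereal (support_value u C)"
    using assms by (intro support_function_bounded) auto
  ultimately show ?thesis by simp
qed

lemma support_value_least:
  assumes "bounded C" "C \<noteq> {}" "\<And>x. x \<in> C \<Longrightarrow> u \<bullet> x \<le> c"
  shows "support_value u C \<le> c"
proof -
  have "support_function u C \<le> ereal c"
    unfolding support_function_def using assms by (intro SUP_least) auto
  then show ?thesis using support_function_bounded[of C u] assms by auto
qed

lemma abs_support_value_le:
  assumes "C \<noteq> {}" "\<And>x. x \<in> C \<Longrightarrow> norm x \<le> K"
  shows "\<bar>support_value u C\<bar> \<le> norm u * K"
proof -
  have C: "bounded C" using assms(2) by (auto simp: bounded_iff)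
  have b: "\<bar>u \<bullet> x\<bar> \<le> norm u * K" if "x \<in> C" for x
    using assms(2)[OF that] Cauchy_Schwarz_ineq2[of u x] mult_left_mono[of "norm x" K "norm u"] by simp
  obtain x where "x \<in> C" using assms(1) by auto
  have "support_value u C \<le> norm u * K"
    using b by (intro support_value_least C assms(1)) (auto simp: abs_le_iff)
  moreover have "- (norm u * K) \<le> support_value u C"
    using support_value_upper[OF C \<open>x \<in> C\<close>, of u] b[OF \<open>x \<in> C\<close>] by linarith
  ultimately show ?thesis by linarith
qed

lemma support_value_diff_le:
  assumes "C \<noteq> {}" "\<And>x. x \<in> C \<Longrightarrow> norm x \<le> K"
  shows "support_value u C - support_value v C \<le> norm (u - v) * K"
proof -
  have C: "bounded C" using assms(2) by (auto simp: bounded_iff)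
  have "support_value u C \<le> support_value v C + norm (u - v) * K"
  proof (intro support_value_least C assms(1))
    fix x assume x: "x \<in> C"
    have "(u - v) \<bullet> x \<le> norm (u - v) * norm x" by (rule norm_cauchy_schwarz)
    also have "\<dots> \<le> norm (u - v) * K" by (intro mult_left_mono assms(2) x) simp
    finally show "u \<bullet> x \<le> support_value v C + norm (u - v) * K"
      using support_value_upper[OF C x, of v] by (simp add: inner_diff_left)
  qed
  then show ?thesis by simp
qed

text \<open>The source of all lower bounds: a very negative value in direction \<open>u\<close>
  forces a large one in direction \<open>- u\<close>, and large values are what submartingale
  inequalities control.\<close>

lemma support_value_opposite:
  assumes "bounded C" "C \<noteq> {}"
  shows "- support_value u C \<le> support_value (- u) C"
proof -
  obtain x where "x \<in> C" using assms by auto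
  then show ?thesis
    using support_value_upper[OF assms(1), of x u] support_value_upper[OF assms(1), of x "- u"] by simp
qed

text \<open>The unit vector pointing from the nearest point of \<open>D\<close> to \<open>x\<close> witnesses the distance.\<close>

lemma infdist_le_support_value_diff:
  fixes D :: "'b::euclidean_space set"
  assumes "bounded C" "x \<in> C" "convex D" "closed D" "bounded D" "D \<noteq> {}"
    and le: "\<And>u. norm u \<le> 1 \<Longrightarrow> support_value u C - support_value u D \<le> e" and "0 \<le> e"
  shows "infdist x D \<le> e"
proof (cases "x \<in> D")
  case True then show ?thesis using assms by simp
next
  case False
  define y where "y = closest_point D x"
  have y: "y \<in> D" unfolding y_def using assms by (intro closest_point_in_set) auto
  have nz: "norm (x - y) > 0" using y False by auto
  define u where "u = (x - y) /\<^sub>R norm (x - y)"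
  have nu: "norm u = 1" using nz by (simp add: u_def)
  \<comment> \<open>The angle at the projection is obtuse, so \<open>y\<close> maximizes
    \<open>u\<close> over \<open>D\<close>, and the gap between the support values in direction
    \<open>u\<close> is at least the distance from \<open>x\<close> to \<open>y\<close>.\<close>
  have "support_value u D \<le> u \<bullet> y"
  proof (intro support_value_least)
    fix z assume "z \<in> D"
    then have "(x - y) \<bullet> (z - y) \<le> 0"
      unfolding y_def by (intro closest_point_dot) (use assms in auto)
    then have "(x - y) \<bullet> z \<le> (x - y) \<bullet> y" by (simp add: inner_diff_right)
    then show "u \<bullet> z \<le> u \<bullet> y"
      using nz unfolding u_def by (simp add: divide_right_mono mult_left_mono)
  qed (use assms in auto)
  moreover have "u \<bullet> (x - y) = norm (x - y)"
    using nz by (simp add: u_def dot_square_norm power2_eq_square)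
  moreover have "u \<bullet> x \<le> support_value u C" using assms by (intro support_value_upper)
  ultimately have "norm (x - y) \<le> e" using le[of u] nu by (simp add: inner_diff_right)
  then show ?thesis using infdist_le[OF y, of x] by (simp add: dist_norm)
qed

text \<open>Support functions of subsets of a fixed ball are equi-Lipschitz, so finitely many
  directions control all of them.\<close>

lemma finite_directions_control:
  fixes W :: "'b::euclidean_space set"
  assumes W: "cball 0 1 \<subseteq> closure W" and e: "0 < e" and K: "0 \<le> K"
  obtains V where "finite V" "V \<subseteq> W"
    "\<forall>C D x. C \<subseteq> cball 0 K \<and> D \<subseteq> cball 0 K \<and> x \<in> C \<and> convex D \<and> closed D \<and> D \<noteq> {} \<and>
       (\<forall>v\<in>V. \<bar>support_value v C - support_value v D\<bar> \<le> e) \<longrightarrow> infdist x D \<le> 2 * e"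
proof -
  \<comment> \<open>Moving a direction by less than \<open>d\<close> changes each of the two support
    values by at most e/2, so a gap of \<open>e\<close> on \<open>V\<close> becomes at most 2 e
    everywhere. The summand 1 covers K = 0.\<close>
  define d where "d = e / (2 * (K + 1))"
  have d: "d > 0" using e K by (simp add: d_def)
  have cover: "cball (0::'b) 1 \<subseteq> (\<Union>v\<in>W. ball v d)"
  proof
    fix u :: 'b assume "u \<in> cball 0 1"
    then have "u \<in> closure W" using W by auto
    then obtain v where "v \<in> W" "dist v u < d" using d by (meson closure_approachable)
    then show "u \<in> (\<Union>v\<in>W. ball v d)" by auto
  qed
  obtain V where V: "V \<subseteq> W" "finite V" "cball (0::'b) 1 \<subseteq> (\<Union>v\<in>V. ball v d)"
    using compactE_image[OF compact_cball _ cover] by (metis open_ball)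
  show thesis
  proof (rule that[OF V(2,1)], intro allI impI, elim conjE)
    fix C D :: "'b set" and x
    assume *: "C \<subseteq> cball 0 K" "D \<subseteq> cball 0 K" "x \<in> C" "convex D" "closed D" "D \<noteq> {}"
       "\<forall>v\<in>V. \<bar>support_value v C - support_value v D\<bar> \<le> e"
    have bd: "bounded C" "bounded D" using * bounded_cball bounded_subset by blast+
    show "infdist x D \<le> 2 * e"
    proof (rule infdist_le_support_value_diff[of C x D])
      fix u :: 'b assume "norm u \<le> 1"
      then obtain v where v: "v \<in> V" "dist v u < d" using V(3) by auto
      have n: "norm (u - v) * K \<le> e / 2"
      proof -
        have "norm (u - v) * K \<le> d * (K + 1)"
          using v K d by (intro mult_mono) (auto simp: dist_norm norm_minus_commute)
        also have "\<dots> = e / 2" using K by (simp add: d_def field_simps)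
        finally show ?thesis .
      qed
      have "support_value u C - support_value v C \<le> norm (u - v) * K"
        by (intro support_value_diff_le) (use * in auto)
      moreover have "support_value v D - support_value u D \<le> norm (v - u) * K"
        by (intro support_value_diff_le) (use * in auto)
      ultimately show "support_value u C - support_value u D \<le> 2 * e"
        using bspec[OF *(7) v(1)] n by (simp add: norm_minus_commute)
    qed (use * bd e in auto)
  qed
qed

section \<open>Hausdorff convergence along a filter\<close>

lemma hausdorff_distance_le:
  assumes "\<And>x. x \<in> C \<Longrightarrow> infdist x D \<le> e" "\<And>x. x \<in> D \<Longrightarrow> infdist x C \<le> e"
  shows "hausdorff_distance C D \<le> ennreal e"
  unfolding hausdorff_distance_def using assms by (auto intro!: SUP_least ennreal_leI)

lemma hausdorff_limitI:
  assumes "closed L" "L \<noteq> {}"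
    and "\<And>e. 0 < e \<Longrightarrow> eventually (\<lambda>r. (\<forall>x\<in>C r. infdist x L \<le> e) \<and> (\<forall>x\<in>L. infdist x (C r) \<le> e)) A"
  shows "hausdorff_limit C L A"
  unfolding hausdorff_limit_def
proof (intro conjI assms order_tendstoI)
  fix a :: ennreal assume "0 < a"
  obtain e where e: "0 < e" "ennreal e < a"
  proof (cases a)
    case (real r)
    then show ?thesis using \<open>0 < a\<close> that[of "r / 2"] by (auto simp: ennreal_less_iff)
  next
    case top then show ?thesis using that[of 1] by simp
  qed
  show "eventually (\<lambda>r. hausdorff_distance (C r) L < a) A"
    using assms(3)[OF e(1)]
    by eventually_elim (use hausdorff_distance_le e(2) in \<open>blast intro: le_less_trans\<close>)
qed auto

lemma hausdorff_limitD:
  assumes "hausdorff_limit C L A" "0 < e"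
  shows "eventually (\<lambda>r. (\<forall>x\<in>C r. infdist x L < e) \<and> (\<forall>x\<in>L. infdist x (C r) < e)) A"
proof -
  have "eventually (\<lambda>r. hausdorff_distance (C r) L < ennreal e) A"
    using assms by (auto simp: hausdorff_limit_def intro: order_tendstoD)
  then show ?thesis
  proof eventually_elim
    case (elim r)
    have "ennreal (infdist x L) \<le> hausdorff_distance (C r) L" if "x \<in> C r" for x
      unfolding hausdorff_distance_def using that by (intro max.coboundedI1 SUP_upper)
    moreover have "ennreal (infdist x (C r)) \<le> hausdorff_distance (C r) L" if "x \<in> L" for x
      unfolding hausdorff_distance_def using that by (intro max.coboundedI2 SUP_upper)
    ultimately show ?case using elim
      by (metis ennreal_less_iff infdist_nonneg le_less_trans)
  qed
qed

text \<open>Go to an almost nearest point of \<open>C\<close> and from there to \<open>D\<close>;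
  the slack \<open>d\<close> is needed because the infimum over \<open>C\<close> may not be
  attained.\<close>

lemma infdist_triangle_set:
  assumes "C \<noteq> {}" "\<And>y. y \<in> C \<Longrightarrow> infdist y D \<le> e"
  shows "infdist x D \<le> infdist x C + e"
proof (rule field_le_epsilon)
  fix d :: real assume d: "0 < d"
  have eq: "infdist x C = (INF y\<in>C. dist x y)" using assms(1) by (simp add: infdist_def)
  have "(INF y\<in>C. dist x y) < infdist x C + d" using d eq by simp
  then obtain y where y: "y \<in> C" "dist x y < infdist x C + d"
    using assms(1) by (subst (asm) cInf_less_iff) auto
  then show "infdist x D \<le> infdist x C + e + d"
    using infdist_triangle[of x D y] assms(2)[OF y(1)] by simp
qed

text \<open>A point of \<open>L\<close> is close to some late \<open>C r\<close>, all of which is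
  close to \<open>L'\<close>, and \<open>L'\<close> is closed. Nonempty \<open>C r\<close> is
  essential: \<open>infdist\<close> to the empty set is 0, so empty sets would converge to
  everything.\<close>

lemma hausdorff_limit_subset:
  assumes "A \<noteq> bot" "hausdorff_limit C L A" "hausdorff_limit C L' A"
    and C: "eventually (\<lambda>r. C r \<noteq> {}) A"
  shows "L \<subseteq> L'"
proof
  fix x assume x: "x \<in> L"
  have "infdist x L' \<le> 0"
  proof (rule field_le_epsilon)
    fix e :: real assume "0 < e"
    then have "0 < e / 2" by simp
    from hausdorff_limitD[OF assms(2) this] hausdorff_limitD[OF assms(3) this] C
    have "eventually (\<lambda>r. infdist x L' \<le> 0 + e) A"
    proof eventually_elim
      case (elim r)
      have "infdist x L' \<le> infdist x (C r) + e / 2"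
        using elim by (intro infdist_triangle_set) (auto intro: less_imp_le)
      moreover have "infdist x (C r) < e / 2" using elim x by auto
      ultimately show ?case by simp
    qed
    then show "infdist x L' \<le> 0 + e" using assms(1) by (simp add: eventually_const)
  qed
  then have "infdist x L' = 0" using infdist_nonneg[of x L'] by simp
  then show "x \<in> L'" using assms(3) in_closed_iff_infdist_zero[of L' x]
    by (auto simp: hausdorff_limit_def)
qed

lemma hausdorff_limit_unique:
  assumes "A \<noteq> bot" "hausdorff_limit C L A" "hausdorff_limit C L' A"
    and "eventually (\<lambda>r. C r \<noteq> {}) A"
  shows "L = L'"
  using hausdorff_limit_subset[OF assms] hausdorff_limit_subset[OF assms(1,3,2,4)] by blast

text \<open>Finitely many directions are eventually close at the same time, and the control lemma,
  used once in each order of \<open>C r\<close> and \<open>D\<close>, gives both halves of the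
  Hausdorff distance. This serves when the limit set is already known.\<close>

lemma hausdorff_limit_if_support_values_tendsto:
  fixes C :: "'i \<Rightarrow> 'b::euclidean_space set"
  assumes W: "cball 0 1 \<subseteq> closure W" and K: "0 \<le> K"
    and C: "eventually (\<lambda>r. convex (C r) \<and> closed (C r) \<and> C r \<noteq> {} \<and> C r \<subseteq> cball 0 K) A"
    and D: "convex D" "closed D" "D \<noteq> {}" "D \<subseteq> cball 0 K"
    and lim: "\<And>u. u \<in> W \<Longrightarrow> ((\<lambda>r. support_value u (C r)) \<longlongrightarrow> support_value u D) A"
  shows "hausdorff_limit C D A"
proof (intro hausdorff_limitI D)
  fix e :: real assume e: "0 < e"
  obtain V where V: "finite V" "V \<subseteq> W"
    and control: "\<forall>C D x. C \<subseteq> cball 0 K \<and> D \<subseteq> cball 0 K \<and> x \<in> C \<and> convex D \<and> closed D \<and> D \<noteq> {} \<and>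
        (\<forall>v\<in>V. \<bar>support_value v C - support_value v D\<bar> \<le> e/2) \<longrightarrow> infdist x D \<le> 2 * (e/2)"
    by (rule finite_directions_control[OF W half_gt_zero[OF e] K])
  have "eventually (\<lambda>r. \<forall>v\<in>V. \<bar>support_value v (C r) - support_value v D\<bar> < e / 2) A"
  proof (intro eventually_ball_finite V ballI)
    fix v assume "v \<in> V"
    then have "((\<lambda>r. support_value v (C r)) \<longlongrightarrow> support_value v D) A" using V lim by auto
    from tendstoD[OF this, of "e/2"] e
    show "eventually (\<lambda>r. \<bar>support_value v (C r) - support_value v D\<bar> < e / 2) A"
      by (simp add: dist_real_def)
  qed
  with C show "eventually (\<lambda>r. (\<forall>x\<in>C r. infdist x D \<le> e) \<and> (\<forall>x\<in>D. infdist x (C r) \<le> e)) A"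
  proof eventually_elim
    case (elim r)
    have 1: "\<bar>support_value v (C r) - support_value v D\<bar> \<le> e / 2"
      "\<bar>support_value v D - support_value v (C r)\<bar> \<le> e / 2" if "v \<in> V" for v
      using elim that by (auto simp: abs_minus_commute less_imp_le)
    show ?case
      using control[rule_format, of "C r" D] control[rule_format, of D "C r"] 1 elim D by auto
  qed
qed

text \<open>The limit is the set of points whose distance to \<open>C r\<close> tends to 0; compactness of the ball
  makes it rich enough.\<close>

lemma hausdorff_limit_exists:
  fixes C :: "'i \<Rightarrow> 'b::euclidean_space set"
  assumes A: "A \<noteq> bot" and W: "cball 0 1 \<subseteq> closure W" and K: "0 \<le> K"
    and C: "eventually (\<lambda>r. convex (C r) \<and> closed (C r) \<and> C r \<noteq> {} \<and> C r \<subseteq> cball 0 K) A"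
    and lim: "\<And>u. u \<in> W \<Longrightarrow> \<exists>l. ((\<lambda>r. support_value u (C r)) \<longlongrightarrow> l) A"
  shows "\<exists>L. convex L \<and> hausdorff_limit C L A"
proof -
  \<comment> \<open>The Cauchy property along an arbitrary filter: for each tolerance a predicate
    that eventually holds and on which any two sets are within \<open>e\<close> of each
    other.\<close>
  have "\<exists>Q. eventually Q A \<and> (\<forall>r s. Q r \<longrightarrow> Q s \<longrightarrow> (\<forall>x\<in>C r. infdist x (C s) \<le> e)) \<and>
      (\<forall>r. Q r \<longrightarrow> convex (C r) \<and> closed (C r) \<and> C r \<noteq> {} \<and> C r \<subseteq> cball 0 K)" if e: "0 < e" for e
  proof -
    obtain V where V: "finite V" "V \<subseteq> W"
      and control: "\<forall>C D x. C \<subseteq> cball 0 K \<and> D \<subseteq> cball 0 K \<and> x \<in> C \<and> convex D \<and> closed D \<and> D \<noteq> {} \<and>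
        (\<forall>v\<in>V. \<bar>support_value v C - support_value v D\<bar> \<le> e/2) \<longrightarrow> infdist x D \<le> 2 * (e/2)"
      by (rule finite_directions_control[OF W half_gt_zero[OF e] K])
    obtain l where l: "\<And>u. u \<in> W \<Longrightarrow> ((\<lambda>r. support_value u (C r)) \<longlongrightarrow> l u) A"
      using lim by metis
    \<comment> \<open>A distance of e/4 from the limit on either side gives e/2 between two sets,
      which the control lemma doubles to \<open>e\<close>.\<close>
    define Q where "Q r \<longleftrightarrow> (\<forall>v\<in>V. \<bar>support_value v (C r) - l v\<bar> < e / 4) \<and>
       convex (C r) \<and> closed (C r) \<and> C r \<noteq> {} \<and> C r \<subseteq> cball 0 K" for r
    have "eventually (\<lambda>r. \<forall>v\<in>V. \<bar>support_value v (C r) - l v\<bar> < e / 4) A"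
    proof (intro eventually_ball_finite V ballI)
      fix v assume "v \<in> V"
      then have "((\<lambda>r. support_value v (C r)) \<longlongrightarrow> l v) A" using V l by auto
      from tendstoD[OF this, of "e/4"] e
      show "eventually (\<lambda>r. \<bar>support_value v (C r) - l v\<bar> < e / 4) A"
        by (simp add: dist_real_def)
    qed
    with C have "eventually Q A" unfolding Q_def by eventually_elim auto
    moreover have "infdist x (C s) \<le> e" if "Q r" "Q s" "x \<in> C r" for r s x
    proof -
      have "\<bar>support_value v (C r) - support_value v (C s)\<bar> \<le> e / 2" if "v \<in> V" for v
      proof -
        have "\<bar>support_value v (C r) - l v\<bar> < e / 4" "\<bar>support_value v (C s) - l v\<bar> < e / 4"
          using \<open>Q r\<close> \<open>Q s\<close> that by (auto simp: Q_def)
        then show ?thesis by linarith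
      qed
      then show ?thesis using control[rule_format, of "C r" "C s" x] that by (auto simp: Q_def)
    qed
    ultimately show ?thesis by (intro exI[of _ Q]) (auto simp: Q_def)
  qed
  then obtain Q where Q: "\<And>e. 0 < e \<Longrightarrow> eventually (Q e) A"
    and cauchy: "\<And>e r s x. 0 < e \<Longrightarrow> Q e r \<Longrightarrow> Q e s \<Longrightarrow> x \<in> C r \<Longrightarrow> infdist x (C s) \<le> e"
    and good: "\<And>e r. 0 < e \<Longrightarrow> Q e r \<Longrightarrow> convex (C r) \<and> closed (C r) \<and> C r \<noteq> {} \<and> C r \<subseteq> cball 0 K"
    by metis
  define L where "L = {x. \<forall>e>0. eventually (\<lambda>r. infdist x (C r) < e) A}"
  have near_L: "\<exists>x\<in>L. dist x y \<le> e" if e: "0 < e" and r: "Q e r" and y: "y \<in> C r" for e r y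
  proof -
    \<comment> \<open>For fixed \<open>n\<close> a single index \<open>s\<close> meets the
      tolerances 1, 1/2, ..., 1/(n+1) and \<open>e\<close> all at once, and the point of
      \<open>C s\<close> nearest to \<open>y\<close> is then close to every set that is good for one
      of them. A limit point of these \<open>z\<close> is close for all tolerances and so lies in
      \<open>L\<close>.\<close>
    have "\<exists>z. dist y z \<le> e \<and> z \<in> cball 0 K \<and>
        (\<forall>m\<le>n. \<forall>s. Q (1 / Suc m) s \<longrightarrow> infdist z (C s) \<le> 1 / Suc m)" for n
    proof -
      have "eventually (\<lambda>s. \<forall>m\<in>{..n}. Q (1 / Suc m) s) A"
        by (intro eventually_ball_finite) (auto intro: Q)
      moreover have "eventually (Q e) A" using Q e by auto
      ultimately have "eventually (\<lambda>s. (\<forall>m\<in>{..n}. Q (1 / Suc m) s) \<and> Q e s) A"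
        by eventually_elim auto
      then obtain s where s: "\<And>m. m \<le> n \<Longrightarrow> Q (1 / Suc m) s" "Q e s"
        using eventually_happens'[OF A] by blast
      have "infdist y (C s) \<le> e" using cauchy[OF e r s(2) y] .
      moreover obtain z where "z \<in> C s" "infdist y (C s) = dist y z"
        using infdist_attains_inf[of "C s" y] good[OF e s(2)] by auto
      ultimately show ?thesis
        using good[OF e s(2)] cauchy[OF _ s(1)] by (intro exI[of _ z]) auto
    qed
    then obtain z where z: "\<And>n. dist y (z n) \<le> e" "\<And>n. z n \<in> cball 0 K"
      "\<And>n m s. m \<le> n \<Longrightarrow> Q (1 / Suc m) s \<Longrightarrow> infdist (z n) (C s) \<le> 1 / Suc m"
      by metis
    obtain x \<sigma> where x: "strict_mono (\<sigma> :: nat \<Rightarrow> nat)" "(z \<circ> \<sigma>) \<longlonglongrightarrow> x"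
      using compact_cball[of "0::'b" K] z(2) unfolding compact_def by metis
    have "infdist x (C s) \<le> 1 / Suc m" if "Q (1 / Suc m) s" for m s
    proof -
      have "(\<lambda>n. infdist ((z \<circ> \<sigma>) n) (C s)) \<longlonglongrightarrow> infdist x (C s)"
        by (intro tendsto_infdist x)
      moreover have "eventually (\<lambda>n. infdist ((z \<circ> \<sigma>) n) (C s) \<le> 1 / Suc m) sequentially"
        using eventually_ge_at_top[of m]
      proof eventually_elim
        case (elim n)
        then have "m \<le> \<sigma> n" using seq_suble[OF x(1), of n] by simp
        then show ?case using z(3) that by simp
      qed
      ultimately show ?thesis by (intro tendsto_upperbound) auto
    qed
    then have "eventually (\<lambda>r. infdist x (C r) < d) A" if d: "0 < d" for d
    proof -
      obtain m where m: "1 / Suc m < d"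
        using reals_Archimedean[OF d] by (auto simp: inverse_eq_divide)
      have "eventually (Q (1 / Suc m)) A" by (intro Q) simp
      then show ?thesis
        by eventually_elim (use m \<open>\<And>s m. Q (1 / Suc m) s \<Longrightarrow> infdist x (C s) \<le> 1 / Suc m\<close> in \<open>blast intro: le_less_trans\<close>)
    qed
    then have "x \<in> L" by (simp add: L_def)
    moreover have "dist x y \<le> e"
    proof -
      have "(\<lambda>n. dist y ((z \<circ> \<sigma>) n)) \<longlonglongrightarrow> dist y x" by (intro tendsto_intros x)
      then have "dist y x \<le> e" by (rule tendsto_upperbound) (use z in auto)
      then show ?thesis by (simp add: dist_commute)
    qed
    ultimately show ?thesis by auto
  qed
  have "L \<noteq> {}"
  proof -
    obtain r where r: "Q 1 r" using eventually_happens'[OF A Q[of 1]] by auto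
    then obtain y where "y \<in> C r" using good[of 1 r] by auto
    then show ?thesis using near_L[OF _ r] by auto
  qed
  moreover have "closed L"
  proof -
    have "x \<in> L" if x: "x \<in> closure L" for x
      unfolding L_def
    proof safe
      fix e :: real assume e: "0 < e"
      obtain y where y: "y \<in> L" "dist y x < e / 2"
        using x e by (meson closure_approachable half_gt_zero)
      have "eventually (\<lambda>r. infdist y (C r) < e / 2) A"
        using y(1) half_gt_zero[OF e] unfolding L_def by blast
      then show "eventually (\<lambda>r. infdist x (C r) < e) A"
      proof eventually_elim
        case (elim r)
        then show ?case using infdist_triangle[of x "C r" y] y by (simp add: dist_commute)
      qed
    qed
    then show ?thesis using closure_subset_eq by blast
  qed
  moreover have "convex L"
    unfolding convex_def
  proof (intro ballI allI impI)
    fix x y and a b :: real assume xy: "x \<in> L" "y \<in> L" and ab: "0 \<le> a" "0 \<le> b" "a + b = 1"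
    show "a *\<^sub>R x + b *\<^sub>R y \<in> L"
      unfolding L_def
    proof safe
      fix e :: real assume e: "0 < e"
      have "eventually (\<lambda>r. infdist x (C r) < e) A" "eventually (\<lambda>r. infdist y (C r) < e) A"
        using xy e by (auto simp: L_def)
      with C show "eventually (\<lambda>r. infdist (a *\<^sub>R x + b *\<^sub>R y) (C r) < e) A"
      proof eventually_elim
        case (elim r)
        obtain p where p: "p \<in> C r" "infdist x (C r) = dist x p"
          using infdist_attains_inf[of "C r" x] elim by auto
        obtain q where q: "q \<in> C r" "infdist y (C r) = dist y q"
          using infdist_attains_inf[of "C r" y] elim by auto
        have "a *\<^sub>R p + b *\<^sub>R q \<in> C r" using elim p q ab by (auto simp: convex_def)
        then have "infdist (a *\<^sub>R x + b *\<^sub>R y) (C r) \<le> dist (a *\<^sub>R x + b *\<^sub>R y) (a *\<^sub>R p + b *\<^sub>R q)"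
          by (rule infdist_le)
        also have "\<dots> = norm (a *\<^sub>R (x - p) + b *\<^sub>R (y - q))"
          by (simp add: dist_norm algebra_simps)
        also have "\<dots> \<le> a * dist x p + b * dist y q"
          using ab by (intro order_trans[OF norm_triangle_ineq]) (simp add: dist_norm)
        also have "\<dots> < e"
          using convex_bound_lt[of "dist x p" e "dist y q" a b] elim p q ab by simp
        finally show ?case .
      qed
    qed
  qed
  moreover have "hausdorff_limit C L A"
  proof (intro hausdorff_limitI \<open>closed L\<close> \<open>L \<noteq> {}\<close>)
    fix e :: real assume "0 < e"
    then have e: "0 < e / 2" by simp
    show "eventually (\<lambda>r. (\<forall>x\<in>C r. infdist x L \<le> e) \<and> (\<forall>x\<in>L. infdist x (C r) \<le> e)) A"
      using Q[OF e]
    proof eventually_elim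
      case (elim r)
      have "infdist y L \<le> e" if y: "y \<in> C r" for y
      proof -
        obtain x where "x \<in> L" "dist x y \<le> e / 2" using near_L[OF e elim y] by auto
        then show ?thesis using infdist_le2[of x L y e] e by (simp add: dist_commute)
      qed
      moreover have "infdist x (C r) \<le> e" if "x \<in> L" for x
      proof -
        have "eventually (\<lambda>s. infdist x (C s) < e / 2) A" using that e unfolding L_def by blast
        with Q[OF e] have "eventually (\<lambda>s. Q (e/2) s \<and> infdist x (C s) < e / 2) A"
          by eventually_elim auto
        then obtain s where s: "Q (e/2) s" "infdist x (C s) < e / 2"
          using eventually_happens'[OF A] by blast
        have "infdist x (C r) \<le> infdist x (C s) + e / 2"
          using good[OF e s(1)] cauchy[OF e s(1) elim] by (intro infdist_triangle_set) auto
        then show ?thesis using s by simp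
      qed
      ultimately show ?case by auto
    qed
  qed
  ultimately show ?thesis by blast
qed

section \<open>Upcrossings and scalar submartingales\<close>

text \<open>Counted backwards from the end \<open>e\<close>: the last low-high pair comes first, the
  other \<open>k\<close> lie before its low time. A predicate rather than a number, since in a dense
  index set such as the rationals there is no next time at which to count; it is also monotone in
  \<open>S\<close> and \<open>e\<close>. For a < b, \<open>r \<le> s\<close> already forces r <
  s.\<close>

fun upcrosses :: "'i::linorder set \<Rightarrow> real \<Rightarrow> real \<Rightarrow> ('i \<Rightarrow> real) \<Rightarrow> nat \<Rightarrow> 'i \<Rightarrow> bool" where
  "upcrosses S a b x 0 e = True"
| "upcrosses S a b x (Suc k) e =
     (\<exists>r\<in>S. \<exists>s\<in>S. r \<le> s \<and> s \<le> e \<and> x r \<le> a \<and> b \<le> x s \<and> upcrosses S a b x k r)"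

lemma upcrosses_mono:
  "upcrosses S a b x k e \<Longrightarrow> S \<subseteq> S' \<Longrightarrow> e \<le> e' \<Longrightarrow> upcrosses S' a b x k e'"
proof (induction k arbitrary: e e')
  case (Suc k)
  then obtain r s where *: "r \<in> S" "s \<in> S" "r \<le> s" "s \<le> e" "x r \<le> a" "b \<le> x s" "upcrosses S a b x k r"
    by auto
  then have "upcrosses S' a b x k r" "r \<in> S'" "s \<in> S'" "s \<le> e'" using Suc.IH[of r r] Suc.prems by auto
  then show ?case using * by (auto simp del: upcrosses.simps(1))
qed auto

text \<open>A chain of \<open>k\<close> upcrossings uses only finitely many times, so one member of
  the increasing sequence contains them all.\<close>

lemma upcrosses_incseq_Union:
  assumes "incseq G" "upcrosses (\<Union>n. G n) a b x k e"
  shows "\<exists>n. upcrosses (G n) a b x k e"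
  using assms(2)
proof (induction k arbitrary: e)
  case (Suc k)
  then obtain r s n1 n2 where *: "r \<in> G n1" "s \<in> G n2" "r \<le> s" "s \<le> e" "x r \<le> a" "b \<le> x s"
    "upcrosses (\<Union>n. G n) a b x k r"
    by auto
  obtain n3 where n3: "upcrosses (G n3) a b x k r" using Suc.IH *(7) by auto
  define n where "n = Max {n1, n2, n3}"
  have "G n1 \<subseteq> G n" "G n2 \<subseteq> G n" "G n3 \<subseteq> G n"
    using assms(1) by (auto simp: n_def incseq_def)
  then have "r \<in> G n" "s \<in> G n" "upcrosses (G n) a b x k r"
    using * n3 upcrosses_mono[of "G n3" a b x k r "G n" r] by auto
  then show ?case using * by (intro exI[of _ n]) auto
qed auto

lemma upcrosses_grid:
  assumes "0 < c" "upcrosses (range (\<lambda>i::nat. real i / c)) a b x k (real j / c)"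
  shows "upcrosses UNIV a b (\<lambda>i. x (real i / c)) k j"
  using assms(2)
proof (induction k arbitrary: j)
  case (Suc k)
  then obtain r s where "real r / c \<le> real s / c" "real s / c \<le> real j / c"
    "x (real r / c) \<le> a" "b \<le> x (real s / c)" "upcrosses (range (\<lambda>i::nat. real i / c)) a b x k (real r / c)"
    by auto
  then have "r \<le> s" "s \<le> j" "x (real r / c) \<le> a" "b \<le> x (real s / c)"
    "upcrosses UNIV a b (\<lambda>i. x (real i / c)) k r"
    using Suc.IH[of r] assms(1) by (auto simp: divide_le_cancel)
  then show ?case by auto
qed auto

text \<open>The number of upcrossings completed up to time \<open>i\<close>, and whether the path is currently on
  its way up from below \<open>a\<close>.\<close>

fun upcrossing_state :: "real \<Rightarrow> real \<Rightarrow> (nat \<Rightarrow> real) \<Rightarrow> nat \<Rightarrow> nat \<times> bool" where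
  "upcrossing_state a b x 0 = (0, x 0 \<le> a)"
| "upcrossing_state a b x (Suc i) =
     (case upcrossing_state a b x i of (k, h) \<Rightarrow>
       if h then (if b \<le> x (Suc i) then (Suc k, False) else (k, True)) else (k, x (Suc i) \<le> a))"

text \<open>Greedy counting is optimal. The second conjunct is what the induction needs: if
  \<open>k\<close> upcrossings fit before a low time \<open>j\<close>, then the greedy count has
  already passed \<open>k\<close>, or it has reached \<open>k\<close> and is on its way up, so that
  the next high value completes another.\<close>

lemma upcrossing_state_greedy:
  assumes "a < b"
  shows "(upcrosses UNIV a b x k i \<longrightarrow> k \<le> fst (upcrossing_state a b x i)) \<and>
    (\<forall>j\<le>i. x j \<le> a \<and> upcrosses UNIV a b x k j \<longrightarrow>
       k < fst (upcrossing_state a b x i) \<or>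
       (k \<le> fst (upcrossing_state a b x i) \<and> snd (upcrossing_state a b x i)))"
proof (induction i arbitrary: k)
  case 0
  show ?case using assms by (cases k) auto
next
  case (Suc i)
  obtain u h where st: "upcrossing_state a b x i = (u, h)" by force
  \<comment> \<open>Either the whole chain already fits before \<open>i\<close>, or its last high
    time is \<open>Suc i\<close>; in the second case the strengthened hypothesis is applied at the
    last low time \<open>r\<close>, which is at most \<open>i\<close> because a < b.\<close>
  have last: "upcrosses UNIV a b x k i \<or> (\<exists>k'. k = Suc k' \<and> b \<le> x (Suc i) \<and> (u > k' \<or> (u \<ge> k' \<and> h)))"
    if up: "upcrosses UNIV a b x k (Suc i)" for k
  proof (cases k)
    case 0 then show ?thesis by simp
  next
    case (Suc k')
    with up obtain r s where rs: "r \<le> s" "s \<le> Suc i" "x r \<le> a" "b \<le> x s" "upcrosses UNIV a b x k' r"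
      by auto
    show ?thesis
    proof (cases "s \<le> i")
      case True then show ?thesis using rs Suc by auto
    next
      case False
      then have s: "s = Suc i" using rs by simp
      then have "r \<noteq> Suc i" using rs assms by auto
      then have "r \<le> i" using rs s by simp
      then show ?thesis using Suc.IH[of k'] rs s st Suc by auto
    qed
  qed
  have 1: "k \<le> fst (upcrossing_state a b x (Suc i))" if "upcrosses UNIV a b x k (Suc i)" for k
    using last[OF that] Suc.IH[of k] st by auto
  have 2: "k < fst (upcrossing_state a b x (Suc i)) \<or>
       (k \<le> fst (upcrossing_state a b x (Suc i)) \<and> snd (upcrossing_state a b x (Suc i)))"
    if "j \<le> Suc i" "x j \<le> a" "upcrosses UNIV a b x k j" for j
  proof (cases "j \<le> i")
    case True
    then show ?thesis using Suc.IH[of k] that st assms by auto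
  next
    case False
    then have "j = Suc i" using that by simp
    then have "upcrosses UNIV a b x k i" using last[of k] that assms by auto
    then show ?thesis using Suc.IH[of k] that st assms \<open>j = Suc i\<close> by auto
  qed
  show ?case using 1[of k] 2 by blast
qed

lemma upcrossing_state_le: "fst (upcrossing_state a b x i) \<le> i"
  by (induction i) (auto split: prod.split if_splits)

text \<open>Completing an upcrossing adds b - a to the first term and gives up a positive part of at
  least b - a. Starting one costs nothing, since then x (Suc i) is at most \<open>a\<close> and the
  positive part is 0.\<close>

lemma upcrossing_gain:
  assumes "a < b"
  shows "(b - a) * real (fst (upcrossing_state a b x (Suc i)))
      + of_bool (snd (upcrossing_state a b x (Suc i))) * max 0 (x (Suc i) - a)
    \<le> (b - a) * real (fst (upcrossing_state a b x i))
      + of_bool (snd (upcrossing_state a b x i)) * max 0 (x (Suc i) - a)"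
  using assms by (auto split: prod.split simp: algebra_simps max_def)

text \<open>Generic in the index set, so that grid times in \<open>nat\<close> and real times share
  the same facts. The integrated inequality is the definition of the submartingale property here,
  and no version of a conditional expectation has to be chosen.\<close>

locale scalar_submartingale = prob_space P for P :: "'a measure" +
  fixes F :: "'i::linorder \<Rightarrow> 'a measure" and X :: "'i \<Rightarrow> 'a \<Rightarrow> real" and I :: "'i set"
  assumes subalg: "i \<in> I \<Longrightarrow> subalgebra P (F i)"
    and filtration: "i \<in> I \<Longrightarrow> j \<in> I \<Longrightarrow> i \<le> j \<Longrightarrow> sets (F i) \<subseteq> sets (F j)"
    and adapted: "i \<in> I \<Longrightarrow> X i \<in> borel_measurable (F i)"
    and integrable: "i \<in> I \<Longrightarrow> integrable P (X i)"
    and submartingale: "i \<in> I \<Longrightarrow> j \<in> I \<Longrightarrow> i \<le> j \<Longrightarrow> A \<in> sets (F i) \<Longrightarrow>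
      (\<integral>\<omega>. indicator A \<omega> * X i \<omega> \<partial>P) \<le> (\<integral>\<omega>. indicator A \<omega> * X j \<omega> \<partial>P)"
begin

lemma sets_F: "i \<in> I \<Longrightarrow> sets (F i) \<subseteq> sets P" and space_F: "i \<in> I \<Longrightarrow> space (F i) = space P"
  using subalg by (auto simp: subalgebra_def)

lemma measurable_later:
  "i \<in> I \<Longrightarrow> j \<in> I \<Longrightarrow> i \<le> j \<Longrightarrow> f \<in> measurable (F i) N \<Longrightarrow> f \<in> measurable (F j) N"
  using filtration[of i j] space_F[of i] space_F[of j] by (auto simp: measurable_def)

lemma measurable_P: "i \<in> I \<Longrightarrow> f \<in> measurable (F i) N \<Longrightarrow> f \<in> measurable P N"
  using sets_F[of i] space_F[of i] by (auto simp: measurable_def)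

lemma measurable_X [measurable]: "i \<in> I \<Longrightarrow> X i \<in> borel_measurable P"
  using adapted measurable_P by blast

lemma sets_X_ge: "i \<in> I \<Longrightarrow> {\<omega> \<in> space P. c \<le> X i \<omega>} \<in> sets (F i)"
  using adapted[of i] space_F[of i] by (auto simp: borel_measurable_iff_ge)

lemma integrable_mult_indicator_real:
  "integrable P f \<Longrightarrow> A \<in> sets P \<Longrightarrow> integrable P (\<lambda>\<omega>. indicator A \<omega> * (f \<omega> :: real))"
  using integrable_mult_indicator[of A P f] by simp

text \<open>On \<open>B\<close>, the part of \<open>A\<close> where X i exceeds \<open>a\<close>,
  the positive part at time \<open>i\<close> is X i - a, to which the submartingale inequality
  applies; on the rest of \<open>A\<close> it vanishes at time \<open>i\<close> and is nonnegative
  at time \<open>j\<close>.\<close>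

lemma positive_part_submartingale:
  assumes ij: "i \<in> I" "j \<in> I" "i \<le> j" "A \<in> sets (F i)"
  shows "(\<integral>\<omega>. indicator A \<omega> * max 0 (X i \<omega> - a) \<partial>P) \<le> (\<integral>\<omega>. indicator A \<omega> * max 0 (X j \<omega> - a) \<partial>P)"
proof -
  note [measurable] = measurable_X[OF ij(1)] measurable_X[OF ij(2)]
  note [simp] = integrable[OF ij(1)] integrable[OF ij(2)]
  define B where "B = A \<inter> {\<omega> \<in> space (F i). a < X i \<omega>}"
  have B: "B \<in> sets (F i)"
    using adapted[OF ij(1)] ij(4) unfolding B_def by measurable
  have BP: "B \<in> sets P" "A \<in> sets P" using B ij sets_F by auto
  have BI: "integrable P (\<lambda>\<omega>. indicator B \<omega> * X l \<omega>)" if "l \<in> I" for l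
    using integrable_mult_indicator_real[OF integrable[OF that] BP(1)] .
  have BA: "integrable P (\<lambda>\<omega>. indicator B \<omega> * a)"
    using integrable_mult_indicator_real[OF _ BP(1), of "\<lambda>_. a"] by simp
  have sp: "A \<subseteq> space P" using BP sets.sets_into_space by auto
  have "(\<integral>\<omega>. indicator A \<omega> * max 0 (X i \<omega> - a) \<partial>P) = (\<integral>\<omega>. indicator B \<omega> * X i \<omega> - indicator B \<omega> * a \<partial>P)"
    using sp space_F[OF ij(1)] by (intro Bochner_Integration.integral_cong) (auto simp: B_def indicator_def)
  also have "\<dots> \<le> (\<integral>\<omega>. indicator B \<omega> * X j \<omega> - indicator B \<omega> * a \<partial>P)"
    using submartingale[OF ij(1-3) B] BI BA ij by simp
  also have "\<dots> \<le> (\<integral>\<omega>. indicator A \<omega> * max 0 (X j \<omega> - a) \<partial>P)"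
    by (intro integral_mono Bochner_Integration.integrable_diff BI BA ij integrable_mult_indicator_real BP integrable_max)
       (auto simp: B_def indicator_def)
  finally show ?thesis .
qed

lemma sets_upcrosses:
  assumes S: "countable S" "S \<subseteq> I"
  shows "{\<omega> \<in> space P. upcrosses S a b (\<lambda>r. X r \<omega>) k e} \<in> sets P"
proof (induction k arbitrary: e)
  case (Suc k)
  have X: "X r \<in> borel_measurable P" if "r \<in> S" for r using that S(2) by auto
  show ?case unfolding upcrosses.simps
  proof (intro sets.sets_Collect_countable_Ex'[OF _ S(1)] sets.sets_Collect_conj sets.sets_Collect_const Suc.IH)
    fix r s assume "r \<in> S" "s \<in> S"
    note [measurable] = X[OF this(1)] X[OF this(2)]
    show "{\<omega> \<in> space P. X r \<omega> \<le> a} \<in> sets P" "{\<omega> \<in> space P. b \<le> X s \<omega>} \<in> sets P" by measurable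
  qed
qed simp

end

text \<open>The passage from grids to the rationals: \<open>n\<close> numbers the grids,
  \<open>k\<close> is a level or a number of upcrossings. A bound that is uniform in
  \<open>n\<close> survives the increasing union over \<open>n\<close>, and then k tends to
  infinity.\<close>

lemma (in prob_space) AE_not_all_levels:
  assumes E: "\<And>n k. E n k \<in> events" "\<And>k. incseq (\<lambda>n. E n k)"
    and C: "\<And>n k. 0 < k \<Longrightarrow> prob (E n k) \<le> C / real k"
  shows "AE \<omega> in M. \<exists>k. \<forall>n. \<omega> \<notin> E n k"
proof -
  define D where "D k = (\<Union>n. E n k)" for k
  have D: "D k \<in> events" for k using E by (auto simp: D_def)
  have DC: "prob (D k) \<le> C / real k" if "0 < k" for k
  proof -
    have "(\<lambda>n. prob (E n k)) \<longlonglongrightarrow> prob (D k)"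
      unfolding D_def using E by (intro finite_Lim_measure_incseq) auto
    then show ?thesis by (rule tendsto_upperbound) (auto intro!: always_eventually C that)
  qed
  have "prob (\<Inter>k. D k) \<le> 0"
  proof (rule tendsto_lowerbound)
    show "(\<lambda>k. C / real (Suc k)) \<longlonglongrightarrow> 0"
      using tendsto_mult[OF tendsto_const[of C] LIMSEQ_inverse_real_of_nat] by (simp add: divide_inverse)
    have "prob (\<Inter>k. D k) \<le> C / real (Suc k)" for k
    proof -
      have "prob (\<Inter>k. D k) \<le> prob (D (Suc k))" by (intro finite_measure_mono D) auto
      then show ?thesis using DC[of "Suc k"] by simp
    qed
    then show "\<forall>\<^sub>F k in sequentially. prob (\<Inter>k. D k) \<le> C / real (Suc k)" by simp
  qed simp
  then have "prob (\<Inter>k. D k) = 0" by (simp add: measure_le_0_iff)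
  then have "AE \<omega> in M. \<omega> \<notin> (\<Inter>k. D k)"
    using D by (subst (asm) prob_eq_0) auto
  then show ?thesis by eventually_elim (auto simp: D_def)
qed

section \<open>Doob's inequalities in discrete time\<close>

locale nat_submartingale = scalar_submartingale P F X "UNIV :: nat set"
  for P :: "'a measure" and F X
begin

text \<open>Induction on the horizon takes the place of a stopping time. The event at
  \<open>Suc i\<close> splits into \<open>A\<close>, where the level was reached before and whose
  integral is carried on by the submartingale inequality, and \<open>B\<close>, where X (Suc i)
  itself is at least \<open>c\<close>. Measurability of \<open>A\<close> in F i is proved along,
  because that inequality needs it.\<close>

lemma maximal_inequality_aux:
  "{\<omega> \<in> space P. \<exists>j\<le>i. c \<le> X j \<omega>} \<in> sets (F i) \<and>
   c * prob {\<omega> \<in> space P. \<exists>j\<le>i. c \<le> X j \<omega>} \<le>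
     (\<integral>\<omega>. indicator {\<omega> \<in> space P. \<exists>j\<le>i. c \<le> X j \<omega>} \<omega> * X i \<omega> \<partial>P)"
proof (induction i)
  case 0
  have A: "{\<omega> \<in> space P. c \<le> X 0 \<omega>} \<in> sets (F 0)"
    by (intro sets_X_ge) simp
  then have AP: "{\<omega> \<in> space P. c \<le> X 0 \<omega>} \<in> sets P" using sets_F[of 0] by auto
  have "c * prob {\<omega> \<in> space P. c \<le> X 0 \<omega>} = (\<integral>\<omega>. indicator {\<omega> \<in> space P. c \<le> X 0 \<omega>} \<omega> * c \<partial>P)"
    using AP by simp
  also have "\<dots> \<le> (\<integral>\<omega>. indicator {\<omega> \<in> space P. c \<le> X 0 \<omega>} \<omega> * X 0 \<omega> \<partial>P)"
    by (intro integral_mono integrable_mult_indicator_real AP integrable) (auto simp: indicator_def)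
  finally show ?case using A by simp
next
  case (Suc i)
  define A where "A = {\<omega> \<in> space P. \<exists>j\<le>i. c \<le> X j \<omega>}"
  define B where "B = {\<omega> \<in> space P. c \<le> X (Suc i) \<omega>} - A"
  have A: "A \<in> sets (F i)" and IH: "c * prob A \<le> (\<integral>\<omega>. indicator A \<omega> * X i \<omega> \<partial>P)"
    using Suc.IH unfolding A_def by blast+
  have A': "A \<in> sets (F (Suc i))" using A filtration[of i "Suc i"] by auto
  have B: "B \<in> sets (F (Suc i))"
    unfolding B_def by (intro sets.Diff sets_X_ge A') simp
  have P: "A \<in> sets P" "B \<in> sets P" using A' B sets_F[of "Suc i"] by auto
  have U: "{\<omega> \<in> space P. \<exists>j\<le>Suc i. c \<le> X j \<omega>} = A \<union> B"
    unfolding A_def B_def using le_Suc_eq by auto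
  have "A \<inter> B = {}" by (auto simp: B_def)
  then have ind: "indicator (A \<union> B) \<omega> = (indicator A \<omega> + indicator B \<omega> :: real)" for \<omega>
    by (auto simp: indicator_def)
  have "c * prob (A \<union> B) = c * prob A + c * prob B"
    using \<open>A \<inter> B = {}\<close> P by (simp add: finite_measure_Union distrib_left)
  also have "\<dots> \<le> (\<integral>\<omega>. indicator A \<omega> * X (Suc i) \<omega> \<partial>P) + (\<integral>\<omega>. indicator B \<omega> * X (Suc i) \<omega> \<partial>P)"
  proof (rule add_mono)
    show "c * prob A \<le> (\<integral>\<omega>. indicator A \<omega> * X (Suc i) \<omega> \<partial>P)"
      using order_trans[OF IH submartingale[OF _ _ _ A, of "Suc i"]] by simp
    have "c * prob B = (\<integral>\<omega>. indicator B \<omega> * c \<partial>P)" using P by simp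
    also have "\<dots> \<le> (\<integral>\<omega>. indicator B \<omega> * X (Suc i) \<omega> \<partial>P)"
      by (intro integral_mono integrable_mult_indicator_real P integrable) (auto simp: indicator_def B_def)
    finally show "c * prob B \<le> (\<integral>\<omega>. indicator B \<omega> * X (Suc i) \<omega> \<partial>P)" by simp
  qed
  also have "\<dots> = (\<integral>\<omega>. indicator (A \<union> B) \<omega> * X (Suc i) \<omega> \<partial>P)"
    unfolding ind unfolding distrib_right by (intro Bochner_Integration.integral_add[symmetric] integrable_mult_indicator_real P integrable) simp_all
  finally show ?case unfolding U using sets.Un[OF A' B] by blast
qed

lemma maximal_inequality:
  assumes "0 < c"
  shows "prob {\<omega> \<in> space P. \<exists>j\<le>i. c \<le> X j \<omega>} \<le> expectation (\<lambda>\<omega>. \<bar>X i \<omega>\<bar>) / c"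
proof -
  let ?A = "{\<omega> \<in> space P. \<exists>j\<le>i. c \<le> X j \<omega>}"
  have A: "?A \<in> sets P" using maximal_inequality_aux[of i c] sets_F[of i] by blast
  have "c * prob ?A \<le> (\<integral>\<omega>. indicator ?A \<omega> * X i \<omega> \<partial>P)"
    using maximal_inequality_aux[of i c] by blast
  also have "\<dots> \<le> expectation (\<lambda>\<omega>. \<bar>X i \<omega>\<bar>)"
    by (intro integral_mono integrable_mult_indicator_real integrable integrable_abs A) (auto simp: indicator_def)
  finally show ?thesis using assms by (simp add: field_simps)
qed

lemma measurable_upcrossing_state:
  "(\<lambda>\<omega>. upcrossing_state a b (\<lambda>j. X j \<omega>) i) \<in> measurable (F i) (count_space UNIV)"
proof (induction i)
  case 0
  have [measurable]: "X 0 \<in> borel_measurable (F 0)" by (simp add: adapted)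
  have "(\<lambda>\<omega>. X 0 \<omega> \<le> a) \<in> measurable (F 0) (count_space UNIV)" by measurable
  from measurable_compose[OF this, of "\<lambda>h. (0::nat, h)" "count_space UNIV"] show ?case by simp
next
  case (Suc i)
  have [measurable]: "X (Suc i) \<in> borel_measurable (F (Suc i))" by (simp add: adapted)
  have st: "(\<lambda>\<omega>. upcrossing_state a b (\<lambda>j. X j \<omega>) i) \<in> measurable (F (Suc i)) (count_space UNIV)"
    by (rule measurable_later[OF _ _ _ Suc.IH]) simp_all
  have low: "(\<lambda>\<omega>. X (Suc i) \<omega> \<le> a) \<in> measurable (F (Suc i)) (count_space UNIV)" by measurable
  have high: "(\<lambda>\<omega>. b \<le> X (Suc i) \<omega>) \<in> measurable (F (Suc i)) (count_space UNIV)" by measurable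
  show ?case unfolding upcrossing_state.simps
  \<comment> \<open>There are countably many states, so the next state may be studied for each fixed
    current state.\<close>
  proof (rule measurable_compose_countable[OF _ st])
    fix s :: "nat \<times> bool"
    obtain k h where s: "s = (k, h)" by force
    show "(\<lambda>\<omega>. case s of (k, h) \<Rightarrow>
       if h then (if b \<le> X (Suc i) \<omega> then (Suc k, False) else (k, True)) else (k, X (Suc i) \<omega> \<le> a))
       \<in> measurable (F (Suc i)) (count_space UNIV)"
    proof (cases h)
      case True
      then show ?thesis
        using measurable_compose[OF high, of "\<lambda>c. if c then (Suc k, False) else (k, True)" "count_space UNIV"]
        by (simp add: s)
    next
      case False
      then show ?thesis
        using measurable_compose[OF low, of "\<lambda>c. (k, c)" "count_space UNIV"] by (simp add: s)
    qed
  qed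
qed

text \<open>The left side is the gain from holding (X - a)^+ exactly while the path is on its way
  up, with the position still open included so that an unfinished upcrossing does no harm. A step
  raises it by at most the increment of (X - a)^+ on the event \<open>H i\<close> of
  holding.\<close>

lemma upcrossing_expectation:
  assumes ab: "a < b"
  shows "expectation (\<lambda>\<omega>. (b - a) * real (fst (upcrossing_state a b (\<lambda>j. X j \<omega>) i))
      + of_bool (snd (upcrossing_state a b (\<lambda>j. X j \<omega>) i)) * max 0 (X i \<omega> - a))
    \<le> expectation (\<lambda>\<omega>. max 0 (X i \<omega> - a))"
proof (induction i)
  case 0
  have [measurable]: "X 0 \<in> borel_measurable P" by simp
  have "integrable P (\<lambda>\<omega>. max 0 (X 0 \<omega> - a))" by (intro integrable_max) (auto simp: integrable)
  \<comment> \<open>This product is identically 0: at time 0 the path is held only if it is at most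
    \<open>a\<close>.\<close>
  moreover have "integrable P (\<lambda>\<omega>. of_bool (X 0 \<omega> \<le> a) * max 0 (X 0 \<omega> - a))"
    by (rule integrable_const_bound[of _ 0]) auto
  ultimately show ?case
    by simp (intro integral_mono; auto)
next
  case (Suc i)
  define U where "U i \<omega> = real (fst (upcrossing_state a b (\<lambda>j. X j \<omega>) i))" for i \<omega>
  define H where "H i = {\<omega> \<in> space P. snd (upcrossing_state a b (\<lambda>j. X j \<omega>) i)}" for i
  define Y where "Y i \<omega> = max 0 (X i \<omega> - a)" for i \<omega>
  have st[measurable]: "(\<lambda>\<omega>. upcrossing_state a b (\<lambda>j. X j \<omega>) i) \<in> measurable P (count_space UNIV)" for i
    using measurable_P[OF _ measurable_upcrossing_state] by simp
  have HF: "H i \<in> sets (F i)" for i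
  proof -
    have eq: "H i = (\<lambda>\<omega>. upcrossing_state a b (\<lambda>j. X j \<omega>) i) -` {s. snd s} \<inter> space (F i)"
      using space_F[of i] by (auto simp: H_def)
    show ?thesis unfolding eq by (rule measurable_sets[OF measurable_upcrossing_state]) simp
  qed
  have HP: "H i \<in> sets P" for i using HF[of i] sets_F[of i] by auto
  have CF: "space P - H i \<in> sets (F i)"
    using sets.compl_sets[OF HF[of i]] space_F[of i] by simp
  have U: "integrable P (U i)" for i
    unfolding U_def
    by (rule integrable_const_bound[of _ "real i"]) (auto simp: upcrossing_state_le)
  have Y: "integrable P (Y i)" for i
    unfolding Y_def by (intro integrable_max) (auto simp: integrable)
  have HY: "integrable P (\<lambda>\<omega>. indicator (H i) \<omega> * Y j \<omega>)" for i j
    by (intro integrable_mult_indicator_real HP Y)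
  have eq: "expectation (\<lambda>\<omega>. (b - a) * real (fst (upcrossing_state a b (\<lambda>j. X j \<omega>) i))
      + of_bool (snd (upcrossing_state a b (\<lambda>j. X j \<omega>) i)) * max 0 (X i \<omega> - a))
     = expectation (\<lambda>\<omega>. (b - a) * U i \<omega> + indicator (H i) \<omega> * Y i \<omega>)" for i
    by (intro Bochner_Integration.integral_cong) (auto simp: U_def H_def Y_def)
  have "expectation (\<lambda>\<omega>. (b - a) * U (Suc i) \<omega> + indicator (H (Suc i)) \<omega> * Y (Suc i) \<omega>)
    \<le> expectation (\<lambda>\<omega>. (b - a) * U i \<omega> + indicator (H i) \<omega> * Y (Suc i) \<omega>)"
  proof (intro integral_mono Bochner_Integration.integrable_add integrable_mult_right HY)
    fix \<omega> assume "\<omega> \<in> space P"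
    then show "(b - a) * U (Suc i) \<omega> + indicator (H (Suc i)) \<omega> * Y (Suc i) \<omega>
      \<le> (b - a) * U i \<omega> + indicator (H i) \<omega> * Y (Suc i) \<omega>"
      using upcrossing_gain[OF ab, of "\<lambda>j. X j \<omega>" i]
      by (simp add: U_def H_def Y_def indicator_def of_bool_def)
  qed (auto intro: U)
  also have "\<dots> = expectation (\<lambda>\<omega>. (b - a) * U i \<omega> + indicator (H i) \<omega> * Y i \<omega>)
     + (expectation (\<lambda>\<omega>. indicator (H i) \<omega> * Y (Suc i) \<omega>) - expectation (\<lambda>\<omega>. indicator (H i) \<omega> * Y i \<omega>))"
    using U HY by simp
  also have "expectation (\<lambda>\<omega>. (b - a) * U i \<omega> + indicator (H i) \<omega> * Y i \<omega>) \<le> expectation (Y i)"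
    using Suc.IH unfolding eq by (simp add: Y_def[abs_def])
  also have "expectation (Y i) + (expectation (\<lambda>\<omega>. indicator (H i) \<omega> * Y (Suc i) \<omega>)
      - expectation (\<lambda>\<omega>. indicator (H i) \<omega> * Y i \<omega>)) \<le> expectation (Y (Suc i))"
  \<comment> \<open>The increment of Y over \<open>H i\<close> is at most its increment over the
    whole space, because the complement of \<open>H i\<close> is an event of the past and
    contributes a nonnegative amount.\<close>
  proof -
    have split: "expectation (Y j) = expectation (\<lambda>\<omega>. indicator (H i) \<omega> * Y j \<omega>)
        + expectation (\<lambda>\<omega>. indicator (space P - H i) \<omega> * Y j \<omega>)" for j
    proof -
      have "expectation (Y j) = expectation (\<lambda>\<omega>. indicator (H i) \<omega> * Y j \<omega> + indicator (space P - H i) \<omega> * Y j \<omega>)"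
        by (intro Bochner_Integration.integral_cong) (auto simp: indicator_def)
      also have "\<dots> = expectation (\<lambda>\<omega>. indicator (H i) \<omega> * Y j \<omega>)
        + expectation (\<lambda>\<omega>. indicator (space P - H i) \<omega> * Y j \<omega>)"
        by (intro Bochner_Integration.integral_add HY integrable_mult_indicator_real Y) (use HP in auto)
      finally show ?thesis .
    qed
    show ?thesis
      using positive_part_submartingale[of i "Suc i" "space P - H i" a] CF split[of i] split[of "Suc i"]
      by (simp add: Y_def[abs_def])
  qed
  finally show ?case unfolding eq by (simp add: Y_def[abs_def])
qed

text \<open>Markov's inequality for the greedy count, which is at least the length of any chain of
  upcrossings.\<close>

lemma upcrossing_inequality:
  assumes ab: "a < b" and k: "0 < k"
  shows "prob {\<omega> \<in> space P. upcrosses UNIV a b (\<lambda>j. X j \<omega>) k i}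
    \<le> expectation (\<lambda>\<omega>. max 0 (X i \<omega> - a)) / (b - a) / real k"
proof -
  let ?U = "\<lambda>\<omega>. fst (upcrossing_state a b (\<lambda>j. X j \<omega>) i)"
  have st[measurable]: "(\<lambda>\<omega>. upcrossing_state a b (\<lambda>j. X j \<omega>) i) \<in> measurable P (count_space UNIV)"
    using measurable_P[OF _ measurable_upcrossing_state] by simp
  have [measurable]: "X i \<in> borel_measurable P" by simp
  have [measurable]: "Measurable.pred P (\<lambda>\<omega>. snd (upcrossing_state a b (\<lambda>j. X j \<omega>) i))"
    using measurable_compose[OF st, of snd "count_space UNIV"] by simp
  have sub: "{\<omega> \<in> space P. upcrosses UNIV a b (\<lambda>j. X j \<omega>) k i} \<subseteq> {\<omega> \<in> space P. k \<le> ?U \<omega>}"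
    using upcrossing_state_greedy[OF ab] by auto
  have U: "integrable P (\<lambda>\<omega>. real (?U \<omega>))"
    by (rule integrable_const_bound[of _ "real i"]) (auto simp: upcrossing_state_le)
  have Ue: "{\<omega> \<in> space P. k \<le> ?U \<omega>} \<in> sets P" by measurable
  have "prob {\<omega> \<in> space P. upcrosses UNIV a b (\<lambda>j. X j \<omega>) k i} \<le> prob {\<omega> \<in> space P. k \<le> ?U \<omega>}"
    using sub Ue by (intro finite_measure_mono)
  moreover have "(b - a) * real k * prob {\<omega> \<in> space P. k \<le> ?U \<omega>}
      = expectation (\<lambda>\<omega>. indicator {\<omega> \<in> space P. k \<le> ?U \<omega>} \<omega> * ((b - a) * real k))"
    using Ue by simp
  moreover have "\<dots> \<le> expectation (\<lambda>\<omega>. (b - a) * real (?U \<omega>)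
      + of_bool (snd (upcrossing_state a b (\<lambda>j. X j \<omega>) i)) * max 0 (X i \<omega> - a))"
  proof (intro integral_mono integrable_mult_indicator_real Ue Bochner_Integration.integrable_add
      integrable_mult_right)
    show "integrable P (\<lambda>\<omega>. of_bool (snd (upcrossing_state a b (\<lambda>j. X j \<omega>) i)) * max 0 (X i \<omega> - a))"
      by (rule Bochner_Integration.integrable_bound[of _ "\<lambda>\<omega>. max 0 (X i \<omega> - a)"])
         (auto intro!: integrable_max simp: integrable)
    fix \<omega>
    have "indicator {\<omega> \<in> space P. k \<le> ?U \<omega>} \<omega> * ((b - a) * real k) \<le> (b - a) * real (?U \<omega>)"
      using ab by (auto simp: indicator_def intro!: mult_left_mono)
    moreover have "0 \<le> of_bool (snd (upcrossing_state a b (\<lambda>j. X j \<omega>) i)) * max 0 (X i \<omega> - a)" by simp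
    ultimately show "indicator {\<omega> \<in> space P. k \<le> ?U \<omega>} \<omega> * ((b - a) * real k) \<le> (b - a) * real (?U \<omega>)
      + of_bool (snd (upcrossing_state a b (\<lambda>j. X j \<omega>) i)) * max 0 (X i \<omega> - a)" by linarith
  qed (auto intro: U)
  moreover note upcrossing_expectation[OF ab, of i]
  ultimately have "(b - a) * real k * prob {\<omega> \<in> space P. k \<le> ?U \<omega>} \<le> expectation (\<lambda>\<omega>. max 0 (X i \<omega> - a))"
    by linarith
  then have "prob {\<omega> \<in> space P. k \<le> ?U \<omega>} \<le> expectation (\<lambda>\<omega>. max 0 (X i \<omega> - a)) / (b - a) / real k"
    using ab k by (simp add: field_simps)
  then show ?thesis
    using \<open>prob {\<omega> \<in> space P. upcrosses UNIV a b (\<lambda>j. X j \<omega>) k i} \<le> _\<close> by linarith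
qed

end

text \<open>Consecutive factorials divide each other, so these grids are nested, as those with
  denominators 1, 2, 3, ... are not; and every positive integer divides some factorial, so together
  they exhaust the nonnegative rationals.\<close>

definition fact_grid :: "nat \<Rightarrow> real set" where
  "fact_grid n = range (\<lambda>i::nat. real i / fact n)"

lemma incseq_fact_grid: "incseq fact_grid"
proof (rule incseq_SucI)
  fix n
  have "real i / fact n = real (Suc n * i) / fact (Suc n)" for i
    by (simp add: field_simps del: of_nat_Suc, simp add: algebra_simps)
  then show "fact_grid n \<subseteq> fact_grid (Suc n)" unfolding fact_grid_def by blast
qed

lemma Union_fact_grid: "(\<Union>n. fact_grid n) = \<rat> \<inter> {0..}"
proof
  show "(\<Union>n. fact_grid n) \<subseteq> \<rat> \<inter> {0..}"
  proof -
    have "(fact n :: real) \<in> \<rat>" for n by (metis Rats_of_nat of_nat_fact)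
    then show ?thesis by (auto simp: fact_grid_def)
  qed
  show "\<rat> \<inter> {0..} \<subseteq> (\<Union>n. fact_grid n)"
  proof
    fix x :: real assume x: "x \<in> \<rat> \<inter> {0..}"
    then obtain m n :: nat where n: "n \<noteq> 0" and mn: "\<bar>x\<bar> = real m / real n"
      using Rats_abs_nat_div_natE[of x] by blast
    have "n dvd fact n" using n by (intro dvd_fact) auto
    then obtain k where k: "fact n = n * k" by auto
    have "(fact n :: real) = real n * real k" using k by (metis of_nat_fact of_nat_mult)
    moreover have "k \<noteq> 0" using k by (metis fact_nonzero mult_0_right)
    ultimately have "x = real (m * k) / fact n" using x mn n by simp
    then have "x \<in> fact_grid n" unfolding fact_grid_def by blast
    then show "x \<in> (\<Union>n. fact_grid n)" by blast
  qed
qed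

lemma countable_fact_grid: "countable (fact_grid n)"
  by (simp add: fact_grid_def)

section \<open>Almost sure path properties along rational times\<close>

locale real_time_submartingale = scalar_submartingale P F X "{0..} :: real set"
  for P :: "'a measure" and F X
begin

lemma grid_submartingale:
  "nat_submartingale P (\<lambda>i. F (real i / fact n)) (\<lambda>i. X (real i / fact n))"
proof unfold_locales
  fix i j :: nat and A assume "i \<le> j"
  then have le: "real i / fact n \<le> real j / fact n" by (simp add: divide_right_mono)
  show "sets (F (real i / fact n)) \<subseteq> sets (F (real j / fact n))"
    using le by (intro filtration) auto
  assume "A \<in> sets (F (real i / fact n))"
  with le show "(\<integral>\<omega>. indicator A \<omega> * X (real i / fact n) \<omega> \<partial>P)
    \<le> (\<integral>\<omega>. indicator A \<omega> * X (real j / fact n) \<omega> \<partial>P)"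
    by (intro submartingale) auto
qed (auto intro!: subalg adapted integrable)

text \<open>The integer \<open>N\<close> lies on every grid, with index \<open>N * fact n\<close>,
  so the upcrossing bound always involves the same variable X (real N). It is therefore uniform in
  \<open>n\<close>.\<close>

lemma AE_finitely_many_upcrossings:
  assumes ab: "a < b"
  shows "AE \<omega> in P. \<exists>k. \<not> upcrosses (\<rat> \<inter> {0..}) a b (\<lambda>r. X r \<omega>) k (real N)"
proof -
  define E where "E n k = {\<omega> \<in> space P. upcrosses (fact_grid n) a b (\<lambda>r. X r \<omega>) k (real N)}" for n k
  have sub: "fact_grid n \<subseteq> {0..}" for n by (auto simp: fact_grid_def)
  have "AE \<omega> in P. \<exists>k. \<forall>n. \<omega> \<notin> E n k"
  proof (rule AE_not_all_levels)
    show "E n k \<in> sets P" for n k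
      unfolding E_def by (rule sets_upcrosses[OF countable_fact_grid sub])
    show "incseq (\<lambda>n. E n k)" for k
      using incseq_fact_grid unfolding E_def incseq_def by (blast intro: upcrosses_mono)
    show "prob (E n k) \<le> (expectation (\<lambda>\<omega>. max 0 (X (real N) \<omega> - a)) / (b - a)) / real k"
      if k: "0 < k" for n k
    proof -
      interpret grid: nat_submartingale P "\<lambda>i. F (real i / fact n)" "\<lambda>i. X (real i / fact n)"
        by (rule grid_submartingale)
      have meas: "{\<omega> \<in> space P. upcrosses UNIV a b (\<lambda>j. X (real j / fact n) \<omega>) k (N * fact n)} \<in> sets P"
        by (rule grid.sets_upcrosses) auto
      have "E n k \<subseteq> {\<omega> \<in> space P. upcrosses UNIV a b (\<lambda>j. X (real j / fact n) \<omega>) k (N * fact n)}"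
      proof
        fix \<omega> assume w: "\<omega> \<in> E n k"
        then have "upcrosses (range (\<lambda>i::nat. real i / fact n)) a b (\<lambda>r. X r \<omega>) k (real (N * fact n) / fact n)"
          by (simp add: E_def fact_grid_def)
        from upcrosses_grid[OF _ this]
        show "\<omega> \<in> {\<omega> \<in> space P. upcrosses UNIV a b (\<lambda>j. X (real j / fact n) \<omega>) k (N * fact n)}"
          using w by (simp add: E_def)
      qed
      then have "prob (E n k) \<le> prob {\<omega> \<in> space P. upcrosses UNIV a b (\<lambda>j. X (real j / fact n) \<omega>) k (N * fact n)}"
        by (intro finite_measure_mono meas)
      also note grid.upcrossing_inequality[OF ab k, of "N * fact n"]
      finally show ?thesis by simp
    qed
  qed
  with AE_space show ?thesis
  proof eventually_elim
    case (elim \<omega>)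
    then obtain k where k: "\<And>n. \<omega> \<notin> E n k" by auto
    have "\<not> upcrosses (\<Union>n. fact_grid n) a b (\<lambda>r. X r \<omega>) k (real N)"
      using upcrosses_incseq_Union[OF incseq_fact_grid, of a b "\<lambda>r. X r \<omega>" k "real N"] k elim(1)
      by (auto simp: E_def)
    then show ?case unfolding Union_fact_grid by blast
  qed
qed

text \<open>From above only, as the maximal inequality gives no more. The lower bound on support
  values comes later from opposite directions.\<close>

lemma AE_bounded_above:
  "AE \<omega> in P. \<exists>K. \<forall>r\<in>\<rat> \<inter> {0..real N}. X r \<omega> \<le> K"
proof -
  define E where "E n k = {\<omega> \<in> space P. \<exists>r\<in>fact_grid n \<inter> {0..real N}. real k \<le> X r \<omega>}" for n and k :: nat
  have "AE \<omega> in P. \<exists>k. \<forall>n. \<omega> \<notin> E n k"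
  proof (rule AE_not_all_levels)
    show meas: "E n k \<in> sets P" for n k
    proof -
      have eq: "E n k = (\<Union>r\<in>fact_grid n \<inter> {0..real N}. {\<omega> \<in> space P. real k \<le> X r \<omega>})"
        by (auto simp: E_def)
      show ?thesis unfolding eq
      proof (intro sets.countable_UN'')
        show "countable (fact_grid n \<inter> {0..real N})" using countable_fact_grid by auto
        fix r assume r: "r \<in> fact_grid n \<inter> {0..real N}"
        then have [measurable]: "X r \<in> borel_measurable P" by (intro measurable_X) simp
        show "{\<omega> \<in> space P. real k \<le> X r \<omega>} \<in> sets P" by measurable
      qed
    qed
    show "incseq (\<lambda>n. E n k)" for k
      using incseq_fact_grid unfolding E_def incseq_def by blast
    show "prob (E n k) \<le> expectation (\<lambda>\<omega>. \<bar>X (real N) \<omega>\<bar>) / real k" if k: "0 < k" for n k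
    proof -
      interpret grid: nat_submartingale P "\<lambda>i. F (real i / fact n)" "\<lambda>i. X (real i / fact n)"
        by (rule grid_submartingale)
      let ?A = "{\<omega> \<in> space P. \<exists>j\<le>N * fact n. real k \<le> X (real j / fact n) \<omega>}"
      have meas: "?A \<in> sets P"
        using grid.maximal_inequality_aux[of "N * fact n" "real k"] grid.sets_F[of "N * fact n"] by blast
      have "E n k \<subseteq> ?A"
      proof
        fix \<omega> assume w: "\<omega> \<in> E n k"
        then obtain j where j: "real j / fact n \<le> real N" "real k \<le> X (real j / fact n) \<omega>"
          by (auto simp: E_def fact_grid_def)
        then have "real j \<le> real (N * fact n)" by (simp add: field_simps)
        then have "j \<le> N * fact n" by (simp only: of_nat_le_iff)
        then show "\<omega> \<in> ?A" using j w by (auto simp: E_def)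
      qed
      then have "prob (E n k) \<le> prob ?A" by (intro finite_measure_mono meas)
      also have "\<dots> \<le> expectation (\<lambda>\<omega>. \<bar>X (real (N * fact n) / fact n) \<omega>\<bar>) / real k"
        using k by (intro grid.maximal_inequality) simp
      finally show ?thesis by simp
    qed
  qed
  with AE_space show ?thesis
  proof eventually_elim
    case (elim \<omega>)
    then obtain k where k: "\<And>n. \<omega> \<notin> E n k" by auto
    show ?case
    proof (intro exI[of _ "real k"] ballI)
      fix r :: real assume "r \<in> \<rat> \<inter> {0..real N}"
      then have "r \<in> (\<Union>n. fact_grid n)" "r \<in> {0..real N}" unfolding Union_fact_grid by auto
      then show "X r \<omega> \<le> real k" using k elim(1) by (force simp: E_def)
    qed
  qed
qed

end

section \<open>One-sided limits from finitely many upcrossings\<close>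

lemma bounded_oscillation_free_convergent:
  fixes f :: "'i \<Rightarrow> real"
  assumes A: "A \<noteq> bot" and bdd: "eventually (\<lambda>r. \<bar>f r\<bar> \<le> K) A"
    and osc: "\<And>a b. a \<in> \<rat> \<Longrightarrow> b \<in> \<rat> \<Longrightarrow> a < b \<Longrightarrow>
      \<not> (frequently (\<lambda>r. f r \<le> a) A \<and> frequently (\<lambda>r. b \<le> f r) A)"
  shows "\<exists>l. (f \<longlongrightarrow> l) A"
proof -
  let ?g = "\<lambda>r. ereal (f r)"
  have lower: "ereal (- K) \<le> Liminf A ?g"
    by (intro Liminf_bounded) (use bdd in \<open>auto elim!: eventually_mono\<close>)
  have upper: "Limsup A ?g \<le> ereal K"
    by (intro Limsup_bounded) (use bdd in \<open>auto elim!: eventually_mono\<close>)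
  have le: "Liminf A ?g \<le> Limsup A ?g" by (rule Liminf_le_Limsup[OF A])
  \<comment> \<open>Between different extended limits there are two rational levels a < b, and the
    function would be frequently below the one and frequently above the other. The bound
    \<open>K\<close> then makes the common value finite.\<close>
  have "\<not> Liminf A ?g < Limsup A ?g"
  proof
    assume "Liminf A ?g < Limsup A ?g"
    then obtain c where c: "Liminf A ?g < ereal c" "ereal c < Limsup A ?g"
      using lower upper by (metis ereal_dense2)
    then obtain d where d: "ereal c < ereal d" "ereal d < Limsup A ?g" by (metis ereal_dense2)
    obtain a where a: "a \<in> \<rat>" "c < a" "a < d" using d Rats_dense_in_real by auto
    obtain b where b: "b \<in> \<rat>" "a < b" "b < d" using a Rats_dense_in_real by blast
    have "frequently (\<lambda>r. f r \<le> a) A"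
    proof (rule ccontr)
      assume "\<not> frequently (\<lambda>r. f r \<le> a) A"
      then have "eventually (\<lambda>r. ereal a \<le> ?g r) A"
        by (auto simp: frequently_def elim!: eventually_mono)
      then have "ereal a \<le> Liminf A ?g" by (rule Liminf_bounded)
      then show False using c a by (metis ereal_less_le ereal_less_eq(3) leD less_imp_le less_le_trans)
    qed
    moreover have "frequently (\<lambda>r. b \<le> f r) A"
    proof (rule ccontr)
      assume "\<not> frequently (\<lambda>r. b \<le> f r) A"
      then have "eventually (\<lambda>r. ?g r \<le> ereal b) A"
        by (auto simp: frequently_def elim!: eventually_mono)
      then have "Limsup A ?g \<le> ereal b" by (rule Limsup_bounded)
      then show False using d b by (metis ereal_less_eq(3) leD less_imp_le order_trans)
    qed
    ultimately show False using osc[OF a(1) b(1) b(2)] by blast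
  qed
  then have eq: "Liminf A ?g = Limsup A ?g" using le by simp
  then have "(?g \<longlongrightarrow> Limsup A ?g) A" by (intro Liminf_eq_Limsup A) auto
  moreover obtain l where "Limsup A ?g = ereal l"
    using lower upper eq by (cases "Limsup A ?g") auto
  ultimately show ?thesis by auto
qed

text \<open>Approaching \<open>t\<close> from the right matches the backward recursion of
  \<open>upcrosses\<close>: pick a high time before \<open>e\<close>, then a low time between
  \<open>t\<close> and it, and continue before that low time.\<close>

lemma upcrosses_if_oscillates_right:
  fixes f :: "real \<Rightarrow> real"
  assumes "frequently (\<lambda>r. f r \<le> a) (at t within (\<rat> \<inter> {t<..}))"
    and "frequently (\<lambda>r. b \<le> f r) (at t within (\<rat> \<inter> {t<..}))" and t: "0 \<le> t"
  shows "t < e \<Longrightarrow> upcrosses (\<rat> \<inter> {0..}) a b f k e"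
proof (induction k arbitrary: e)
  case (Suc k)
  obtain s where s: "s \<in> \<rat>" "t < s" "s < e" "b \<le> f s"
  proof -
    have "0 < e - t" using Suc.prems by simp
    then obtain s where "s \<in> \<rat> \<inter> {t<..}" "dist s t < e - t" "b \<le> f s"
      using assms(2) unfolding frequently_def eventually_at by (metis (lifting))
    then show ?thesis using that[of s] by (auto simp: dist_real_def)
  qed
  obtain r where r: "r \<in> \<rat>" "t < r" "r < s" "f r \<le> a"
  proof -
    have "0 < s - t" using s by simp
    then obtain r where "r \<in> \<rat> \<inter> {t<..}" "dist r t < s - t" "f r \<le> a"
      using assms(1) unfolding frequently_def eventually_at by (metis (lifting))
    then show ?thesis using that[of r] by (auto simp: dist_real_def)
  qed
  show ?case using Suc.IH[OF r(2)] r s t unfolding upcrosses.simps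
    by (intro bexI[of _ r] bexI[of _ s]) auto
qed simp

text \<open>Here new upcrossings are appended at the end. The chain so far must stop at some e < t,
  to leave room for a further pair between \<open>e\<close> and \<open>t\<close>.\<close>

lemma upcrosses_if_oscillates_left:
  fixes f :: "real \<Rightarrow> real"
  assumes "frequently (\<lambda>r. f r \<le> a) (at t within (\<rat> \<inter> {0..<t}))"
    and "frequently (\<lambda>r. b \<le> f r) (at t within (\<rat> \<inter> {0..<t}))" and t: "0 < t"
  shows "\<exists>e<t. upcrosses (\<rat> \<inter> {0..}) a b f k e"
proof (induction k)
  case 0
  then show ?case using t by auto
next
  case (Suc k)
  then obtain e where e: "e < t" "upcrosses (\<rat> \<inter> {0..}) a b f k e" by auto
  obtain r where r: "r \<in> \<rat>" "0 \<le> r" "r < t" "e < r" "f r \<le> a"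
  proof -
    have "0 < t - e" using e by simp
    then obtain r where "r \<in> \<rat> \<inter> {0..<t}" "dist r t < t - e" "f r \<le> a"
      using assms(1) unfolding frequently_def eventually_at by (metis (lifting))
    then show ?thesis using that[of r] by (auto simp: dist_real_def)
  qed
  obtain s where s: "s \<in> \<rat>" "0 \<le> s" "s < t" "r < s" "b \<le> f s"
  proof -
    have "0 < t - r" using r by simp
    then obtain s where "s \<in> \<rat> \<inter> {0..<t}" "dist s t < t - r" "b \<le> f s"
      using assms(2) unfolding frequently_def eventually_at by (metis (lifting))
    then show ?thesis using that[of s] by (auto simp: dist_real_def)
  qed
  have "upcrosses (\<rat> \<inter> {0..}) a b f k r" using upcrosses_mono[OF e(2) subset_refl] r by simp
  then have "upcrosses (\<rat> \<inter> {0..}) a b f (Suc k) s"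
    using r s unfolding upcrosses.simps by (intro bexI[of _ r] bexI[of _ s]) auto
  then show ?case using s by auto
qed

lemma right_filter_nontrivial: "at (t::real) within (\<rat> \<inter> {t<..}) \<noteq> bot"
proof -
  have "\<exists>y\<in>\<rat> \<inter> {t<..}. y \<noteq> t \<and> dist y t < e" if "0 < e" for e
  proof -
    have "t < t + e" using \<open>0 < e\<close> by simp
    then obtain q where "q \<in> \<rat>" "t < q" "q < t + e" using Rats_dense_in_real by blast
    then show ?thesis by (intro bexI[of _ q]) (auto simp: dist_real_def)
  qed
  then show ?thesis by (simp add: trivial_limit_within islimpt_approachable)
qed

lemma left_filter_nontrivial: "0 < t \<Longrightarrow> at (t::real) within (\<rat> \<inter> {0..<t}) \<noteq> bot"
proof -
  assume t: "0 < t"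
  have "\<exists>y\<in>\<rat> \<inter> {0..<t}. y \<noteq> t \<and> dist y t < e" if "0 < e" for e
  proof -
    have "max 0 (t - e) < t" using \<open>0 < e\<close> t by simp
    then obtain q where "q \<in> \<rat>" "max 0 (t - e) < q" "q < t" using Rats_dense_in_real by blast
    then show ?thesis by (intro bexI[of _ q]) (auto simp: dist_real_def)
  qed
  then show ?thesis by (simp add: trivial_limit_within islimpt_approachable)
qed

lemma one_sided_limits_exist:
  fixes f :: "real \<Rightarrow> real"
  assumes bdd: "\<And>r. r \<in> \<rat> \<inter> {0..real N} \<Longrightarrow> \<bar>f r\<bar> \<le> K"
    and up: "\<And>a b. a \<in> \<rat> \<Longrightarrow> b \<in> \<rat> \<Longrightarrow> a < b \<Longrightarrow> \<exists>k. \<not> upcrosses (\<rat> \<inter> {0..}) a b f k (real N)"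
  shows "0 \<le> t \<Longrightarrow> t < real N \<Longrightarrow> \<exists>l. (f \<longlongrightarrow> l) (at t within (\<rat> \<inter> {t<..}))"
    and "0 < t \<Longrightarrow> t < real N \<Longrightarrow> \<exists>l. (f \<longlongrightarrow> l) (at t within (\<rat> \<inter> {0..<t}))"
proof -
  assume t: "0 \<le> t" "t < real N"
  have "eventually (\<lambda>r. \<bar>f r\<bar> \<le> K) (at t within (\<rat> \<inter> {t<..}))"
    unfolding eventually_at using t
    by (intro exI[of _ "real N - t"]) (auto intro!: bdd simp: dist_real_def)
  then show "\<exists>l. (f \<longlongrightarrow> l) (at t within (\<rat> \<inter> {t<..}))"
    using up upcrosses_if_oscillates_right[of f _ t _ "real N"] t
    by (intro bounded_oscillation_free_convergent right_filter_nontrivial) blast+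
next
  assume t: "0 < t" "t < real N"
  have "eventually (\<lambda>r. \<bar>f r\<bar> \<le> K) (at t within (\<rat> \<inter> {0..<t}))"
    unfolding eventually_at using t
    by (intro exI[of _ 1]) (auto intro!: bdd simp: dist_real_def)
  moreover have "\<not> (frequently (\<lambda>r. f r \<le> a) (at t within (\<rat> \<inter> {0..<t})) \<and>
      frequently (\<lambda>r. b \<le> f r) (at t within (\<rat> \<inter> {0..<t})))" if ab: "a \<in> \<rat>" "b \<in> \<rat>" "a < b" for a b
  proof
    assume fr: "frequently (\<lambda>r. f r \<le> a) (at t within (\<rat> \<inter> {0..<t})) \<and>
      frequently (\<lambda>r. b \<le> f r) (at t within (\<rat> \<inter> {0..<t}))"
    obtain k where k: "\<not> upcrosses (\<rat> \<inter> {0..}) a b f k (real N)" using up[OF ab] by blast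
    obtain e where "e < t" "upcrosses (\<rat> \<inter> {0..}) a b f k e"
      using upcrosses_if_oscillates_left fr t by blast
    then show False using k upcrosses_mono[of _ a b f k e _ "real N"] t by auto
  qed
  ultimately show "\<exists>l. (f \<longlongrightarrow> l) (at t within (\<rat> \<inter> {0..<t}))"
    by (intro bounded_oscillation_free_convergent left_filter_nontrivial t) blast+
qed

section \<open>Right limits of submartingales with right-continuous mean\<close>

lemma (in prob_space) AE_eq_if_integrals_eq:
  fixes f g :: "'a \<Rightarrow> real"
  assumes G: "subalgebra M G"
    and f: "f \<in> borel_measurable G" "integrable M f" and g: "g \<in> borel_measurable G" "integrable M g"
    and eq: "\<And>A. A \<in> sets G \<Longrightarrow> (\<integral>\<omega>. indicator A \<omega> * f \<omega> \<partial>M) = (\<integral>\<omega>. indicator A \<omega> * g \<omega> \<partial>M)"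
  shows "AE \<omega> in M. f \<omega> = g \<omega>"
proof -
  have le: "AE \<omega> in M. \<not> h \<omega> < k \<omega>"
    if h: "h \<in> borel_measurable G" "integrable M h" and k: "k \<in> borel_measurable G" "integrable M k"
      and hk: "\<And>A. A \<in> sets G \<Longrightarrow> (\<integral>\<omega>. indicator A \<omega> * h \<omega> \<partial>M) = (\<integral>\<omega>. indicator A \<omega> * k \<omega> \<partial>M)"
    for h k :: "'a \<Rightarrow> real"
  proof -
    note [measurable] = h(1) k(1)
    define A where "A = {\<omega> \<in> space G. h \<omega> < k \<omega>}"
    have A: "A \<in> sets G" unfolding A_def by measurable
    then have AM: "A \<in> sets M" using G by (auto simp: subalgebra_def)
    have int: "integrable M (\<lambda>\<omega>. indicator A \<omega> * h \<omega>)" "integrable M (\<lambda>\<omega>. indicator A \<omega> * k \<omega>)"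
      using integrable_mult_indicator[OF AM h(2)] integrable_mult_indicator[OF AM k(2)] by simp_all
    have "(\<integral>\<omega>. indicator A \<omega> * k \<omega> - indicator A \<omega> * h \<omega> \<partial>M) = 0"
      using int hk[OF A] by simp
    then have "AE \<omega> in M. indicator A \<omega> * k \<omega> - indicator A \<omega> * h \<omega> = 0"
      using int by (subst (asm) integral_nonneg_eq_0_iff_AE) (auto simp: A_def indicator_def)
    with AE_space show ?thesis
      by eventually_elim (use G in \<open>auto simp: A_def indicator_def subalgebra_def split: if_splits\<close>)
  qed
  have "AE \<omega> in M. \<not> f \<omega> < g \<omega>" using f g eq by (rule le)
  moreover have "AE \<omega> in M. \<not> g \<omega> < f \<omega>" using g f eq[symmetric] by (rule le)
  ultimately show ?thesis by eventually_elim simp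
qed

text \<open>Vitali's theorem with an explicit tail bound \<open>e\<close>. Fatou's lemma makes
  \<open>Y\<close> integrable; clipping to the interval from -k to k leaves errors of at most the
  tails, and the clipped variables converge by dominated convergence.\<close>

lemma (in prob_space) L1_convergence_if_uniformly_integrable:
  fixes X :: "nat \<Rightarrow> 'a \<Rightarrow> real"
  assumes X: "\<And>n. integrable M (X n)" and Y[measurable]: "Y \<in> borel_measurable M"
    and lim: "AE \<omega> in M. (\<lambda>n. X n \<omega>) \<longlonglongrightarrow> Y \<omega>"
    and C: "\<And>n. (\<integral>\<omega>. \<bar>X n \<omega>\<bar> \<partial>M) \<le> C"
    and ui: "\<And>n k. (\<integral>\<omega>. indicator {\<omega> \<in> space M. real k < \<bar>X n \<omega>\<bar>} \<omega> * \<bar>X n \<omega>\<bar> \<partial>M) \<le> e k"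
    and e: "e \<longlonglongrightarrow> (0::real)"
  shows "integrable M Y" and "(\<lambda>n. \<integral>\<omega>. \<bar>X n \<omega> - Y \<omega>\<bar> \<partial>M) \<longlonglongrightarrow> 0"
proof -
  have [measurable]: "X n \<in> borel_measurable M" for n using X by auto
  show Yi: "integrable M Y"
  proof (rule integrableI_bounded)
    have "(\<integral>\<^sup>+ \<omega>. ennreal \<bar>Y \<omega>\<bar> \<partial>M) = (\<integral>\<^sup>+ \<omega>. liminf (\<lambda>n. ennreal \<bar>X n \<omega>\<bar>) \<partial>M)"
    proof (intro nn_integral_cong_AE)
      show "AE \<omega> in M. ennreal \<bar>Y \<omega>\<bar> = liminf (\<lambda>n. ennreal \<bar>X n \<omega>\<bar>)"
        using lim
      proof eventually_elim
        case (elim \<omega>)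
        then have "(\<lambda>n. ennreal \<bar>X n \<omega>\<bar>) \<longlonglongrightarrow> ennreal \<bar>Y \<omega>\<bar>"
          by (intro tendsto_ennrealI tendsto_rabs)
        then show ?case by (intro lim_imp_Liminf[symmetric]) auto
      qed
    qed
    also have "\<dots> \<le> liminf (\<lambda>n. \<integral>\<^sup>+ \<omega>. ennreal \<bar>X n \<omega>\<bar> \<partial>M)"
      by (intro nn_integral_liminf) measurable
    also have "\<dots> \<le> limsup (\<lambda>n. \<integral>\<^sup>+ \<omega>. ennreal \<bar>X n \<omega>\<bar> \<partial>M)"
      by (intro Liminf_le_Limsup) auto
    also have "\<dots> \<le> ennreal C"
    proof (intro Limsup_bounded always_eventually allI)
      fix n
      have "(\<integral>\<^sup>+ \<omega>. ennreal \<bar>X n \<omega>\<bar> \<partial>M) = ennreal (\<integral>\<omega>. \<bar>X n \<omega>\<bar> \<partial>M)"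
        by (intro nn_integral_eq_integral integrable_abs X) auto
      then show "(\<integral>\<^sup>+ \<omega>. ennreal \<bar>X n \<omega>\<bar> \<partial>M) \<le> ennreal C" using C by (simp add: ennreal_leI)
    qed
    also have "\<dots> < \<infinity>" by simp
    finally show "(\<integral>\<^sup>+ \<omega>. ennreal (norm (Y \<omega>)) \<partial>M) < \<infinity>" by simp
  qed measurable
  define cl :: "nat \<Rightarrow> real \<Rightarrow> real" where "cl k x = max (- real k) (min (real k) x)" for k x
  have [measurable]: "cl k \<in> borel_measurable borel" for k unfolding cl_def by measurable
  have cl_bdd: "\<bar>cl k x\<bar> \<le> real k" for k x by (auto simp: cl_def)
  have cl_int: "integrable M (\<lambda>\<omega>. cl k (f \<omega>))" if [measurable]: "f \<in> borel_measurable M" for k f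
    using cl_bdd by (intro integrable_const_bound[of _ "real k"]) auto
  have cl_err: "\<bar>f \<omega> - cl k (f \<omega>)\<bar> \<le> indicator {\<omega> \<in> space M. real k < \<bar>f \<omega>\<bar>} \<omega> * \<bar>f \<omega>\<bar>"
    if "\<omega> \<in> space M" for f :: "'a \<Rightarrow> real" and \<omega> k
    using that by (auto simp: cl_def indicator_def)
  have tail_int: "integrable M (\<lambda>\<omega>. indicator {\<omega> \<in> space M. real k < \<bar>f \<omega>\<bar>} \<omega> * \<bar>f \<omega>\<bar>)"
    if f: "integrable M f" for f :: "'a \<Rightarrow> real" and k
  proof -
    have [measurable]: "f \<in> borel_measurable M" using f by auto
    show ?thesis using integrable_mult_indicator[OF _ integrable_abs[OF f], of "{\<omega> \<in> space M. real k < \<bar>f \<omega>\<bar>}"]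
      by simp
  qed
  have cl_err_int: "(\<integral>\<omega>. \<bar>f \<omega> - cl k (f \<omega>)\<bar> \<partial>M)
      \<le> (\<integral>\<omega>. indicator {\<omega> \<in> space M. real k < \<bar>f \<omega>\<bar>} \<omega> * \<bar>f \<omega>\<bar> \<partial>M)"
    if f: "integrable M f" for f :: "'a \<Rightarrow> real" and k
    using f by (intro integral_mono integrable_abs Bochner_Integration.integrable_diff cl_int tail_int cl_err) auto
  have Ytail: "(\<lambda>k. \<integral>\<omega>. indicator {\<omega> \<in> space M. real k < \<bar>Y \<omega>\<bar>} \<omega> * \<bar>Y \<omega>\<bar> \<partial>M) \<longlonglongrightarrow> (\<integral>\<omega>. 0 \<partial>M)"
  proof (rule integral_dominated_convergence)
    show "AE \<omega> in M. (\<lambda>k. indicator {\<omega> \<in> space M. real k < \<bar>Y \<omega>\<bar>} \<omega> * \<bar>Y \<omega>\<bar>) \<longlonglongrightarrow> 0"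
    proof (intro AE_I2 tendsto_eventually)
      fix \<omega>
      obtain m :: nat where "\<bar>Y \<omega>\<bar> \<le> real m" using real_arch_simple by blast
      then show "\<forall>\<^sub>F k in sequentially. indicator {\<omega> \<in> space M. real k < \<bar>Y \<omega>\<bar>} \<omega> * \<bar>Y \<omega>\<bar> = 0"
        by (intro eventually_sequentiallyI[of m]) (auto simp: indicator_def)
    qed
    show "integrable M (\<lambda>\<omega>. \<bar>Y \<omega>\<bar>)" using Yi by auto
  qed (auto simp: indicator_def)
  show "(\<lambda>n. \<integral>\<omega>. \<bar>X n \<omega> - Y \<omega>\<bar> \<partial>M) \<longlonglongrightarrow> 0"
  proof (rule order_tendstoI)
    fix a :: real assume "0 < a"
    then have a: "0 < a / 3" by simp
    have "\<forall>\<^sub>F k in sequentially. e k < a / 3" using order_tendstoD(2)[OF e a] .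
    moreover have "\<forall>\<^sub>F k in sequentially. (\<integral>\<omega>. indicator {\<omega> \<in> space M. real k < \<bar>Y \<omega>\<bar>} \<omega> * \<bar>Y \<omega>\<bar> \<partial>M) < a / 3"
      using order_tendstoD(2)[OF Ytail, of "a / 3"] a by simp
    ultimately have "\<forall>\<^sub>F k in sequentially. e k < a / 3 \<and>
        (\<integral>\<omega>. indicator {\<omega> \<in> space M. real k < \<bar>Y \<omega>\<bar>} \<omega> * \<bar>Y \<omega>\<bar> \<partial>M) < a / 3"
      by eventually_elim simp
    then obtain k where k: "e k < a / 3" "(\<integral>\<omega>. indicator {\<omega> \<in> space M. real k < \<bar>Y \<omega>\<bar>} \<omega> * \<bar>Y \<omega>\<bar> \<partial>M) < a / 3"
      using eventually_happens'[OF sequentially_bot] by blast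
    have "(\<lambda>n. \<integral>\<omega>. \<bar>cl k (X n \<omega>) - cl k (Y \<omega>)\<bar> \<partial>M) \<longlonglongrightarrow> (\<integral>\<omega>. 0 \<partial>M)"
    proof (rule integral_dominated_convergence)
      show "AE \<omega> in M. (\<lambda>n. \<bar>cl k (X n \<omega>) - cl k (Y \<omega>)\<bar>) \<longlonglongrightarrow> 0"
        using lim
      proof eventually_elim
        case (elim \<omega>)
        then have "(\<lambda>n. \<bar>cl k (X n \<omega>) - cl k (Y \<omega>)\<bar>) \<longlonglongrightarrow> \<bar>cl k (Y \<omega>) - cl k (Y \<omega>)\<bar>"
          unfolding cl_def by (intro tendsto_intros)
        then show ?case by simp
      qed
      show "integrable M (\<lambda>\<omega>. 2 * real k)" by simp
      show "AE \<omega> in M. norm \<bar>cl k (X n \<omega>) - cl k (Y \<omega>)\<bar> \<le> 2 * real k" for n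
      proof (intro AE_I2)
        fix \<omega>
        show "norm \<bar>cl k (X n \<omega>) - cl k (Y \<omega>)\<bar> \<le> 2 * real k"
          using cl_bdd[of k "X n \<omega>"] cl_bdd[of k "Y \<omega>"] by simp
      qed
    qed measurable
    then have "\<forall>\<^sub>F n in sequentially. (\<integral>\<omega>. \<bar>cl k (X n \<omega>) - cl k (Y \<omega>)\<bar> \<partial>M) < a / 3"
      using a by (intro order_tendstoD(2)[of _ 0]) simp_all
    then show "\<forall>\<^sub>F n in sequentially. (\<integral>\<omega>. \<bar>X n \<omega> - Y \<omega>\<bar> \<partial>M) < a"
    proof eventually_elim
      case (elim n)
      have "(\<integral>\<omega>. \<bar>X n \<omega> - Y \<omega>\<bar> \<partial>M) \<le> (\<integral>\<omega>. \<bar>X n \<omega> - cl k (X n \<omega>)\<bar>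
          + (\<bar>cl k (X n \<omega>) - cl k (Y \<omega>)\<bar> + \<bar>Y \<omega> - cl k (Y \<omega>)\<bar>) \<partial>M)"
        by (intro integral_mono integrable_abs Bochner_Integration.integrable_add
            Bochner_Integration.integrable_diff cl_int X Yi) auto
      also have "\<dots> = (\<integral>\<omega>. \<bar>X n \<omega> - cl k (X n \<omega>)\<bar> \<partial>M)
          + ((\<integral>\<omega>. \<bar>cl k (X n \<omega>) - cl k (Y \<omega>)\<bar> \<partial>M) + (\<integral>\<omega>. \<bar>Y \<omega> - cl k (Y \<omega>)\<bar> \<partial>M))"
        using X Yi cl_int by simp
      also have "\<dots> < a"
        using elim k cl_err_int[OF X, of n k] ui[of k n] cl_err_int[OF Yi, of k] by linarith
      finally show ?case .
    qed
  next
    fix a :: real assume "a < 0"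
    then show "\<forall>\<^sub>F n in sequentially. a < (\<integral>\<omega>. \<bar>X n \<omega> - Y \<omega>\<bar> \<partial>M)"
      by (intro always_eventually allI less_le_trans[OF _ integral_nonneg_AE]) auto
  qed
qed

context real_time_submartingale
begin

text \<open>Along rationals \<open>r n\<close> tending to \<open>t\<close> from the right the values
  converge to a variable \<open>Y\<close>, which is measurable at time \<open>t\<close> because the
  filtration is right-continuous. On every event of F t the integrals of X (r n) tend to that of
  \<open>Y\<close> by L1 convergence and to that of X t by continuity of the mean, so the two
  variables agree.\<close>

lemma AE_right_limit_eq:
  assumes t: "0 \<le> t" "t < T"
    and right_cont: "sets (F t) = (\<Inter>u\<in>{t<..}. sets (F u))"
    and mean: "((\<lambda>u. expectation (X u)) \<longlongrightarrow> expectation (X t)) (at_right t)"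
    and Z: "integrable P Z" "\<And>\<omega>. 0 \<le> Z \<omega>"
    and dom: "\<And>r A. t < r \<Longrightarrow> r \<le> T \<Longrightarrow> A \<in> sets (F r) \<Longrightarrow>
      (\<integral>\<omega>. indicator A \<omega> * \<bar>X r \<omega>\<bar> \<partial>P) \<le> (\<integral>\<omega>. indicator A \<omega> * Z \<omega> \<partial>P)"
    and bdd: "AE \<omega> in P. \<exists>K. \<forall>r\<in>\<rat> \<inter> {t<..T}. \<bar>X r \<omega>\<bar> \<le> K"
    and lim: "AE \<omega> in P. \<exists>l. ((\<lambda>r. X r \<omega>) \<longlongrightarrow> l) (at t within (\<rat> \<inter> {t<..}))"
  shows "AE \<omega> in P. ((\<lambda>r. X r \<omega>) \<longlongrightarrow> X t \<omega>) (at t within (\<rat> \<inter> {t<..}))"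
proof -
  have "\<exists>q\<in>\<rat>. t < q \<and> q < min T (t + 1 / Suc n)" for n
    using Rats_dense_in_real[of t "min T (t + 1 / Suc n)"] t by auto
  then obtain r where r: "\<And>n. r n \<in> \<rat>" "\<And>n. t < r n" "\<And>n. r n < min T (t + 1 / Suc n)" by metis
  have r0: "0 \<le> r n" for n using r(2)[of n] t by simp
  have r_lim: "r \<longlonglongrightarrow> t"
  proof (rule tendsto_sandwich[OF _ _ tendsto_const])
    show "(\<lambda>n. t + 1 / Suc n) \<longlonglongrightarrow> t"
      using tendsto_add[OF tendsto_const[of t] LIMSEQ_inverse_real_of_nat] by (simp add: inverse_eq_divide)
    show "\<forall>\<^sub>F n in sequentially. t \<le> r n" using less_imp_le[OF r(2)] by simp
    have "r n \<le> t + 1 / Suc n" for n using r(3)[of n] by simp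
    then show "\<forall>\<^sub>F n in sequentially. r n \<le> t + 1 / Suc n" by simp
  qed
  have r_filter: "filterlim r (at t within (\<rat> \<inter> {t<..})) sequentially"
    unfolding filterlim_at using r r_lim by (auto simp: less_imp_neq[symmetric] intro!: always_eventually)
  have r_right: "filterlim r (at_right t) sequentially"
    unfolding filterlim_at using r r_lim by (auto simp: less_imp_neq[symmetric] intro!: always_eventually)
  define Y where "Y \<omega> = lim (\<lambda>n. X (r n) \<omega>)" for \<omega>
  have Xr: "(\<lambda>n. X (r n) \<omega>) \<longlonglongrightarrow> l" if "((\<lambda>r. X r \<omega>) \<longlongrightarrow> l) (at t within (\<rat> \<inter> {t<..}))" for l \<omega>
    using filterlim_compose[OF that r_filter] by simp
  have Ylim: "AE \<omega> in P. (\<lambda>n. X (r n) \<omega>) \<longlonglongrightarrow> Y \<omega>"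
    using lim by eventually_elim (metis Xr Y_def limI)
  text \<open>\<open>Y\<close> depends only on a tail of the sequence, hence is measurable at every time after \<open>t\<close>.\<close>
  have YF: "Y \<in> borel_measurable (F u)" if u: "t < u" for u
  proof -
    have "\<forall>\<^sub>F n in sequentially. r n < u" using order_tendstoD(2)[OF r_lim u] .
    then obtain m where m: "\<And>n. m \<le> n \<Longrightarrow> r n < u" by (auto simp: eventually_sequentially)
    have "(\<lambda>n. X (r (n + m)) \<omega>) \<longlonglongrightarrow> l \<longleftrightarrow> (\<lambda>n. X (r n) \<omega>) \<longlonglongrightarrow> l" for l \<omega>
      using LIMSEQ_ignore_initial_segment LIMSEQ_offset[of "\<lambda>n. X (r n) \<omega>" m] by blast
    then have "Y = (\<lambda>\<omega>. lim (\<lambda>n. X (r (n + m)) \<omega>))" by (intro ext) (simp add: Y_def lim_def)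
    moreover have "X (r (n + m)) \<in> borel_measurable (F u)" for n
      using r0[of "n + m"] m[of "n + m"] u t
      by (intro measurable_later[OF _ _ _ adapted]) auto
    ultimately show ?thesis by (simp add: borel_measurable_lim_metric)
  qed
  have YFt: "Y \<in> borel_measurable (F t)"
  proof (rule measurableI)
    fix B :: "real set" assume B: "B \<in> sets borel"
    have "Y -` B \<inter> space (F t) \<in> sets (F u)" if "t < u" for u
      using measurable_sets[OF YF[OF that] B] space_F[of u] space_F[of t] that t by simp
    then show "Y -` B \<inter> space (F t) \<in> sets (F t)" unfolding right_cont by auto
  qed simp
  have YP[measurable]: "Y \<in> borel_measurable P" using measurable_P[OF _ YFt] t by simp
  have XP[measurable]: "X (r n) \<in> borel_measurable P" for n using r0 by (intro measurable_X) simp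
  have Xi: "integrable P (X (r n))" for n using r0 by (intro integrable) simp
  have Xti: "integrable P (X t)" using t by (intro integrable) simp
  have spF: "space P \<in> sets (F (r n))" for n
    using space_F[of "r n"] r0[of n] sets.top[of "F (r n)"] by simp
  \<comment> \<open>One event for all \<open>n\<close>, so that its integral \<open>e k\<close> is a
    common tail bound. It tends to 0 because almost every path is bounded along the rationals near
    \<open>t\<close>.\<close>
  define B where "B k = {\<omega> \<in> space P. \<exists>n. real k < \<bar>X (r n) \<omega>\<bar>}" for k
  have [measurable]: "B k \<in> sets P" for k unfolding B_def by measurable
  have BZ: "integrable P (\<lambda>\<omega>. indicator (B k) \<omega> * Z \<omega>)" for k
    by (intro integrable_mult_indicator_real Z) measurable
  define e where "e k = (\<integral>\<omega>. indicator (B k) \<omega> * Z \<omega> \<partial>P)" for k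
  have "e \<longlonglongrightarrow> (\<integral>\<omega>. 0 \<partial>P)"
    unfolding e_def
  proof (rule integral_dominated_convergence)
    show "AE \<omega> in P. (\<lambda>k. indicator (B k) \<omega> * Z \<omega>) \<longlonglongrightarrow> 0"
      using bdd
    proof eventually_elim
      case (elim \<omega>)
      then obtain K where K: "\<And>q. q \<in> \<rat> \<inter> {t<..T} \<Longrightarrow> \<bar>X q \<omega>\<bar> \<le> K" by blast
      obtain m :: nat where m: "K \<le> real m" using real_arch_simple by blast
      have "\<bar>X (r n) \<omega>\<bar> \<le> K" for n using r(1)[of n] r(2)[of n] r(3)[of n] by (intro K) auto
      then have le: "\<bar>X (r n) \<omega>\<bar> \<le> real m" for n using m order_trans by blast
      have "indicator (B k) \<omega> * Z \<omega> = 0" if "m \<le> k" for k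
      proof -
        have "\<bar>X (r n) \<omega>\<bar> \<le> real k" for n using le[of n] that by simp
        then show ?thesis by (simp add: B_def indicator_def not_less)
      qed
      then show ?case by (intro tendsto_eventually eventually_sequentiallyI[of m])
    qed
    show "integrable P Z" by fact
    show "AE \<omega> in P. norm (indicator (B k) \<omega> * Z \<omega>) \<le> Z \<omega>" for k
      using Z(2) by (auto simp: indicator_def)
  qed (use BZ Z in auto)
  then have e0: "e \<longlonglongrightarrow> 0" by simp
  have C: "(\<integral>\<omega>. \<bar>X (r n) \<omega>\<bar> \<partial>P) \<le> expectation Z" for n
  proof -
    have full: "(\<integral>\<omega>. indicator (space P) \<omega> * f \<omega> \<partial>P) = expectation f" for f :: "'a \<Rightarrow> real"
      by (intro Bochner_Integration.integral_cong) auto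
    show ?thesis using dom[OF r(2) _ spF] r(3)[of n] unfolding full by simp
  qed
  have ui: "(\<integral>\<omega>. indicator {\<omega> \<in> space P. real k < \<bar>X (r n) \<omega>\<bar>} \<omega> * \<bar>X (r n) \<omega>\<bar> \<partial>P) \<le> e k" for n k
  proof -
    have [measurable]: "X (r n) \<in> borel_measurable (F (r n))" using r0 by (intro adapted) simp
    have "{\<omega> \<in> space (F (r n)). real k < \<bar>X (r n) \<omega>\<bar>} \<in> sets (F (r n))" by measurable
    then have A: "{\<omega> \<in> space P. real k < \<bar>X (r n) \<omega>\<bar>} \<in> sets (F (r n))"
      using space_F[of "r n"] r0 by simp
    have "(\<integral>\<omega>. indicator {\<omega> \<in> space P. real k < \<bar>X (r n) \<omega>\<bar>} \<omega> * \<bar>X (r n) \<omega>\<bar> \<partial>P)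
        \<le> (\<integral>\<omega>. indicator {\<omega> \<in> space P. real k < \<bar>X (r n) \<omega>\<bar>} \<omega> * Z \<omega> \<partial>P)"
      using r(3)[of n] by (intro dom[OF r(2) _ A]) simp
    also have "\<dots> \<le> e k"
      unfolding e_def
      by (intro integral_mono BZ integrable_mult_indicator_real Z(1)) (auto simp: B_def indicator_def Z)
    finally show ?thesis .
  qed
  note L1 = L1_convergence_if_uniformly_integrable[OF Xi YP Ylim C ui e0]
  have "(\<integral>\<omega>. indicator A \<omega> * X t \<omega> \<partial>P) = (\<integral>\<omega>. indicator A \<omega> * Y \<omega> \<partial>P)" if A: "A \<in> sets (F t)" for A
  proof -
    have AP: "A \<in> sets P" "space P - A \<in> sets (F t)"
      using A sets_F[of t] space_F[of t] sets.compl_sets[OF A] t by auto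
    have iA: "integrable P (\<lambda>\<omega>. indicator A \<omega> * f \<omega>)" if "integrable P f" for f :: "'a \<Rightarrow> real"
      by (intro integrable_mult_indicator_real AP that)
    have "(\<lambda>n. (\<integral>\<omega>. indicator A \<omega> * X (r n) \<omega> \<partial>P) - (\<integral>\<omega>. indicator A \<omega> * Y \<omega> \<partial>P)) \<longlonglongrightarrow> 0"
    proof (rule Lim_null_comparison[OF _ L1(2)], intro always_eventually allI)
      fix n
      have "(\<integral>\<omega>. indicator A \<omega> * X (r n) \<omega> \<partial>P) - (\<integral>\<omega>. indicator A \<omega> * Y \<omega> \<partial>P)
         = (\<integral>\<omega>. indicator A \<omega> * (X (r n) \<omega> - Y \<omega>) \<partial>P)"
        using iA[OF Xi[of n]] iA[OF L1(1)] by (simp add: right_diff_distrib)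
      also have "norm \<dots> \<le> (\<integral>\<omega>. \<bar>X (r n) \<omega> - Y \<omega>\<bar> \<partial>P)"
        by (intro order_trans[OF integral_norm_bound] integral_mono integrable_norm iA integrable_abs
            Bochner_Integration.integrable_diff Xi L1(1)) (auto simp: indicator_def)
      finally show "norm ((\<integral>\<omega>. indicator A \<omega> * X (r n) \<omega> \<partial>P) - (\<integral>\<omega>. indicator A \<omega> * Y \<omega> \<partial>P))
         \<le> (\<integral>\<omega>. \<bar>X (r n) \<omega> - Y \<omega>\<bar> \<partial>P)" .
    qed
    then have "(\<lambda>n. \<integral>\<omega>. indicator A \<omega> * X (r n) \<omega> \<partial>P) \<longlonglongrightarrow> (\<integral>\<omega>. indicator A \<omega> * Y \<omega> \<partial>P)"
      by (rule LIM_zero_cancel)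
    moreover have "(\<lambda>n. \<integral>\<omega>. indicator A \<omega> * X (r n) \<omega> \<partial>P) \<longlonglongrightarrow> (\<integral>\<omega>. indicator A \<omega> * X t \<omega> \<partial>P)"
    \<comment> \<open>The submartingale inequality on \<open>A\<close> gives the lower bound. On the
      complement of \<open>A\<close> it gives the upper one: the excess over \<open>A\<close> is at
      most the excess of the total mean, which vanishes in the limit.\<close>
    proof (rule tendsto_sandwich)
      show "\<forall>\<^sub>F n in sequentially. (\<integral>\<omega>. indicator A \<omega> * X t \<omega> \<partial>P) \<le> (\<integral>\<omega>. indicator A \<omega> * X (r n) \<omega> \<partial>P)"
        using r(2) r0 t A by (intro always_eventually allI submartingale) (auto intro: less_imp_le)
      show "\<forall>\<^sub>F n in sequentially. (\<integral>\<omega>. indicator A \<omega> * X (r n) \<omega> \<partial>P)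
         \<le> (\<integral>\<omega>. indicator A \<omega> * X t \<omega> \<partial>P) + (expectation (X (r n)) - expectation (X t))"
      proof (intro always_eventually allI)
        fix n
        have split: "expectation f = (\<integral>\<omega>. indicator A \<omega> * f \<omega> \<partial>P) + (\<integral>\<omega>. indicator (space P - A) \<omega> * f \<omega> \<partial>P)"
          if f: "integrable P f" for f :: "'a \<Rightarrow> real"
        proof -
          have "expectation f = (\<integral>\<omega>. indicator A \<omega> * f \<omega> + indicator (space P - A) \<omega> * f \<omega> \<partial>P)"
            by (intro Bochner_Integration.integral_cong) (auto simp: indicator_def)
          also have "\<dots> = (\<integral>\<omega>. indicator A \<omega> * f \<omega> \<partial>P) + (\<integral>\<omega>. indicator (space P - A) \<omega> * f \<omega> \<partial>P)"
            by (intro Bochner_Integration.integral_add iA f integrable_mult_indicator_real) (use AP in auto)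
          finally show ?thesis .
        qed
        have "(\<integral>\<omega>. indicator (space P - A) \<omega> * X t \<omega> \<partial>P) \<le> (\<integral>\<omega>. indicator (space P - A) \<omega> * X (r n) \<omega> \<partial>P)"
          using r(2)[of n] r0[of n] t by (intro submartingale AP) auto
        then show "(\<integral>\<omega>. indicator A \<omega> * X (r n) \<omega> \<partial>P)
         \<le> (\<integral>\<omega>. indicator A \<omega> * X t \<omega> \<partial>P) + (expectation (X (r n)) - expectation (X t))"
          using split[OF Xi[of n]] split[OF Xti] by simp
      qed
      have "(\<lambda>n. expectation (X (r n))) \<longlonglongrightarrow> expectation (X t)"
        using filterlim_compose[OF mean r_right] .
      from tendsto_add[OF tendsto_const[of "\<integral>\<omega>. indicator A \<omega> * X t \<omega> \<partial>P"] tendsto_diff[OF this tendsto_const[of "expectation (X t)"]]]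
      show "(\<lambda>n. (\<integral>\<omega>. indicator A \<omega> * X t \<omega> \<partial>P) + (expectation (X (r n)) - expectation (X t)))
        \<longlonglongrightarrow> (\<integral>\<omega>. indicator A \<omega> * X t \<omega> \<partial>P)" by simp
    qed simp
    ultimately show ?thesis by (rule LIMSEQ_unique[THEN sym])
  qed
  then have "AE \<omega> in P. X t \<omega> = Y \<omega>"
    using t by (intro AE_eq_if_integrals_eq[OF subalg[of t]] adapted YFt Xti L1(1)) auto
  with lim Ylim show ?thesis
  proof eventually_elim
    case (elim \<omega>)
    then obtain l where l: "((\<lambda>r. X r \<omega>) \<longlongrightarrow> l) (at t within (\<rat> \<inter> {t<..}))" by auto
    then have "l = X t \<omega>" using LIMSEQ_unique[OF Xr[OF l]] elim by simp
    then show ?case using l by simp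
  qed
qed

end

section \<open>Support values of random sets\<close>

lemma sets_hit:
  "set_valued_rv G X \<Longrightarrow> closed C \<Longrightarrow> {\<omega> \<in> space G. \<exists>x\<in>X \<omega>. x \<in> C} \<in> sets G"
proof -
  assume "set_valued_rv G X" "closed C"
  then have "{\<omega> \<in> space G. X \<omega> \<inter> C \<noteq> {}} \<in> sets G" by (auto simp: set_valued_rv_def)
  moreover have "{\<omega> \<in> space G. X \<omega> \<inter> C \<noteq> {}} = {\<omega> \<in> space G. \<exists>x\<in>X \<omega>. x \<in> C}" by auto
  ultimately show ?thesis by simp
qed

text \<open>Measurability of a random set is given for closed test sets only, so the open condition
  is written as a countable union of closed ones.\<close>

lemma sets_exceeds:
  fixes f :: "'b::topological_space \<Rightarrow> real"
  assumes X: "set_valued_rv G X" and f: "continuous_on UNIV f"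
  shows "{\<omega> \<in> space G. \<exists>x\<in>X \<omega>. c < f x} \<in> sets G"
proof -
  have "closed {x. c + 1 / Suc n \<le> f x}" for n
    using f by (intro closed_Collect_le continuous_on_const)
  then have "(\<Union>n. {\<omega> \<in> space G. \<exists>x\<in>X \<omega>. x \<in> {x. c + 1 / Suc n \<le> f x}}) \<in> sets G"
    by (intro sets.countable_UN image_subsetI sets_hit X)
  moreover have "(\<exists>n. c + 1 / Suc n \<le> y) \<longleftrightarrow> c < y" for y :: real
  proof
    assume "c < y"
    then obtain n where "inverse (real (Suc n)) < y - c" using reals_Archimedean[of "y - c"] by auto
    then show "\<exists>n. c + 1 / Suc n \<le> y" by (intro exI[of _ n]) (simp add: inverse_eq_divide)
  next
    assume "\<exists>n. c + 1 / Suc n \<le> y"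
    then obtain n where "c + 1 / Suc n \<le> y" ..
    moreover have "0 < 1 / real (Suc n)" by simp
    ultimately show "c < y" by linarith
  qed
  then have "(\<Union>n. {\<omega> \<in> space G. \<exists>x\<in>X \<omega>. x \<in> {x. c + 1 / Suc n \<le> f x}}) = {\<omega> \<in> space G. \<exists>x\<in>X \<omega>. c < f x}"
    by blast
  ultimately show ?thesis by simp
qed

lemma measurable_support_function:
  fixes X :: "'a \<Rightarrow> 'b::real_inner set"
  assumes X: "set_valued_rv G X"
  shows "(\<lambda>\<omega>. support_function u (X \<omega>)) \<in> borel_measurable G"
proof (rule borel_measurableI_greater)
  fix y :: ereal
  have eq: "y < support_function u C \<longleftrightarrow> (\<exists>x\<in>C. y < ereal (u \<bullet> x))" for C :: "'b set"
    by (simp add: support_function_def less_SUP_iff)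
  show "{\<omega> \<in> space G. y < support_function u (X \<omega>)} \<in> sets G"
  proof (cases y)
    case (real c)
    show ?thesis unfolding eq
      using sets_exceeds[OF X, of "\<lambda>x. u \<bullet> x" c] by (simp add: real continuous_intros)
  next
    case PInf
    then show ?thesis unfolding eq by simp
  next
    case MInf
    have "{\<omega> \<in> space G. y < support_function u (X \<omega>)} = space G"
      unfolding eq using X MInf by (auto simp: set_valued_rv_def)
    then show ?thesis by simp
  qed
qed

lemma measurable_support_value:
  fixes X :: "'a \<Rightarrow> 'b::real_inner set"
  assumes X: "set_valued_rv G X"
  shows "(\<lambda>\<omega>. support_value u (X \<omega>)) \<in> borel_measurable G"
  unfolding support_value_def using measurable_support_function[OF X] by measurable

lemma measurable_norm_of_set:
  fixes X :: "'a \<Rightarrow> 'b::real_normed_vector set"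
  assumes X: "set_valued_rv G X"
  shows "(\<lambda>\<omega>. norm_of_set (X \<omega>)) \<in> borel_measurable G"
proof (rule borel_measurableI_greater)
  fix y :: ennreal
  have eq: "y < norm_of_set C \<longleftrightarrow> (\<exists>x\<in>C. y < ennreal (norm x))" for C :: "'b set"
    by (simp add: norm_of_set_def less_SUP_iff)
  show "{\<omega> \<in> space G. y < norm_of_set (X \<omega>)} \<in> sets G"
  proof (cases y)
    case (real c)
    then have "y < ennreal (norm x) \<longleftrightarrow> c < norm x" for x :: 'b by (simp add: ennreal_less_iff)
    then show ?thesis unfolding eq
      using sets_exceeds[OF X, of norm c] by (simp add: continuous_on_norm_id)
  next
    case top
    then show ?thesis unfolding eq by simp
  qed
qed

text \<open>The nearest point of \<open>X \<omega>\<close> lies in \<open>C\<close> iff every ball of rational radius about \<open>q\<close> that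
  meets \<open>X \<omega>\<close> also meets \<open>X \<omega> \<inter> C\<close>.\<close>

lemma measurable_closest_point:
  fixes X :: "'a \<Rightarrow> 'b::euclidean_space set"
  assumes X: "set_valued_rv G X" and cv: "\<And>\<omega>. \<omega> \<in> space G \<Longrightarrow> convex (X \<omega>)"
  shows "(\<lambda>\<omega>. closest_point (X \<omega>) q) \<in> borel_measurable G"
proof (rule borel_measurableI)
  fix S :: "'b set" assume "open S"
  define C where "C = - S"
  have C: "closed C" using \<open>open S\<close> by (simp add: C_def closed_def)
  have iff: "closest_point (X \<omega>) q \<in> C \<longleftrightarrow>
    (\<forall>r\<in>\<rat>. (\<exists>x\<in>X \<omega>. x \<in> cball q r) \<longrightarrow> (\<exists>x\<in>X \<omega>. x \<in> C \<inter> cball q r))" (is "_ \<longleftrightarrow> ?R")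
    if w: "\<omega> \<in> space G" for \<omega>
  proof
    have X': "closed (X \<omega>)" "X \<omega> \<noteq> {}" using X w by (auto simp: set_valued_rv_def)
    define p where "p = closest_point (X \<omega>) q"
    have p: "p \<in> X \<omega>" "\<And>x. x \<in> X \<omega> \<Longrightarrow> dist q p \<le> dist q x"
      unfolding p_def using closest_point_exists[OF X'] by auto
    {
      assume "closest_point (X \<omega>) q \<in> C"
      then have "p \<in> C" by (simp add: p_def)
      then show ?R using p by (meson IntI mem_cball order_trans)
    next
      assume R: ?R
      have meets: "\<exists>x\<in>X \<omega> \<inter> C. dist q x \<le> r" if "r \<in> \<rat>" "dist q p \<le> r" for r
        using R that p(1) by (meson IntE IntI mem_cball)
      obtain r0 where "r0 \<in> \<rat>" "dist q p < r0"
        using Rats_dense_in_real[of "dist q p" "dist q p + 1"] by auto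
      then have ne: "X \<omega> \<inter> C \<noteq> {}" using meets[of r0] by auto
      obtain z where z: "z \<in> X \<omega> \<inter> C" "\<And>x. x \<in> X \<omega> \<inter> C \<Longrightarrow> dist q z \<le> dist q x"
        using distance_attains_inf[OF closed_Int[OF X'(1) C] ne] by metis
      \<comment> \<open>Otherwise a rational radius strictly between the two distances gives a ball
        that meets \<open>X \<omega>\<close> but not \<open>X \<omega> \<inter> C\<close>. Once
        \<open>z\<close> is as near as \<open>p\<close>, convexity makes them equal.\<close>
      have "dist q z \<le> dist q p"
      proof (rule ccontr)
        assume "\<not> dist q z \<le> dist q p"
        then obtain r where r: "r \<in> \<rat>" "dist q p < r" "r < dist q z"
          using Rats_dense_in_real[of "dist q p" "dist q z"] by auto
        then obtain x where "x \<in> X \<omega> \<inter> C" "dist q x \<le> r" using meets[of r] by auto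
        then show False using z(2)[of x] r by simp
      qed
      then have "\<forall>x\<in>X \<omega>. dist q z \<le> dist q x" using p(2) order_trans by blast
      then have "z = p"
        unfolding p_def using z(1) by (intro closest_point_unique cv w X') auto
      then show "closest_point (X \<omega>) q \<in> C" using z by (simp add: p_def)
    }
  qed
  have "{\<omega> \<in> space G. \<forall>r\<in>\<rat>. (\<exists>x\<in>X \<omega>. x \<in> cball q r) \<longrightarrow> (\<exists>x\<in>X \<omega>. x \<in> C \<inter> cball q r)} \<in> sets G"
    by (intro sets.sets_Collect_countable_All' sets.sets_Collect_imp sets_hit X C closed_Int closed_cball countable_rat)
  moreover have "{\<omega> \<in> space G. \<forall>r\<in>\<rat>. (\<exists>x\<in>X \<omega>. x \<in> cball q r) \<longrightarrow> (\<exists>x\<in>X \<omega>. x \<in> C \<inter> cball q r)}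
     = {\<omega> \<in> space G. closest_point (X \<omega>) q \<in> C}"
    using iff by blast
  ultimately have "{\<omega> \<in> space G. closest_point (X \<omega>) q \<in> C} \<in> sets G" by simp
  then have "space G - {\<omega> \<in> space G. closest_point (X \<omega>) q \<in> C} \<in> sets G" by auto
  moreover have "space G - {\<omega> \<in> space G. closest_point (X \<omega>) q \<in> C} = (\<lambda>\<omega>. closest_point (X \<omega>) q) -` S \<inter> space G"
    by (auto simp: C_def)
  ultimately show "(\<lambda>\<omega>. closest_point (X \<omega>) q) -` S \<inter> space G \<in> sets G" by simp
qed

text \<open>If \<open>p\<close> is the point of \<open>C\<close> nearest to \<open>k u\<close>, then expanding
  \<open>|k u - p|\<^sup>2 \<le> |k u - x|\<^sup>2\<close> gives \<open>u \<bullet> x \<le> u \<bullet> p + R\<^sup>2 / (2 k)\<close>.\<close>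

lemma closest_point_support_value:
  fixes C :: "'b::euclidean_space set"
  assumes C: "closed C" "C \<noteq> {}" "\<And>x. x \<in> C \<Longrightarrow> norm x \<le> R"
  shows "(\<lambda>k. u \<bullet> closest_point C (real (Suc k) *\<^sub>R u)) \<longlonglongrightarrow> support_value u C"
proof -
  have bd: "bounded C" using C(3) by (auto simp: bounded_iff)
  define p where "p k = closest_point C (real (Suc k) *\<^sub>R u)" for k
  have p: "p k \<in> C" for k unfolding p_def by (rule closest_point_in_set[OF C(1,2)])
  show ?thesis unfolding p_def[symmetric]
  proof (rule tendsto_sandwich)
    show "\<forall>\<^sub>F k in sequentially. u \<bullet> p k \<le> support_value u C"
      using support_value_upper[OF bd p] by simp
    have "support_value u C \<le> u \<bullet> p k + R\<^sup>2 / (2 * real (Suc k))" for k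
    proof (intro support_value_least bd C(2))
      fix x assume x: "x \<in> C"
      let ?k = "real (Suc k)"
      have "dist (?k *\<^sub>R u) (p k) \<le> dist (?k *\<^sub>R u) x"
        unfolding p_def by (rule closest_point_le[OF C(1) x])
      then have "(norm (?k *\<^sub>R u - p k))\<^sup>2 \<le> (norm (?k *\<^sub>R u - x))\<^sup>2"
        by (simp add: dist_norm)
      then have "2 * ?k * (u \<bullet> x) \<le> 2 * ?k * (u \<bullet> p k) + (norm x)\<^sup>2 - (norm (p k))\<^sup>2"
        by (simp add: power2_norm_eq_inner inner_diff_left inner_diff_right inner_commute algebra_simps del: of_nat_Suc)
      moreover have "(norm x)\<^sup>2 \<le> R\<^sup>2" using C(3)[OF x] by (intro power_mono) auto
      ultimately have "2 * ?k * (u \<bullet> x) \<le> 2 * ?k * (u \<bullet> p k) + R\<^sup>2"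
        using zero_le_power2[of "norm (p k)"] by linarith
      also have "\<dots> = 2 * ?k * (u \<bullet> p k + R\<^sup>2 / (2 * ?k))" by (simp add: field_simps del: of_nat_Suc)
      finally have "?k * (u \<bullet> x) \<le> ?k * (u \<bullet> p k + R\<^sup>2 / (2 * ?k))" by linarith
      then show "u \<bullet> x \<le> u \<bullet> p k + R\<^sup>2 / (2 * ?k)" by (simp only: mult_le_cancel_left_pos of_nat_0_less_iff zero_less_Suc)
    qed
    then have "support_value u C - R\<^sup>2 / (2 * real (Suc k)) \<le> u \<bullet> p k" for k
      using diff_le_eq by blast
    moreover have "R\<^sup>2 / 2 * inverse (real (Suc k)) = R\<^sup>2 / (2 * real (Suc k))" for k
      by (simp add: field_simps del: of_nat_Suc)
    ultimately show "\<forall>\<^sub>F k in sequentially. support_value u C - R\<^sup>2 / 2 * inverse (real (Suc k)) \<le> u \<bullet> p k"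
      by (simp only: eventually_sequentially) blast
    show "(\<lambda>k. support_value u C - R\<^sup>2 / 2 * inverse (real (Suc k))) \<longlonglongrightarrow> support_value u C"
      using tendsto_diff[OF tendsto_const[of "support_value u C"] tendsto_mult[OF tendsto_const[of "R\<^sup>2/2"] LIMSEQ_inverse_real_of_nat]]
      by simp
  qed simp
qed

locale convex_bounded_rv = prob_space P for P :: "'a measure" +
  fixes G :: "'a measure" and X :: "'a \<Rightarrow> 'b::euclidean_space set"
  assumes subalg: "subalgebra P G" and rv: "set_valued_rv G X"
    and convex: "\<And>\<omega>. \<omega> \<in> space P \<Longrightarrow> convex (X \<omega>)"
    and integrably_bounded: "set_rv_integrably_bounded P X"
begin

text \<open>Where the norm is infinite \<open>enn2real\<close> gives 0, so this bounds the set only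
  almost surely.\<close>

definition radius :: "'a \<Rightarrow> real" where "radius \<omega> = enn2real (norm_of_set (X \<omega>))"

lemma space_G: "space G = space P" and sets_G: "sets G \<subseteq> sets P"
  using subalg by (auto simp: subalgebra_def)

lemma measurable_G: "f \<in> measurable G N \<Longrightarrow> f \<in> measurable P N"
  using subalg measurable_from_subalg by blast

lemma closed: "\<omega> \<in> space P \<Longrightarrow> closed (X \<omega>)" and nonempty: "\<omega> \<in> space P \<Longrightarrow> X \<omega> \<noteq> {}"
  using rv space_G by (auto simp: set_valued_rv_def)

lemma measurable_norm [measurable]: "(\<lambda>\<omega>. norm_of_set (X \<omega>)) \<in> borel_measurable P"
  by (intro measurable_G measurable_norm_of_set rv)

lemma measurable_value [measurable]: "(\<lambda>\<omega>. support_value u (X \<omega>)) \<in> borel_measurable P"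
  by (intro measurable_G measurable_support_value rv)

lemma AE_norm_le_radius: "AE \<omega> in P. \<forall>x\<in>X \<omega>. norm x \<le> radius \<omega>"
proof -
  have "AE \<omega> in P. norm_of_set (X \<omega>) \<noteq> \<infinity>"
    using integrably_bounded by (intro nn_integral_PInf_AE) (auto simp: set_rv_integrably_bounded_def)
  then show ?thesis
  proof eventually_elim
    case (elim \<omega>)
    have "ennreal (norm x) \<le> norm_of_set (X \<omega>)" if "x \<in> X \<omega>" for x
      unfolding norm_of_set_def using that by (rule SUP_upper)
    moreover have "norm_of_set (X \<omega>) = ennreal (radius \<omega>)"
      unfolding radius_def using elim by (simp add: less_top)
    ultimately have "ennreal (norm x) \<le> ennreal (radius \<omega>)" if "x \<in> X \<omega>" for x using that by metis
    moreover have "0 \<le> radius \<omega>" by (simp add: radius_def)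
    ultimately show ?case by (simp only: ennreal_le_iff) blast
  qed
qed

lemma integrable_radius: "integrable P radius"
proof (rule integrableI_bounded)
  show "radius \<in> borel_measurable P" unfolding radius_def by measurable
  have "(\<integral>\<^sup>+ \<omega>. ennreal (norm (radius \<omega>)) \<partial>P) \<le> (\<integral>\<^sup>+ \<omega>. norm_of_set (X \<omega>) \<partial>P)"
  proof (intro nn_integral_mono)
    fix \<omega>
    show "ennreal (norm (radius \<omega>)) \<le> norm_of_set (X \<omega>)"
      by (cases "norm_of_set (X \<omega>)") (auto simp: radius_def)
  qed
  then show "(\<integral>\<^sup>+ \<omega>. ennreal (norm (radius \<omega>)) \<partial>P) < \<infinity>"
    using integrably_bounded by (auto simp: set_rv_integrably_bounded_def)
qed

lemma integrable_value: "integrable P (\<lambda>\<omega>. support_value u (X \<omega>))"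
proof (rule Bochner_Integration.integrable_bound)
  show "integrable P (\<lambda>\<omega>. norm u * radius \<omega>)" using integrable_radius by simp
  show "AE \<omega> in P. norm (support_value u (X \<omega>)) \<le> norm (norm u * radius \<omega>)"
    using AE_norm_le_radius AE_space
  proof eventually_elim
    case (elim \<omega>)
    have "\<bar>support_value u (X \<omega>)\<bar> \<le> norm u * radius \<omega>"
      using elim nonempty by (intro abs_support_value_le) auto
    then show ?case by simp
  qed
qed measurable

text \<open>An explicit selection, defined everywhere and measurable for the small sigma-algebra
  \<open>G\<close>, so no abstract selection theorem enters. \<open>Suc k\<close> leaves out the
  point nearest to 0, which does not depend on \<open>u\<close>.\<close>

definition selection :: "'b \<Rightarrow> nat \<Rightarrow> 'a \<Rightarrow> 'b" where
  "selection u k \<omega> = closest_point (X \<omega>) (real (Suc k) *\<^sub>R u)"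

lemma selection_in: "\<omega> \<in> space P \<Longrightarrow> selection u k \<omega> \<in> X \<omega>"
  unfolding selection_def by (intro closest_point_in_set closed nonempty)

lemma measurable_selection: "selection u k \<in> borel_measurable G"
  unfolding selection_def by (intro measurable_closest_point rv convex) (simp add: space_G)

lemma AE_selection_le: "AE \<omega> in P. norm (selection u k \<omega>) \<le> radius \<omega>"
  using AE_norm_le_radius AE_space by eventually_elim (auto intro: selection_in)

lemma integrable_selection: "integrable P (selection u k)"
proof (rule Bochner_Integration.integrable_bound[OF integrable_radius])
  show "selection u k \<in> borel_measurable P" by (rule measurable_G[OF measurable_selection])
  show "AE \<omega> in P. norm (selection u k \<omega>) \<le> norm (radius \<omega>)"
    using AE_selection_le[of u k] by eventually_elim simp
qed

lemma selection_integrable_selections: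
  "selection u k \<in> integrable_selections P G X" "selection u k \<in> integrable_selections P P X"
  using measurable_selection measurable_G[OF measurable_selection] integrable_selection selection_in
  by (auto simp: integrable_selections_def)

text \<open>The speed of the pointwise convergence depends on the outcome, but all the inner
  products are dominated by |u| times the integrable radius.\<close>

lemma selection_integral_tendsto:
  assumes A: "A \<in> sets P"
  shows "(\<lambda>k. \<integral>\<omega>. indicator A \<omega> * (u \<bullet> selection u k \<omega>) \<partial>P)
    \<longlonglongrightarrow> (\<integral>\<omega>. indicator A \<omega> * support_value u (X \<omega>) \<partial>P)"
proof (rule integral_dominated_convergence)
  have [measurable]: "selection u k \<in> borel_measurable P" for k
    by (rule measurable_G[OF measurable_selection])
  note [measurable] = A
  show "(\<lambda>\<omega>. indicator A \<omega> * (u \<bullet> selection u k \<omega>)) \<in> borel_measurable P" for k by measurable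
  show "(\<lambda>\<omega>. indicator A \<omega> * support_value u (X \<omega>)) \<in> borel_measurable P" by measurable
  show "integrable P (\<lambda>\<omega>. norm u * radius \<omega>)" using integrable_radius by simp
  show "AE \<omega> in P. (\<lambda>k. indicator A \<omega> * (u \<bullet> selection u k \<omega>)) \<longlonglongrightarrow> indicator A \<omega> * support_value u (X \<omega>)"
    using AE_norm_le_radius AE_space
  proof eventually_elim
    case (elim \<omega>)
    have "(\<lambda>k. u \<bullet> closest_point (X \<omega>) (real (Suc k) *\<^sub>R u)) \<longlonglongrightarrow> support_value u (X \<omega>)"
      by (rule closest_point_support_value[where R = "radius \<omega>"]) (use elim closed nonempty in auto)
    then show ?case unfolding selection_def by (intro tendsto_mult tendsto_const)
  qed
  show "AE \<omega> in P. norm (indicator A \<omega> * (u \<bullet> selection u k \<omega>)) \<le> norm u * radius \<omega>" for k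
    using AE_selection_le[of u k]
  proof eventually_elim
    case (elim \<omega>)
    have "\<bar>u \<bullet> selection u k \<omega>\<bar> \<le> norm u * norm (selection u k \<omega>)" by (rule Cauchy_Schwarz_ineq2)
    also have "\<dots> \<le> norm u * radius \<omega>" using elim by (intro mult_left_mono) auto
    finally have "\<bar>u \<bullet> selection u k \<omega>\<bar> \<le> norm u * radius \<omega>" .
    moreover have "0 \<le> norm u * radius \<omega>" by (simp add: radius_def)
    ultimately show ?case by (auto simp: indicator_def)
  qed
qed

lemma AE_inner_le_value:
  assumes "\<xi> \<in> integrable_selections P P X"
  shows "AE \<omega> in P. u \<bullet> \<xi> \<omega> \<le> support_value u (X \<omega>)"
proof -
  have "AE \<omega> in P. \<xi> \<omega> \<in> X \<omega>" using assms by (simp add: integrable_selections_def)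
  with AE_norm_le_radius show ?thesis
    by eventually_elim (auto intro!: support_value_upper boundedI)
qed

text \<open>Supremum and integral may be exchanged: a closed halfspace holds all expectations of
  selections and hence their closure, and the nearest-point selections come arbitrarily close to its
  boundary. This turns the assumption on the sets E[M_t] into right continuity of the mean of a real
  submartingale.\<close>

lemma support_function_expectation:
  "support_function u (set_expectation P X) = ereal (expectation (\<lambda>\<omega>. support_value u (X \<omega>)))"
proof (rule antisym)
  let ?S = "integral\<^sup>L P ` integrable_selections P P X"
  have "?S \<subseteq> {x. u \<bullet> x \<le> expectation (\<lambda>\<omega>. support_value u (X \<omega>))}"
  proof safe
    fix \<xi> assume xi: "\<xi> \<in> integrable_selections P P X"
    then have int: "integrable P \<xi>" by (simp add: integrable_selections_def)
    have "u \<bullet> integral\<^sup>L P \<xi> = (\<integral>\<omega>. u \<bullet> \<xi> \<omega> \<partial>P)" using int by simp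
    also have "\<dots> \<le> expectation (\<lambda>\<omega>. support_value u (X \<omega>))"
      by (intro integral_mono_AE integrable_value AE_inner_le_value[OF xi]) (use int in simp)
    finally show "u \<bullet> integral\<^sup>L P \<xi> \<le> expectation (\<lambda>\<omega>. support_value u (X \<omega>))" .
  qed
  then have "closure ?S \<subseteq> {x. u \<bullet> x \<le> expectation (\<lambda>\<omega>. support_value u (X \<omega>))}"
    by (intro closure_minimal closed_halfspace_le)
  then show "support_function u (set_expectation P X) \<le> ereal (expectation (\<lambda>\<omega>. support_value u (X \<omega>)))"
    unfolding support_function_def set_expectation_def by (intro SUP_least) auto
  have full: "(\<integral>\<omega>. indicator (space P) \<omega> * f \<omega> \<partial>P) = expectation f" for f :: "'a \<Rightarrow> real"
    by (intro Bochner_Integration.integral_cong) auto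
  have "(\<lambda>k. expectation (\<lambda>\<omega>. u \<bullet> selection u k \<omega>)) \<longlonglongrightarrow> expectation (\<lambda>\<omega>. support_value u (X \<omega>))"
    using selection_integral_tendsto[of "space P" u] unfolding full by simp
  then have "(\<lambda>k. ereal (expectation (\<lambda>\<omega>. u \<bullet> selection u k \<omega>))) \<longlonglongrightarrow> ereal (expectation (\<lambda>\<omega>. support_value u (X \<omega>)))"
    by simp
  then show "ereal (expectation (\<lambda>\<omega>. support_value u (X \<omega>))) \<le> support_function u (set_expectation P X)"
  proof (rule tendsto_upperbound)
    have "ereal (expectation (\<lambda>\<omega>. u \<bullet> selection u k \<omega>)) \<le> support_function u (set_expectation P X)" for k
    proof -
      have "integral\<^sup>L P (selection u k) \<in> set_expectation P X"
        unfolding set_expectation_def using selection_integrable_selections(2) closure_subset by blast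
      then have "ereal (u \<bullet> integral\<^sup>L P (selection u k)) \<le> support_function u (set_expectation P X)"
        unfolding support_function_def by (rule SUP_upper)
      moreover have "expectation (\<lambda>\<omega>. u \<bullet> selection u k \<omega>) = u \<bullet> integral\<^sup>L P (selection u k)"
        using integrable_selection by simp
      ultimately show ?thesis by simp
    qed
    then show "\<forall>\<^sub>F k in sequentially. ereal (expectation (\<lambda>\<omega>. u \<bullet> selection u k \<omega>)) \<le> support_function u (set_expectation P X)"
      by simp
  qed simp
qed

end

section \<open>Selections of a conditional expectation\<close>

lemma (in prob_space) integral_inner_vector_cond_exp:
  assumes G: "subalgebra M G" and \<xi>: "integrable M \<xi>" and A: "A \<in> sets G"
  shows "integrable M (vector_cond_exp M G \<xi>)"
    and "(\<integral>\<omega>. indicator A \<omega> * (u \<bullet> vector_cond_exp M G \<xi> \<omega>) \<partial>M) = (\<integral>\<omega>. indicator A \<omega> * (u \<bullet> \<xi> \<omega>) \<partial>M)"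
proof -
  interpret finite_measure_subalgebra M G by unfold_locales (rule G)
  have AM: "A \<in> sets M" using A G by (auto simp: subalgebra_def)
  have int: "integrable M (real_cond_exp M G (\<lambda>\<omega>. \<xi> \<omega> \<bullet> b))" for b
    using \<xi> by (intro real_cond_exp_int) simp
  show "integrable M (vector_cond_exp M G \<xi>)"
    unfolding vector_cond_exp_def by (intro Bochner_Integration.integrable_sum integrable_scaleR_left int)
  have iA: "integrable M (\<lambda>\<omega>. indicator A \<omega> * f \<omega>)" if "integrable M f" for f :: "'a \<Rightarrow> real"
    using integrable_mult_indicator[OF AM that] by simp
  have "(\<integral>\<omega>. indicator A \<omega> * (u \<bullet> vector_cond_exp M G \<xi> \<omega>) \<partial>M)
      = (\<integral>\<omega>. (\<Sum>b\<in>Basis. (u \<bullet> b) * (indicator A \<omega> * real_cond_exp M G (\<lambda>\<omega>. \<xi> \<omega> \<bullet> b) \<omega>)) \<partial>M)"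
    by (intro Bochner_Integration.integral_cong)
       (auto simp: vector_cond_exp_def inner_sum_right sum_distrib_left algebra_simps)
  also have "\<dots> = (\<Sum>b\<in>Basis. (u \<bullet> b) * (\<integral>\<omega>. indicator A \<omega> * real_cond_exp M G (\<lambda>\<omega>. \<xi> \<omega> \<bullet> b) \<omega> \<partial>M))"
    using iA[OF int] by simp
  also have "\<dots> = (\<Sum>b\<in>Basis. (u \<bullet> b) * (\<integral>\<omega>. indicator A \<omega> * (\<xi> \<omega> \<bullet> b) \<partial>M))"
  proof (intro sum.cong refl arg_cong2[where f = "(*)"])
    fix b
    have "integrable M (\<lambda>\<omega>. \<xi> \<omega> \<bullet> b)" using \<xi> by simp
    from real_cond_exp_intA[OF this A]
    show "(\<integral>\<omega>. indicator A \<omega> * real_cond_exp M G (\<lambda>\<omega>. \<xi> \<omega> \<bullet> b) \<omega> \<partial>M) = (\<integral>\<omega>. indicator A \<omega> * (\<xi> \<omega> \<bullet> b) \<partial>M)"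
      by (simp add: set_lebesgue_integral_def)
  qed
  also have "\<dots> = (\<integral>\<omega>. (\<Sum>b\<in>Basis. (u \<bullet> b) * (indicator A \<omega> * (\<xi> \<omega> \<bullet> b))) \<partial>M)"
    using iA \<xi> by simp
  also have "\<dots> = (\<integral>\<omega>. indicator A \<omega> * (u \<bullet> \<xi> \<omega>) \<partial>M)"
    by (intro Bochner_Integration.integral_cong refl, subst euclidean_inner[of u])
       (simp add: sum_distrib_left algebra_simps)
  finally show "(\<integral>\<omega>. indicator A \<omega> * (u \<bullet> vector_cond_exp M G \<xi> \<omega>) \<partial>M) = (\<integral>\<omega>. indicator A \<omega> * (u \<bullet> \<xi> \<omega>) \<partial>M)" .
qed

text \<open>A selection of \<open>Y\<close> is only an L1 limit of conditional expectations of
  selections of \<open>X\<close>. For one such approximation the conditioning disappears under the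
  integral over \<open>A\<close>, and the pointwise bound by the support value applies; the
  approximation error is at most |u| d.\<close>

lemma (in convex_bounded_rv) selection_cond_exp_le:
  assumes H: "subalgebra P H" and Y: "has_set_cond_exp P H X Y"
    and \<xi>: "\<xi> \<in> integrable_selections P H Y" and A: "A \<in> sets H"
  shows "(\<integral>\<omega>. indicator A \<omega> * (u \<bullet> \<xi> \<omega>) \<partial>P) \<le> (\<integral>\<omega>. indicator A \<omega> * support_value u (X \<omega>) \<partial>P)"
proof (rule field_le_epsilon)
  fix e :: real assume e: "0 < e"
  define d where "d = e / (norm u + 1)"
  have d: "0 < d" "norm u * d \<le> e"
    using e by (auto simp: d_def divide_simps add_pos_nonneg algebra_simps)
  have AP: "A \<in> sets P" using A H by (auto simp: subalgebra_def)
  have iA: "integrable P (\<lambda>\<omega>. indicator A \<omega> * f \<omega>)" if "integrable P f" for f :: "'a \<Rightarrow> real"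
    using integrable_mult_indicator[OF AP that] by simp
  have "\<xi> \<in> L1_closure P H (vector_cond_exp P H ` integrable_selections P P X)"
    using Y \<xi> by (auto simp: has_set_cond_exp_def)
  then obtain \<zeta> where xi: "integrable P \<xi>" and \<zeta>: "\<zeta> \<in> integrable_selections P P X"
    and close: "(\<integral>\<omega>. norm (\<xi> \<omega> - vector_cond_exp P H \<zeta> \<omega>) \<partial>P) < d"
    using d(1) unfolding L1_closure_def by auto
  have zi: "integrable P \<zeta>" using \<zeta> by (simp add: integrable_selections_def)
  note vce = integral_inner_vector_cond_exp[OF H zi A]
  have "(\<integral>\<omega>. indicator A \<omega> * (u \<bullet> \<xi> \<omega>) \<partial>P)
     = (\<integral>\<omega>. indicator A \<omega> * (u \<bullet> (\<xi> \<omega> - vector_cond_exp P H \<zeta> \<omega>)) \<partial>P)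
     + (\<integral>\<omega>. indicator A \<omega> * (u \<bullet> vector_cond_exp P H \<zeta> \<omega>) \<partial>P)"
    using iA[OF integrable_inner_right[OF xi]] iA[OF integrable_inner_right[OF vce(1)]]
    by (simp add: inner_diff_right right_diff_distrib)
  also have "(\<integral>\<omega>. indicator A \<omega> * (u \<bullet> (\<xi> \<omega> - vector_cond_exp P H \<zeta> \<omega>)) \<partial>P)
     \<le> (\<integral>\<omega>. norm u * norm (\<xi> \<omega> - vector_cond_exp P H \<zeta> \<omega>) \<partial>P)"
  proof (intro integral_mono iA integrable_mult_right integrable_norm integrable_inner_right
      Bochner_Integration.integrable_diff xi vce(1))
    fix \<omega>
    show "indicator A \<omega> * (u \<bullet> (\<xi> \<omega> - vector_cond_exp P H \<zeta> \<omega>))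
      \<le> norm u * norm (\<xi> \<omega> - vector_cond_exp P H \<zeta> \<omega>)"
      using norm_cauchy_schwarz[of u "\<xi> \<omega> - vector_cond_exp P H \<zeta> \<omega>"] by (auto simp: indicator_def)
  qed
  also have "\<dots> \<le> norm u * d" using close by (simp add: mult_left_mono)
  also have "\<dots> \<le> e" by (rule d(2))
  also have "(\<integral>\<omega>. indicator A \<omega> * (u \<bullet> vector_cond_exp P H \<zeta> \<omega>) \<partial>P) = (\<integral>\<omega>. indicator A \<omega> * (u \<bullet> \<zeta> \<omega>) \<partial>P)"
    by (rule vce(2))
  also have "\<dots> \<le> (\<integral>\<omega>. indicator A \<omega> * support_value u (X \<omega>) \<partial>P)"
    using AE_inner_le_value[OF \<zeta>, of u]
    by (intro integral_mono_AE iA integrable_value integrable_inner_right zi)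
       (auto simp: indicator_def elim!: eventually_mono)
  finally show "(\<integral>\<omega>. indicator A \<omega> * (u \<bullet> \<xi> \<omega>) \<partial>P) \<le> (\<integral>\<omega>. indicator A \<omega> * support_value u (X \<omega>) \<partial>P) + e"
    by simp
qed

section \<open>The modification\<close>

lemma hausdorff_limit_cong:
  assumes "eventually (\<lambda>r. C r = D r) A"
  shows "hausdorff_limit C L A \<longleftrightarrow> hausdorff_limit D L A"
proof -
  have "eventually (\<lambda>r. hausdorff_distance (C r) L = hausdorff_distance (D r) L) A"
    using assms by eventually_elim simp
  from tendsto_cong[OF this] show ?thesis by (simp add: hausdorff_limit_def)
qed

text \<open>The event that X' hits a closed set differs from that for X only inside a null set. The
  part of it inside is measurable by completeness and lies in \<open>G\<close> because
  \<open>G\<close> contains the null sets, whatever X' is there.\<close>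

lemma set_valued_rv_AE_eq:
  assumes G: "subalgebra P G" "complete_measure P" "null_sets P \<subseteq> sets G"
    and X: "set_valued_rv G X" and eq: "AE \<omega> in P. X \<omega> = X' \<omega>"
    and X': "\<And>\<omega>. closed (X' \<omega>)" "\<And>\<omega>. X' \<omega> \<noteq> {}"
  shows "set_valued_rv G X'"
  unfolding set_valued_rv_def
proof (intro conjI ballI allI impI X')
  interpret complete_measure P by (rule G(2))
  fix C :: "'b set" assume C: "closed C"
  define A where "A = {\<omega> \<in> space G. X \<omega> \<inter> C \<noteq> {}}"
  define A' where "A' = {\<omega> \<in> space G. X' \<omega> \<inter> C \<noteq> {}}"
  have sp: "space G = space P" using G(1) by (simp add: subalgebra_def)
  obtain N where N: "N \<in> null_sets P" "{\<omega> \<in> space P. X \<omega> \<noteq> X' \<omega>} \<subseteq> N"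
    using eq by (auto simp: eventually_ae_filter)
  have "A' \<inter> N \<in> null_sets P" using N(1) by (rule complete2[rotated]) auto
  then have "(A - N) \<union> (A' \<inter> N) \<in> sets G"
    using X C G(3) N(1) unfolding A_def set_valued_rv_def by (intro sets.Un sets.Diff) auto
  moreover have "A' = (A - N) \<union> (A' \<inter> N)"
    using N(2) sp by (auto simp: A_def A'_def)
  ultimately show "{\<omega> \<in> space G. X' \<omega> \<inter> C \<noteq> {}} \<in> sets G" by (simp add: A'_def)
qed

lemma integrable_selections_AE_eq:
  assumes eq: "AE \<omega> in P. X \<omega> = X' \<omega>"
  shows "integrable_selections P G X = integrable_selections P G X'"
proof -
  have "(AE \<omega> in P. \<xi> \<omega> \<in> X \<omega>) \<longleftrightarrow> (AE \<omega> in P. \<xi> \<omega> \<in> X' \<omega>)" for \<xi>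
  proof
    assume "AE \<omega> in P. \<xi> \<omega> \<in> X \<omega>"
    with eq show "AE \<omega> in P. \<xi> \<omega> \<in> X' \<omega>" by eventually_elim simp
  next
    assume "AE \<omega> in P. \<xi> \<omega> \<in> X' \<omega>"
    with eq show "AE \<omega> in P. \<xi> \<omega> \<in> X \<omega>" by eventually_elim simp
  qed
  then show ?thesis by (simp add: integrable_selections_def)
qed

text \<open>The relation sees X only through its integrable selections.\<close>

lemma has_set_cond_exp_AE_eq:
  assumes "AE \<omega> in P. X \<omega> = X' \<omega>"
  shows "has_set_cond_exp P G X Y \<longleftrightarrow> has_set_cond_exp P G X' Y"
  by (simp add: has_set_cond_exp_def integrable_selections_AE_eq[OF assms])

section \<open>Path properties of the set-valued submartingale\<close>

locale bounded_convex_submartingale = prob_space P for P :: "'a measure" +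
  fixes F :: "real \<Rightarrow> 'a measure" and M :: "real \<Rightarrow> 'a \<Rightarrow> 'b::euclidean_space set"
  assumes filtration: "is_filtration P F" and usual: "usual_conditions P F"
    and submartingale: "set_submartingale P F M"
    and convex_process: "convex_process P M"
    and bounded_process: "integrably_bounded_process P M"
begin

lemma convex_bounded_rv: "0 \<le> t \<Longrightarrow> convex_bounded_rv P (F t) (M t)"
  using filtration submartingale convex_process bounded_process
  by unfold_locales
     (auto simp: is_filtration_def set_submartingale_def set_adapted_def convex_process_def
        integrably_bounded_process_def)

lemma value_properties:
  assumes "0 \<le> t" "\<omega> \<in> space P"
  shows "convex (M t \<omega>)" "closed (M t \<omega>)" "M t \<omega> \<noteq> {}"
proof -
  interpret convex_bounded_rv P "F t" "M t" using assms(1) by (rule convex_bounded_rv)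
  show "convex (M t \<omega>)" "closed (M t \<omega>)" "M t \<omega> \<noteq> {}"
    using convex closed nonempty assms(2) by auto
qed

lemma scalar_submartingale: "real_time_submartingale P F (\<lambda>t \<omega>. support_value u (M t \<omega>))"
proof unfold_locales
  fix s :: real assume "s \<in> {0..}"
  then interpret S: convex_bounded_rv P "F s" "M s" using convex_bounded_rv by simp
  show "subalgebra P (F s)" by (rule S.subalg)
  show "(\<lambda>\<omega>. support_value u (M s \<omega>)) \<in> borel_measurable (F s)"
    by (intro measurable_support_value S.rv)
  show "integrable P (\<lambda>\<omega>. support_value u (M s \<omega>))" by (rule S.integrable_value)
next
  fix s t :: real assume st: "s \<in> {0..}" "t \<in> {0..}" "s \<le> t"
  show FF: "sets (F s) \<subseteq> sets (F t)" using filtration st by (auto simp: is_filtration_def)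
  fix A assume A: "A \<in> sets (F s)"
  interpret S: convex_bounded_rv P "F s" "M s" using convex_bounded_rv st by simp
  interpret T: convex_bounded_rv P "F t" "M t" using convex_bounded_rv st by simp
  obtain Y where Y: "has_set_cond_exp P (F s) (M t) Y" "AE \<omega> in P. M s \<omega> \<subseteq> Y \<omega>"
    using submartingale st by (auto simp: set_submartingale_def)
  \<comment> \<open>The almost sure inclusion of M s in \<open>Y\<close> is used here: selections of
    M s that are measurable at time \<open>s\<close> are also selections of
    \<open>Y\<close>.\<close>
  have sel: "S.selection u k \<in> integrable_selections P (F s) Y" for k
    using S.selection_integrable_selections(1)[of u k] Y(2)
    by (auto simp: integrable_selections_def elim: eventually_elim2)
  have "A \<in> sets P" using A S.sets_G by auto
  from S.selection_integral_tendsto[OF this, of u]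
  show "(\<integral>\<omega>. indicator A \<omega> * support_value u (M s \<omega>) \<partial>P) \<le> (\<integral>\<omega>. indicator A \<omega> * support_value u (M t \<omega>) \<partial>P)"
    by (rule tendsto_upperbound) (simp_all add: T.selection_cond_exp_le[OF S.subalg Y(1) sel A])
qed

text \<open>Split \<open>A\<close> by the sign of the value at time \<open>r\<close>, which is known
  at that time. On \<open>B\<close> the modulus is s(u), on \<open>C\<close> it is at most s(-u),
  and both parts can be moved to time \<open>T\<close>. This feeds the uniform
  integrability.\<close>

lemma support_value_dominated:
  assumes r: "0 \<le> r" "r \<le> T" and A: "A \<in> sets (F r)"
  shows "(\<integral>\<omega>. indicator A \<omega> * \<bar>support_value u (M r \<omega>)\<bar> \<partial>P)
    \<le> (\<integral>\<omega>. indicator A \<omega> * (\<bar>support_value u (M T \<omega>)\<bar> + \<bar>support_value (- u) (M T \<omega>)\<bar>) \<partial>P)"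
proof -
  interpret R: convex_bounded_rv P "F r" "M r" using convex_bounded_rv r by simp
  interpret T: convex_bounded_rv P "F T" "M T" using convex_bounded_rv r by simp
  interpret U: real_time_submartingale P F "\<lambda>t \<omega>. support_value u (M t \<omega>)" by (rule scalar_submartingale)
  interpret V: real_time_submartingale P F "\<lambda>t \<omega>. support_value (- u) (M t \<omega>)" by (rule scalar_submartingale)
  have [measurable]: "(\<lambda>\<omega>. support_value u (M r \<omega>)) \<in> borel_measurable (F r)"
    by (intro measurable_support_value R.rv)
  define B where "B = A \<inter> {\<omega> \<in> space (F r). 0 \<le> support_value u (M r \<omega>)}"
  define C where "C = A \<inter> {\<omega> \<in> space (F r). support_value u (M r \<omega>) < 0}"
  have BC: "B \<in> sets (F r)" "C \<in> sets (F r)" unfolding B_def C_def using A by measurable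
  then have BCP: "B \<in> sets P" "C \<in> sets P" "A \<in> sets P" using A R.sets_G by auto
  have A_sub: "A \<subseteq> space (F r)" using A by (rule sets.sets_into_space)
  have i: "integrable P (\<lambda>\<omega>. indicator D \<omega> * f \<omega>)" if "integrable P f" "D \<in> sets P" for f :: "'a \<Rightarrow> real" and D
    using integrable_mult_indicator[OF that(2,1)] by simp
  note ints = R.integrable_value T.integrable_value
  have "(\<integral>\<omega>. indicator A \<omega> * \<bar>support_value u (M r \<omega>)\<bar> \<partial>P)
     \<le> (\<integral>\<omega>. indicator B \<omega> * support_value u (M r \<omega>) + indicator C \<omega> * support_value (- u) (M r \<omega>) \<partial>P)"
  proof (intro integral_mono_AE Bochner_Integration.integrable_add i integrable_abs ints BCP)
    show "AE \<omega> in P. indicator A \<omega> * \<bar>support_value u (M r \<omega>)\<bar>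
      \<le> indicator B \<omega> * support_value u (M r \<omega>) + indicator C \<omega> * support_value (- u) (M r \<omega>)"
      using R.AE_norm_le_radius AE_space
    proof eventually_elim
      case (elim \<omega>)
      then have "- support_value u (M r \<omega>) \<le> support_value (- u) (M r \<omega>)"
        using R.nonempty by (intro support_value_opposite boundedI) auto
      then show ?case using A_sub by (auto simp: B_def C_def indicator_def)
    qed
  qed
  also have "\<dots> = (\<integral>\<omega>. indicator B \<omega> * support_value u (M r \<omega>) \<partial>P)
      + (\<integral>\<omega>. indicator C \<omega> * support_value (- u) (M r \<omega>) \<partial>P)"
    by (intro Bochner_Integration.integral_add i ints BCP)
  also have "\<dots> \<le> (\<integral>\<omega>. indicator B \<omega> * support_value u (M T \<omega>) \<partial>P)
      + (\<integral>\<omega>. indicator C \<omega> * support_value (- u) (M T \<omega>) \<partial>P)"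
    using r by (intro add_mono U.submartingale V.submartingale BC) auto
  also have "\<dots> = (\<integral>\<omega>. indicator B \<omega> * support_value u (M T \<omega>) + indicator C \<omega> * support_value (- u) (M T \<omega>) \<partial>P)"
    by (intro Bochner_Integration.integral_add[symmetric] i ints BCP)
  also have "\<dots> \<le> (\<integral>\<omega>. indicator A \<omega> * (\<bar>support_value u (M T \<omega>)\<bar> + \<bar>support_value (- u) (M T \<omega>)\<bar>) \<partial>P)"
    by (intro integral_mono Bochner_Integration.integrable_add i integrable_abs ints BCP)
       (auto simp: B_def C_def indicator_def)
  finally show ?thesis .
qed

text \<open>Upper bounds on the support values in the directions b and -b bound every coordinate
  from both sides, and the norm is at most the sum of the moduli of the coordinates.\<close>

lemma AE_locally_bounded:
  "AE \<omega> in P. \<exists>K\<ge>0. \<forall>r\<in>\<rat> \<inter> {0..real N}. M r \<omega> \<subseteq> cball 0 K"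
proof -
  let ?D = "Basis \<union> uminus ` Basis :: 'b set"
  have "AE \<omega> in P. \<forall>u\<in>?D. \<exists>K. \<forall>r\<in>\<rat> \<inter> {0..real N}. support_value u (M r \<omega>) \<le> K"
    by (intro AE_finite_allI) (auto intro: real_time_submartingale.AE_bounded_above scalar_submartingale)
  \<comment> \<open>Needed for the support values to be genuine suprema; for an unbounded set
    \<open>support_value\<close> may be the default 0.\<close>
  moreover have "AE \<omega> in P. \<forall>r\<in>\<rat> \<inter> {0..real N}. bounded (M r \<omega>)"
  proof -
    have "AE \<omega> in P. bounded (M r \<omega>)" if "r \<in> \<rat> \<inter> {0..real N}" for r
    proof -
      interpret R: convex_bounded_rv P "F r" "M r" using convex_bounded_rv that by simp
      show ?thesis using R.AE_norm_le_radius by eventually_elim (auto intro: boundedI)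
    qed
    then show ?thesis by (subst AE_ball_countable) (auto intro: countable_subset[OF _ countable_rat])
  qed
  ultimately show ?thesis
  proof eventually_elim
    case (elim \<omega>)
    from elim(1) obtain K where K: "\<And>u r. u \<in> ?D \<Longrightarrow> r \<in> \<rat> \<inter> {0..real N} \<Longrightarrow> support_value u (M r \<omega>) \<le> K u"
      by metis
    define c where "c = (\<Sum>b\<in>Basis. \<bar>K b\<bar> + \<bar>K (- b)\<bar>)"
    have "norm x \<le> c" if r: "r \<in> \<rat> \<inter> {0..real N}" and x: "x \<in> M r \<omega>" for r x
    proof -
      have "\<bar>x \<bullet> b\<bar> \<le> \<bar>K b\<bar> + \<bar>K (- b)\<bar>" if b: "b \<in> Basis" for b
      proof -
        have bd: "bounded (M r \<omega>)" using elim(2) r by auto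
        have "b \<bullet> x \<le> K b" "- b \<bullet> x \<le> K (- b)"
          using order_trans[OF support_value_upper[OF bd x] K[OF _ r]] b by blast+
        then show ?thesis by (simp add: inner_commute)
      qed
      then show ?thesis unfolding c_def by (intro order_trans[OF norm_le_l1 sum_mono])
    qed
    moreover have "0 \<le> c" unfolding c_def by (intro sum_nonneg) simp
    ultimately show ?case by (intro exI[of _ c]) auto
  qed
qed

lemma AE_finitely_many_upcrossings:
  assumes "countable W"
  shows "AE \<omega> in P. \<forall>u\<in>W. \<forall>a\<in>\<rat>. \<forall>b\<in>\<rat>. a < b \<longrightarrow>
    (\<exists>k. \<not> upcrosses (\<rat> \<inter> {0..}) a b (\<lambda>r. support_value u (M r \<omega>)) k (real N))"
proof (subst AE_ball_countable[OF assms], intro ballI,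
    subst AE_ball_countable[OF countable_rat], intro ballI,
    subst AE_ball_countable[OF countable_rat], intro ballI)
  fix u a and b :: real
  interpret U: real_time_submartingale P F "\<lambda>t \<omega>. support_value u (M t \<omega>)" by (rule scalar_submartingale)
  show "AE \<omega> in P. a < b \<longrightarrow> (\<exists>k. \<not> upcrosses (\<rat> \<inter> {0..}) a b (\<lambda>r. support_value u (M r \<omega>)) k (real N))"
    using U.AE_finitely_many_upcrossings[of a b N] by (cases "a < b") auto
qed

text \<open>One null set serves all \<open>t\<close>: it collects the exceptions for countably many
  horizons, directions and rational levels, and off it the existence of limits is a fact about a
  single path.\<close>

lemma AE_support_value_limits:
  assumes W: "countable W"
  shows "AE \<omega> in P. \<forall>u\<in>W. \<forall>t.
    (0 \<le> t \<longrightarrow> (\<exists>l. ((\<lambda>r. support_value u (M r \<omega>)) \<longlongrightarrow> l) (at t within (\<rat> \<inter> {t<..})))) \<and>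
    (0 < t \<longrightarrow> (\<exists>l. ((\<lambda>r. support_value u (M r \<omega>)) \<longlongrightarrow> l) (at t within (\<rat> \<inter> {0..<t}))))"
proof -
  have "AE \<omega> in P. \<forall>N::nat. \<exists>K\<ge>0. \<forall>r\<in>\<rat> \<inter> {0..real N}. M r \<omega> \<subseteq> cball 0 K"
    by (subst AE_all_countable) (intro allI AE_locally_bounded)
  moreover have "AE \<omega> in P. \<forall>N::nat. \<forall>u\<in>W. \<forall>a\<in>\<rat>. \<forall>b\<in>\<rat>. a < b \<longrightarrow>
    (\<exists>k. \<not> upcrosses (\<rat> \<inter> {0..}) a b (\<lambda>r. support_value u (M r \<omega>)) k (real N))"
    by (subst AE_all_countable) (intro allI AE_finitely_many_upcrossings W)
  ultimately show ?thesis using AE_space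
  proof eventually_elim
    case (elim \<omega>)
    show ?case
    proof (intro ballI allI)
      fix u t assume u: "u \<in> W"
      obtain N :: nat where N: "t < real N" using reals_Archimedean2 by blast
      obtain K where K: "0 \<le> K" "\<And>r. r \<in> \<rat> \<inter> {0..real N} \<Longrightarrow> M r \<omega> \<subseteq> cball 0 K" using elim(1) by blast
      have bdd: "\<bar>support_value u (M r \<omega>)\<bar> \<le> norm u * K" if "r \<in> \<rat> \<inter> {0..real N}" for r
        using K(2)[OF that] value_properties[of r \<omega>] that elim(3) by (intro abs_support_value_le) auto
      have up: "\<exists>k. \<not> upcrosses (\<rat> \<inter> {0..}) a b (\<lambda>r. support_value u (M r \<omega>)) k (real N)"
        if "a \<in> \<rat>" "b \<in> \<rat>" "a < b" for a b using elim(2) u that by blast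
      note lims = one_sided_limits_exist[of N "\<lambda>r. support_value u (M r \<omega>)", OF bdd up]
      show "(0 \<le> t \<longrightarrow> (\<exists>l. ((\<lambda>r. support_value u (M r \<omega>)) \<longlongrightarrow> l) (at t within (\<rat> \<inter> {t<..})))) \<and>
        (0 < t \<longrightarrow> (\<exists>l. ((\<lambda>r. support_value u (M r \<omega>)) \<longlongrightarrow> l) (at t within (\<rat> \<inter> {0..<t}))))"
        using lims N by blast
    qed
  qed
qed

lemma eventually_right: "0 \<le> t \<Longrightarrow> t < N \<Longrightarrow> eventually (\<lambda>r. r \<in> \<rat> \<inter> {0..N}) (at t within (\<rat> \<inter> {t<..}))"
  for t N :: real
  unfolding eventually_at by (intro exI[of _ "N - t"]) (auto simp: dist_real_def)

lemma eventually_left: "t \<le> N \<Longrightarrow> eventually (\<lambda>r. r \<in> \<rat> \<inter> {0..N}) (at t within (\<rat> \<inter> {0..<t}))"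
  for t N :: real
  unfolding eventually_at by (intro exI[of _ 1]) (auto simp: dist_real_def)

lemma AE_one_sided_limits:
  fixes W :: "'b set"
  assumes W: "countable W" "cball 0 1 \<subseteq> closure W"
  shows "AE \<omega> in P. \<forall>t.
    (0 \<le> t \<longrightarrow> (\<exists>L. convex L \<and> has_right_limit (\<lambda>r. M r \<omega>) t L)) \<and>
    (0 < t \<longrightarrow> (\<exists>L. convex L \<and> has_left_limit (\<lambda>r. M r \<omega>) t L))"
proof -
  have "AE \<omega> in P. \<forall>N::nat. \<exists>K\<ge>0. \<forall>r\<in>\<rat> \<inter> {0..real N}. M r \<omega> \<subseteq> cball 0 K"
    by (subst AE_all_countable) (intro allI AE_locally_bounded)
  with AE_support_value_limits[OF W(1)] show ?thesis using AE_space
  proof eventually_elim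
    case (elim \<omega>)
    show ?case
    proof
      fix t
      obtain N :: nat where N: "t < real N" using reals_Archimedean2 by blast
      obtain K where K: "0 \<le> K" "\<And>r. r \<in> \<rat> \<inter> {0..real N} \<Longrightarrow> M r \<omega> \<subseteq> cball 0 K" using elim(2) by blast
      have good: "convex (M r \<omega>) \<and> closed (M r \<omega>) \<and> M r \<omega> \<noteq> {} \<and> M r \<omega> \<subseteq> cball 0 K"
        if "r \<in> \<rat> \<inter> {0..real N}" for r
        using K(2)[OF that] value_properties[of r \<omega>] that elim(3) by auto
      have "\<exists>L. convex L \<and> has_right_limit (\<lambda>r. M r \<omega>) t L" if "0 \<le> t"
        unfolding has_right_limit_def
        using elim(1) that
        by (intro hausdorff_limit_exists[OF right_filter_nontrivial W(2) K(1)]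
            eventually_mono[OF eventually_right[OF that N] good]) auto
      moreover have "\<exists>L. convex L \<and> has_left_limit (\<lambda>r. M r \<omega>) t L" if "0 < t"
        unfolding has_left_limit_def
        using elim(1) that
        by (intro hausdorff_limit_exists[OF left_filter_nontrivial[OF that] W(2) K(1)]
            eventually_mono[OF eventually_left[OF less_imp_le[OF N]] good]) auto
      ultimately show "(0 \<le> t \<longrightarrow> (\<exists>L. convex L \<and> has_right_limit (\<lambda>r. M r \<omega>) t L)) \<and>
        (0 < t \<longrightarrow> (\<exists>L. convex L \<and> has_left_limit (\<lambda>r. M r \<omega>) t L))" by blast
    qed
  qed
qed

text \<open>Here the null set may depend on \<open>t\<close>. The dominating variable is taken at an
  integer time beyond \<open>t\<close>.\<close>

lemma AE_support_value_right_limit: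
  assumes t: "0 \<le> t"
    and cont: "continuous (at_right t) (\<lambda>r. support_function u (set_expectation P (M r)))"
  shows "AE \<omega> in P. ((\<lambda>r. support_value u (M r \<omega>)) \<longlongrightarrow> support_value u (M t \<omega>)) (at t within (\<rat> \<inter> {t<..}))"
proof -
  interpret U: real_time_submartingale P F "\<lambda>t \<omega>. support_value u (M t \<omega>)" by (rule scalar_submartingale)
  obtain N :: nat where N: "t < real N" using reals_Archimedean2 by blast
  interpret T: convex_bounded_rv P "F (real N)" "M (real N)" by (intro convex_bounded_rv) simp
  have mean: "support_function u (set_expectation P (M r)) = ereal (expectation (\<lambda>\<omega>. support_value u (M r \<omega>)))"
    if "0 \<le> r" for r
    using convex_bounded_rv.support_function_expectation[OF convex_bounded_rv[OF that]] .
  show ?thesis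
  proof (rule U.AE_right_limit_eq[OF t N])
    show "sets (F t) = (\<Inter>u\<in>{t<..}. sets (F u))" using usual t unfolding usual_conditions_def by blast
    have "((\<lambda>r. support_function u (set_expectation P (M r))) \<longlongrightarrow> support_function u (set_expectation P (M t))) (at_right t)"
      using cont by (simp add: continuous_within)
    moreover have "eventually (\<lambda>r. support_function u (set_expectation P (M r))
        = ereal (expectation (\<lambda>\<omega>. support_value u (M r \<omega>)))) (at_right t)"
      using eventually_at_right_less[of t] by eventually_elim (use t in \<open>simp add: mean\<close>)
    ultimately have "((\<lambda>r. ereal (expectation (\<lambda>\<omega>. support_value u (M r \<omega>)))) \<longlongrightarrow>
        ereal (expectation (\<lambda>\<omega>. support_value u (M t \<omega>)))) (at_right t)"
      unfolding mean[OF t] by (rule Lim_transform_eventually)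
    then show "((\<lambda>r. expectation (\<lambda>\<omega>. support_value u (M r \<omega>))) \<longlongrightarrow>
        expectation (\<lambda>\<omega>. support_value u (M t \<omega>))) (at_right t)" by simp
    show "integrable P (\<lambda>\<omega>. \<bar>support_value u (M (real N) \<omega>)\<bar> + \<bar>support_value (- u) (M (real N) \<omega>)\<bar>)"
      by (intro Bochner_Integration.integrable_add integrable_abs T.integrable_value)
    show "(\<integral>\<omega>. indicator A \<omega> * \<bar>support_value u (M r \<omega>)\<bar> \<partial>P)
      \<le> (\<integral>\<omega>. indicator A \<omega> * (\<bar>support_value u (M (real N) \<omega>)\<bar> + \<bar>support_value (- u) (M (real N) \<omega>)\<bar>) \<partial>P)"
      if "t < r" "r \<le> real N" "A \<in> sets (F r)" for r A
      using that t by (intro support_value_dominated) auto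
    show "AE \<omega> in P. \<exists>K. \<forall>r\<in>\<rat> \<inter> {t<..real N}. \<bar>support_value u (M r \<omega>)\<bar> \<le> K"
      using AE_locally_bounded[of N] AE_space
    proof eventually_elim
      case (elim \<omega>)
      then obtain K where K: "\<And>r. r \<in> \<rat> \<inter> {0..real N} \<Longrightarrow> M r \<omega> \<subseteq> cball 0 K" by blast
      have "\<bar>support_value u (M r \<omega>)\<bar> \<le> norm u * K" if "r \<in> \<rat> \<inter> {t<..real N}" for r
        using K[of r] value_properties[of r \<omega>] that t elim(2) by (intro abs_support_value_le) auto
      then show ?case by blast
    qed
    show "AE \<omega> in P. \<exists>l. ((\<lambda>r. support_value u (M r \<omega>)) \<longlongrightarrow> l) (at t within (\<rat> \<inter> {t<..}))"
      using AE_support_value_limits[of "{u}"] t by auto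
  qed simp
qed

lemma AE_right_limit:
  fixes W :: "'b set"
  assumes W: "countable W" "cball 0 1 \<subseteq> closure W" and t: "0 \<le> t"
    and cont: "\<And>u. u \<in> W \<Longrightarrow> continuous (at_right t) (\<lambda>r. support_function u (set_expectation P (M r)))"
  shows "AE \<omega> in P. has_right_limit (\<lambda>r. M r \<omega>) t (M t \<omega>)"
proof -
  obtain N :: nat where N: "t < real N" using reals_Archimedean2 by blast
  interpret T: convex_bounded_rv P "F t" "M t" using t by (rule convex_bounded_rv)
  have "AE \<omega> in P. \<forall>u\<in>W. ((\<lambda>r. support_value u (M r \<omega>)) \<longlongrightarrow> support_value u (M t \<omega>)) (at t within (\<rat> \<inter> {t<..}))"
    by (subst AE_ball_countable[OF W(1)]) (intro ballI AE_support_value_right_limit t cont)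
  then show ?thesis using AE_locally_bounded[of N] T.AE_norm_le_radius AE_space
  proof eventually_elim
    case (elim \<omega>)
    then obtain K where K: "0 \<le> K" "\<And>r. r \<in> \<rat> \<inter> {0..real N} \<Longrightarrow> M r \<omega> \<subseteq> cball 0 K" by blast
    \<comment> \<open>The bound \<open>K\<close> concerns rational times only; \<open>t\<close> may
      be irrational, so M t is covered by its own radius.\<close>
    define R where "R = max K (T.radius \<omega>)"
    have good: "convex (M r \<omega>) \<and> closed (M r \<omega>) \<and> M r \<omega> \<noteq> {} \<and> M r \<omega> \<subseteq> cball 0 R"
      if "r \<in> \<rat> \<inter> {0..real N}" for r
      using K(2)[OF that] value_properties[of r \<omega>] that elim(4) by (force simp: R_def)
    show ?case
      unfolding has_right_limit_def
    proof (rule hausdorff_limit_if_support_values_tendsto[OF W(2)])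
      show "0 \<le> R" using K(1) by (simp add: R_def)
      show "\<forall>\<^sub>F r in at t within \<rat> \<inter> {t<..}. convex (M r \<omega>) \<and> closed (M r \<omega>) \<and> M r \<omega> \<noteq> {} \<and> M r \<omega> \<subseteq> cball 0 R"
        by (rule eventually_mono[OF eventually_right[OF t N] good])
      show "convex (M t \<omega>)" "closed (M t \<omega>)" "M t \<omega> \<noteq> {}" using value_properties t elim(4) by auto
      show "M t \<omega> \<subseteq> cball 0 R" using elim(3) by (force simp: R_def)
    qed (use elim(1) in blast)
  qed
qed

text \<open>The default {0} and the demand that \<open>L\<close> be convex keep every value closed,
  convex and nonempty, also for outcomes without a right limit.\<close>

definition modification :: "real \<Rightarrow> 'a \<Rightarrow> 'b set" where
  "modification t \<omega> =
    (if \<exists>L. convex L \<and> has_right_limit (\<lambda>r. M r \<omega>) t L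
     then SOME L. convex L \<and> has_right_limit (\<lambda>r. M r \<omega>) t L else {0})"

lemma modification_right_limit:
  assumes "\<exists>L. convex L \<and> has_right_limit (\<lambda>r. M r \<omega>) t L"
  shows "convex (modification t \<omega>)" "has_right_limit (\<lambda>r. M r \<omega>) t (modification t \<omega>)"
  using someI_ex[OF assms] assms by (simp_all add: modification_def)

lemma modification_values: "convex (modification t \<omega>)" "closed (modification t \<omega>)" "modification t \<omega> \<noteq> {}"
proof -
  have "convex (modification t \<omega>) \<and> closed (modification t \<omega>) \<and> modification t \<omega> \<noteq> {}"
  proof (cases "\<exists>L. convex L \<and> has_right_limit (\<lambda>r. M r \<omega>) t L")
    case True
    then show ?thesis using modification_right_limit[OF True]
      by (simp add: has_right_limit_def hausdorff_limit_def)
  next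
    case False
    show ?thesis unfolding modification_def if_not_P[OF False] by simp
  qed
  then show "convex (modification t \<omega>)" "closed (modification t \<omega>)" "modification t \<omega> \<noteq> {}" by auto
qed

lemma AE_modification_eq:
  assumes t: "0 \<le> t" and lim: "AE \<omega> in P. has_right_limit (\<lambda>r. M r \<omega>) t (M t \<omega>)"
  shows "AE \<omega> in P. M t \<omega> = modification t \<omega>"
  using lim AE_space
proof eventually_elim
  case (elim \<omega>)
  then have ex: "\<exists>L. convex L \<and> has_right_limit (\<lambda>r. M r \<omega>) t L" using value_properties[OF t] by blast
  obtain N :: nat where N: "t < real N" using reals_Archimedean2 by blast
  have "eventually (\<lambda>r. M r \<omega> \<noteq> {}) (at t within (\<rat> \<inter> {t<..}))"
    using eventually_right[OF t N] by eventually_elim (use value_properties elim(2) in auto)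
  then show ?case
    using hausdorff_limit_unique[OF right_filter_nontrivial] elim(1) modification_right_limit(2)[OF ex]
    unfolding has_right_limit_def by blast
qed

text \<open>One-sided limits look at rational times only, and off one null set the two processes
  agree at all of these. So they have the same one-sided limits at every \<open>t\<close>, and the
  right limit of M is by construction the value of the modification.\<close>

lemma AE_modification_cadlag:
  fixes W :: "'b set"
  assumes W: "countable W" "cball 0 1 \<subseteq> closure W"
    and eq: "\<And>t. 0 \<le> t \<Longrightarrow> AE \<omega> in P. M t \<omega> = modification t \<omega>"
  shows "AE \<omega> in P. hausdorff_cadlag (\<lambda>t. modification t \<omega>)"
proof -
  have "AE \<omega> in P. \<forall>r\<in>\<rat> \<inter> {0..}. M r \<omega> = modification r \<omega>"
    by (subst AE_ball_countable) (auto intro: countable_subset[OF _ countable_rat] eq)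
  with AE_one_sided_limits[OF W] show ?thesis
  proof eventually_elim
    case (elim \<omega>)
    have right: "has_right_limit (\<lambda>t. modification t \<omega>) t L \<longleftrightarrow> has_right_limit (\<lambda>r. M r \<omega>) t L"
      if "0 \<le> t" for t L
    proof -
      have "eventually (\<lambda>r. modification r \<omega> = M r \<omega>) (at t within (\<rat> \<inter> {t<..}))"
        using elim(2) that by (auto simp: eventually_at_filter)
      then show ?thesis unfolding has_right_limit_def by (rule hausdorff_limit_cong)
    qed
    have left: "has_left_limit (\<lambda>t. modification t \<omega>) t L \<longleftrightarrow> has_left_limit (\<lambda>r. M r \<omega>) t L" for t L
    proof -
      have "eventually (\<lambda>r. modification r \<omega> = M r \<omega>) (at t within (\<rat> \<inter> {0..<t}))"
        using elim(2) by (auto simp: eventually_at_filter)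
      then show ?thesis unfolding has_left_limit_def by (rule hausdorff_limit_cong)
    qed
    show ?case
      unfolding hausdorff_cadlag_def left
      using elim(1) right modification_right_limit(2) by blast
  qed
qed

end

section \<open>Transfer of the remaining properties to the modification\<close>

lemma set_rv_integrable_AE_eq:
  "AE \<omega> in P. X \<omega> = X' \<omega> \<Longrightarrow> set_rv_integrable P X \<longleftrightarrow> set_rv_integrable P X'"
  by (simp add: set_rv_integrable_def integrable_selections_AE_eq)

lemma set_rv_integrably_bounded_AE_eq:
  assumes "AE \<omega> in P. X \<omega> = X' \<omega>"
  shows "set_rv_integrably_bounded P X \<longleftrightarrow> set_rv_integrably_bounded P X'"
proof -
  have "(\<integral>\<^sup>+ \<omega>. norm_of_set (X \<omega>) \<partial>P) = (\<integral>\<^sup>+ \<omega>. norm_of_set (X' \<omega>) \<partial>P)"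
    using assms by (intro nn_integral_cong_AE) (auto elim: eventually_mono)
  then show ?thesis by (simp add: set_rv_integrably_bounded_def)
qed

lemma set_submartingale_modification:
  assumes sub: "set_submartingale P F M" and ad: "set_adapted F M'"
    and eq: "\<And>t. 0 \<le> t \<Longrightarrow> AE \<omega> in P. M t \<omega> = M' t \<omega>"
  shows "set_submartingale P F M'"
  unfolding set_submartingale_def
proof (intro conjI ad allI impI)
  show "integrable_process P M'"
    using sub set_rv_integrable_AE_eq[OF eq]
    by (simp add: set_submartingale_def integrable_process_def)
  fix s t :: real assume st: "0 \<le> s" "s \<le> t"
  then obtain Y where Y: "has_set_cond_exp P (F s) (M t) Y" "AE \<omega> in P. M s \<omega> \<subseteq> Y \<omega>"
    using sub by (auto simp: set_submartingale_def)
  have "AE \<omega> in P. M' s \<omega> \<subseteq> Y \<omega>" using Y(2) eq[OF st(1)] by eventually_elim simp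
  moreover have "has_set_cond_exp P (F s) (M' t) Y" using Y(1) has_set_cond_exp_AE_eq[OF eq] st by simp
  ultimately show "\<exists>Y. has_set_cond_exp P (F s) (M' t) Y \<and> (AE \<omega> in P. M' s \<omega> \<subseteq> Y \<omega>)" by blast
qed

lemma set_martingale_modification:
  assumes mart: "set_martingale P F M" and ad: "set_adapted F M'"
    and eq: "\<And>t. 0 \<le> t \<Longrightarrow> AE \<omega> in P. M t \<omega> = M' t \<omega>"
  shows "set_martingale P F M'"
  unfolding set_martingale_def
proof (intro conjI ad allI impI)
  show "integrable_process P M'"
    using mart set_rv_integrable_AE_eq[OF eq]
    by (simp add: set_martingale_def integrable_process_def)
  fix s t :: real assume st: "0 \<le> s" "s \<le> t"
  then obtain Y where Y: "has_set_cond_exp P (F s) (M t) Y" "AE \<omega> in P. Y \<omega> = M s \<omega>"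
    using mart by (auto simp: set_martingale_def)
  have "AE \<omega> in P. Y \<omega> = M' s \<omega>" using Y(2) eq[OF st(1)] by eventually_elim simp
  moreover have "has_set_cond_exp P (F s) (M' t) Y" using Y(1) has_set_cond_exp_AE_eq[OF eq] st by simp
  ultimately show "\<exists>Y. has_set_cond_exp P (F s) (M' t) Y \<and> (AE \<omega> in P. Y \<omega> = M' s \<omega>)" by blast
qed

theorem corollary4p3:
  fixes P :: "'a measure"
    and F :: "real \<Rightarrow> 'a measure"
    and M :: "real \<Rightarrow> 'a \<Rightarrow> 'b::euclidean_space set"
    and W :: "'b set"
  assumes "prob_space P"
    and "countable W" and "W \<subseteq> cball 0 1" and "cball 0 1 \<subseteq> closure W" and "0 \<notin> W"
    and "is_filtration P F" and "usual_conditions P F"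
    and "set_submartingale P F M"
    and "convex_process P M" and "integrably_bounded_process P M"
    and "\<forall>x\<in>W. \<forall>t\<ge>0.
           continuous (at_right t) (\<lambda>u. support_function x (set_expectation P (M u)))"
  shows "\<exists>M'. set_submartingale P F M' \<and> convex_process P M' \<and>
              integrably_bounded_process P M' \<and>
              (\<forall>t\<ge>0. AE \<omega> in P. M t \<omega> = M' t \<omega>) \<and>
              (AE \<omega> in P. hausdorff_cadlag (\<lambda>t. M' t \<omega>)) \<and>
              (set_martingale P F M \<longrightarrow> set_martingale P F M')"
proof -
  interpret bounded_convex_submartingale P F M
    using assms by (intro bounded_convex_submartingale.intro bounded_convex_submartingale_axioms.intro)
  have eq: "AE \<omega> in P. M t \<omega> = modification t \<omega>" if "0 \<le> t" for t
    using assms that by (intro AE_modification_eq AE_right_limit) auto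
  have ad: "set_adapted F modification"
    unfolding set_adapted_def
  proof (intro allI impI)
    fix t :: real assume t: "0 \<le> t"
    show "set_valued_rv (F t) (modification t)"
    proof (rule set_valued_rv_AE_eq[of P "F t" "M t"])
      have "sets (F 0) \<subseteq> sets (F t)" using filtration t by (auto simp: is_filtration_def)
      then show "null_sets P \<subseteq> sets (F t)" using usual unfolding usual_conditions_def by blast
      show "subalgebra P (F t)" using filtration t by (auto simp: is_filtration_def)
      show "complete_measure P" using usual unfolding usual_conditions_def by blast
      show "set_valued_rv (F t) (M t)"
        using submartingale t by (auto simp: set_submartingale_def set_adapted_def)
    qed (use eq[OF t] modification_values in auto)
  qed
  show ?thesis
  proof (intro exI[of _ modification] conjI allI impI)
    show "set_submartingale P F modification"
      using submartingale ad eq by (rule set_submartingale_modification)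
    show "convex_process P modification" by (simp add: convex_process_def modification_values)
    show "integrably_bounded_process P modification"
      using bounded_process set_rv_integrably_bounded_AE_eq[OF eq]
      by (simp add: integrably_bounded_process_def)
    show "AE \<omega> in P. hausdorff_cadlag (\<lambda>t. modification t \<omega>)"
      using assms(2,4) eq by (rule AE_modification_cadlag)
    show "set_martingale P F modification" if "set_martingale P F M"
      using that ad eq by (rule set_martingale_modification)
  qed (rule eq)
qed

end
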